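(* Let $\alpha,\beta\in\mathbb R$, let $g\in\tilde S'$, and suppose $\beta\ne-2^{j\alpha}$ for all $j\in\mathbb Z$. Consider the equation $$\mathcal D^\alpha f+\beta f=g\qquad( * )$$ with respect to the unknown $f$. Then: 1. Equation $( * )$ has a unique solution in $\tilde S'$. 2. The solution is in $L_2(G)$ whenever $g\in L_2(G)$ and $\beta\ne0$. 3. If $g$ is continuous on $G$, and either $\beta\neq0$, or $\beta=0$ and $\alpha>-1/2$, then all continuous solutions of $( * )$ are given by $$f_c=\sum_{k=0}^\infty a_k\varphi_{0,k}+\sum_{k,j\in\mathbb Z_+}\frac{\langle g,\psi_{j,k}\rangle}{2^{j\alpha}+\beta}\,\psi_{j,k}+c,$$ where $c$ is an arbitrary complex number and $(a_k)_{k\in\mathbb Z_+}$ is a solution of the system $$\sum_{m=0}^{2^{j-1}-1}a_{2^jk+m}-\sum_{m=2^{j-1}}^{2^j-1}a_{2^jk+m}=2^{j/2}a_{-j,k},\qquad j\in\mathbb N,\ k\in\mathbb Z_+,\qquad\text{with } a_{-j,k}=\frac{\langle g,\psi_{-j,k}\rangle}{2^{-j\alpha}+\beta}.$$ All the functions $f_c$ have the same Haar representation.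
   Context: $\mathbb N$ = positive integers, $\mathbb Z_+$ = non-negative integers. The Cantor dyadic group $G$ is the set of sequences $x=(x_k)_{k\in\mathbb Z}$, $x_k\in\{0,1\}$, such that $x_k=0$ for all $k$ below some index depending on $x$, with coordinatewise addition modulo 2, denoted $\oplus$; $\mathbf 0$ is the zero sequence. For $x\ne\mathbf 0$ let $N(x)$ be the least $k$ with $x_k=1$ and put $\|x\|=2^{-N(x)-1}$; $\|\mathbf 0\|=0$. The metric is $d(x,y)=\|x\oplus y\|$; balls are $I_n(x)=\{y: d(x,y)<2^{-n}\}$, $I_n=I_n(\mathbf 0)=\{x: x_k=0\ \forall k<n\}$, $I=I_0$. $dx$ is the Haar measure with $\int_Idx=1$. Let $\lambda(x)=\sum_{j}x_j2^{-j-1}$; restricted to the elements of $G$ that are not eventually equal to 1 (as $k\to+\infty$), $\lambda$ is a bijection onto $[0,\infty)$, and $\lambda^{-1}$ denotes its inverse. The dilation is $(Dx)_k=x_{k+1}$. For $f:G\to\mathbb C$, $j\in\mathbb Z$, $h\ge0$: $f_{j,h}(x)=2^{j/2}f(D^jx\oplus\lambda^{-1}(h))$. The Fourier–Walsh transform is $\widehat f(\xi)=\int_Gf(x)\mathrm w(\xi,x)\,dx$ for $f\in L_1(G)$, where $\mathrm w(t,x)=(-1)^{\sum_{k\in\mathbb Z}t_kx_{-k-1}}$. $\varphi=\mathbf 1_I$ and $\psi=2^{-1/2}(\varphi_{1,0}-\varphi_{1,1})$. The functions $\psi_{j,k}$ ($j\in\mathbb Z$, $k\in\mathbb Z_+$)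 form an orthonormal basis of $L_2(G)$ (Haar basis); so do the functions $\varphi_{0,k}$ ($k\in\mathbb Z_+$) together with $\psi_{j,k}$ ($j,k\in\mathbb Z_+$). $S$ is the space of locally constant compactly supported functions $G\to\mathbb C$; a sequence in $S$ converges to $0$ if all its members are supported in a common compact set, are all constant on every ball of one common fixed radius, and tend to zero uniformly. $S'$ is the space of continuous linear functionals on $S$. $\tilde S\subset S$ is the subspace of Haar polynomials (finite linear combinations of the $\psi_{j,k}$, $j\in\mathbb Z$, $k\in\mathbb Z_+$); $\tilde S'$ is the space of continuous linear functionals $f:\phi\mapsto\langle f,\phi\rangle$ on $\tilde S$. The Haar representation of $f\in\tilde S'$ is the formal series $\sum_{j\in\mathbb Z,k\in\mathbb Z_+}\langle f,\psi_{j,k}\rangle\psi_{j,k}$. An element of $S'$ is identified with its quasi-Haar representation, the formal series $\sum_{k\in\mathbb Z_+}\langle f,\varphi_{0,k}\rangle\varphi_{0,k}+\sum_{j,k\in\mathbb Z_+}\langle f,\psi_{j,k}\rangle\psi_{j,k}$. A locally integrable function $f$ is regarded as an element of $S'$ (and, by restriction, of $\tilde S'$) via $\langle f,\phi\rangle=\int_Gf\phi\,dx$; a function is a solution of an equation in $\tilde S'$ if the element of $\tilde S'$ it defines is one (different functions may define the same element of $\tilde S'$), and "the solution is in $L_2(G)$" means it is given by an $L_2(G)$ function. For $\alpha\in\mathbb R$ put $\mathbb D^\alpha(x)=\|x\|^\alpha$ for $x\neq\mathbf 0$, $\mathbb D^\alpha(\mathbf 0)=1$. The fractional modified Gibbs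 derivative $\mathcal D^\alpha:\tilde S\to\tilde S$ is defined by $\widehat{\mathcal D^\alpha\phi}=\mathbb D^\alpha\widehat\phi$ (a bijection of $\tilde S$), and is extended to $\tilde S'$ by $\langle\mathcal D^\alpha f,\phi\rangle=\langle f,\mathcal D^\alpha\phi\rangle$, $\phi\in\tilde S$.
   Formalization: In part 3, continuity of every f_c is asserted only if β≠0 or α≥0; for β=0, -1/2<α<0 it can fail (α=-1/4, g=Σ j^{-2}(-1)^{x_j}1_I). There the formal claim is that a continuous function solves ( * ) iff it equals some f_c. *)

theory Defs
  imports "HOL-Analysis.Analysis" "HOL-Library.Z2"
begin

section \<open>The Cantor dyadic group\<close>

typedef cantor = "{x :: int \<Rightarrow> bit. \<exists>n. \<forall>k<n. x k = 0}"
  morphisms coord Abs_cantor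
  by (rule exI[of _ "\<lambda>_. 0"]) simp

lemma cantor_eq_iff: "x = y \<longleftrightarrow> (\<forall>k. coord x k = coord y k)"
  by (metis coord_inject ext)

lemma coord_bounded_below: "\<exists>n. \<forall>k<n. coord x k = 0"
  using coord[of x] by simp

text \<open>The group operation of the dyadic group is written \<open>+\<close>.\<close>

instantiation cantor :: ab_group_add
begin

definition zero_cantor :: cantor where
  "zero_cantor = Abs_cantor (\<lambda>_. 0)"

definition plus_cantor :: "cantor \<Rightarrow> cantor \<Rightarrow> cantor" where
  "plus_cantor x y = Abs_cantor (\<lambda>k. coord x k + coord y k)"

definition uminus_cantor :: "cantor \<Rightarrow> cantor" where
  "uminus_cantor x = x"

definition minus_cantor :: "cantor \<Rightarrow> cantor \<Rightarrow> cantor" where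
  "minus_cantor x y = (x :: cantor) + y"

lemma coord_zero [simp]: "coord 0 k = 0"
  unfolding zero_cantor_def by (subst Abs_cantor_inverse) auto

lemma coord_plus [simp]: "coord (x + y) k = coord x k + coord y k"
proof -
  obtain m n where "\<forall>k<m. coord x k = 0" "\<forall>k<n. coord y k = 0"
    using coord_bounded_below by metis
  then have "\<forall>k<min m n. coord x k + coord y k = 0" by simp
  then have "(\<lambda>k. coord x k + coord y k) \<in> {x. \<exists>n. \<forall>k<n. x k = 0}" by blast
  then show ?thesis unfolding plus_cantor_def by (simp add: Abs_cantor_inverse)
qed

instance
proof
  fix a b c :: cantor
  show "a + b + c = a + (b + c)" unfolding cantor_eq_iff coord_plus by (intro allI add.assoc)
  show "a + b = b + a" unfolding cantor_eq_iff coord_plus by (intro allI add.commute)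
  show "0 + a = a" by (simp add: cantor_eq_iff)
  show "- a + a = 0"
    unfolding cantor_eq_iff uminus_cantor_def coord_plus coord_zero by simp
  show "a - b = a + - b" by (simp add: minus_cantor_def uminus_cantor_def)
qed

end

definition first_one :: "cantor \<Rightarrow> int" where
  "first_one x = (LEAST k. coord x k = 1)"

definition cnorm :: "cantor \<Rightarrow> real" where
  "cnorm x = (if x = 0 then 0 else 2 powi (- first_one x - 1))"

lemma first_one:
  assumes "x \<noteq> 0"
  shows "coord x (first_one x) = 1" and "k < first_one x \<Longrightarrow> coord x k = 0"
proof -
  obtain n where n: "\<forall>k<n. coord x k = 0" using coord_bounded_below by blast
  obtain k0 where k0: "coord x k0 = 1" using assms by (auto simp: cantor_eq_iff)
  have *: "\<exists>l. coord x l = 1 \<and> (\<forall>k. coord x k = 1 \<longrightarrow> l \<le> k)"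
  proof -
    let ?P = "\<lambda>i::nat. coord x (n + int i) = 1"
    have "n \<le> k0" using n k0 by (metis not_le zero_neq_one)
    then have "?P (nat (k0 - n))" using k0 by simp
    then have P: "?P (Least ?P)" by (rule LeastI)
    have "n + int (Least ?P) \<le> k" if "coord x k = 1" for k
    proof -
      have "n \<le> k" using n that by (metis not_le zero_neq_one)
      then have "?P (nat (k - n))" using that by simp
      then have "Least ?P \<le> nat (k - n)" by (rule Least_le)
      then show ?thesis using \<open>n \<le> k\<close> by linarith
    qed
    then show ?thesis using P by blast
  qed
  then obtain l where l: "coord x l = 1" "\<And>k. coord x k = 1 \<Longrightarrow> l \<le> k" by blast
  have "first_one x = l" unfolding first_one_def using l by (intro Least_equality)
  then show "coord x (first_one x) = 1" "k < first_one x \<Longrightarrow> coord x k = 0"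
    using l by (auto, metis bit_not_one_iff not_le)
qed

lemma cnorm_less_iff: "cnorm x < 2 powi (- n) \<longleftrightarrow> (\<forall>k<n. coord x k = 0)"
proof (cases "x = 0")
  case False
  have "cnorm x < 2 powi (- n) \<longleftrightarrow> - first_one x - 1 < - n"
    using False power_int_strict_increasing[of "- first_one x - 1" "- n" "2::real"]
      power_int_increasing[of "- n" "- first_one x - 1" "2::real"]
    by (simp add: cnorm_def) linarith
  also have "\<dots> \<longleftrightarrow> (\<forall>k<n. coord x k = 0)"
  proof
    assume "- first_one x - 1 < - n"
    then have "n \<le> first_one x" by linarith
    then show "\<forall>k<n. coord x k = 0" using first_one(2)[OF False] by (meson less_le_trans)
  next
    assume "\<forall>k<n. coord x k = 0"
    then have "n \<le> first_one x" using first_one(1)[OF False] by (metis not_le zero_neq_one)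
    then show "- first_one x - 1 < - n" by linarith
  qed
  finally show ?thesis .
qed (simp add: cnorm_def)

lemma cnorm_ultra: "cnorm (x + y) \<le> max (cnorm x) (cnorm y)"
proof (cases "x + y = 0")
  case True
  then show ?thesis by (simp add: cnorm_def le_max_iff_disj)
next
  case False
  let ?n = "first_one (x + y)"
  have e: "cnorm (x + y) = 2 powi (- (?n + 1))" using False by (simp add: cnorm_def)
  have "coord (x + y) ?n = 1" by (rule first_one(1)[OF False])
  then have "coord x ?n \<noteq> 0 \<or> coord y ?n \<noteq> 0" by auto
  then have "\<not> cnorm x < cnorm (x + y) \<or> \<not> cnorm y < cnorm (x + y)"
    unfolding e cnorm_less_iff by (metis less_add_one)
  then show ?thesis by linarith
qed

instantiation cantor :: metric_space
begin

definition dist_cantor :: "cantor \<Rightarrow> cantor \<Rightarrow> real" where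
  "dist_cantor x y = cnorm (x + y)"

definition uniformity_cantor :: "(cantor \<times> cantor) filter" where
  "uniformity_cantor = (INF e\<in>{0 <..}. principal {(x, y). dist x y < e})"

definition open_cantor :: "cantor set \<Rightarrow> bool" where
  "open_cantor U = (\<forall>x\<in>U. eventually (\<lambda>(x', y). x' = x \<longrightarrow> y \<in> U) uniformity)"

instance
proof
  fix x y z :: cantor
  have self: "a + a = 0" for a :: cantor
    by (metis add.left_inverse uminus_cantor_def)
  show "(dist x y = 0) = (x = y)"
    unfolding dist_cantor_def cnorm_def
    by (auto simp: self) (metis eq_neg_iff_add_eq_0 uminus_cantor_def)
  have nonneg: "cnorm a \<ge> 0" for a by (simp add: cnorm_def)
  have "x + y = (x + z) + (y + z)"
    using self[of z] by (metis add.assoc add.commute add.right_neutral)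
  then have "cnorm (x + y) \<le> max (cnorm (x + z)) (cnorm (y + z))"
    using cnorm_ultra by metis
  then show "dist x y \<le> dist x z + dist y z"
    unfolding dist_cantor_def using nonneg[of "x + z"] nonneg[of "y + z"] by linarith
qed (simp_all add: uniformity_cantor_def open_cantor_def)

end

definition unit_ball :: "cantor set" where
  "unit_ball = ball 0 1"

lemma unit_ball_iff: "x \<in> unit_ball \<longleftrightarrow> (\<forall>k<0. coord x k = 0)"
  using cnorm_less_iff[of x 0] by (simp add: unit_ball_def dist_cantor_def)

definition dilate :: "int \<Rightarrow> cantor \<Rightarrow> cantor" where
  "dilate j x = Abs_cantor (\<lambda>k. coord x (k + j))"

lemma coord_dilate [simp]: "coord (dilate j x) k = coord x (k + j)"
proof -
  obtain n where "\<forall>k<n. coord x k = 0" using coord_bounded_below by blast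
  then have "\<forall>k<n - j. coord x (k + j) = 0" by simp
  then have "(\<lambda>k. coord x (k + j)) \<in> {x. \<exists>n. \<forall>k<n. x k = 0}" by blast
  then show ?thesis unfolding dilate_def by (simp add: Abs_cantor_inverse)
qed

definition lam :: "cantor \<Rightarrow> real" where
  "lam x = (\<Sum>\<^sub>\<infinity>j. of_bit (coord x j) * 2 powi (- j - 1))"

definition lam_inv :: "real \<Rightarrow> cantor" where
  "lam_inv = inv_into {x. \<not> (\<forall>\<^sub>F k in at_top. coord x k = 1)} lam"


section \<open>Haar measure and the Walsh transform\<close>

text \<open>Local finiteness needs no separate clause: a compact set is covered by finitely many
  translates of the unit ball, and each of these has measure \<open>1\<close>.\<close>

definition is_haar_measure :: "cantor measure \<Rightarrow> bool" where
  "is_haar_measure \<mu> \<longleftrightarrow> sets \<mu> = sets borel \<and>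
     (\<forall>a. \<forall>A\<in>sets borel. emeasure \<mu> ((+) a ` A) = emeasure \<mu> A) \<and>
     emeasure \<mu> unit_ball = 1"

definition haar :: "cantor measure" where
  "haar = (THE \<mu>. is_haar_measure \<mu>)"

text \<open>Only finitely many products \<open>t\<^sub>k x\<^sub>-\<^sub>k\<^sub>-\<^sub>1\<close> are nonzero,
  so their sum is the cardinality below.\<close>

definition walsh :: "cantor \<Rightarrow> cantor \<Rightarrow> complex" where
  "walsh t x = (-1) ^ card {k. coord t k * coord x (- k - 1) = 1}"

definition walsh_transform :: "(cantor \<Rightarrow> complex) \<Rightarrow> cantor \<Rightarrow> complex" where
  "walsh_transform f \<xi> = (LINT x|haar. f x * walsh \<xi> x)"


section \<open>The Haar system\<close>

definition shift_dilate :: "int \<Rightarrow> real \<Rightarrow> (cantor \<Rightarrow> complex) \<Rightarrow> cantor \<Rightarrow> complex" where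
  "shift_dilate j h f x = of_real (2 powr (real_of_int j / 2)) * f (dilate j x + lam_inv h)"

definition haar_phi :: "cantor \<Rightarrow> complex" where
  "haar_phi = indicator unit_ball"

definition haar_psi :: "cantor \<Rightarrow> complex" where
  "haar_psi x = of_real (2 powr (- 1 / 2)) *
     (shift_dilate 1 0 haar_phi x - shift_dilate 1 1 haar_phi x)"

abbreviation phi_jk :: "int \<Rightarrow> nat \<Rightarrow> cantor \<Rightarrow> complex" where
  "phi_jk j k \<equiv> shift_dilate j (real k) haar_phi"

abbreviation psi_jk :: "int \<Rightarrow> nat \<Rightarrow> cantor \<Rightarrow> complex" where
  "psi_jk j k \<equiv> shift_dilate j (real k) haar_psi"


section \<open>Test functions and distributions\<close>

definition test_fun :: "(cantor \<Rightarrow> complex) set" where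
  "test_fun = {f. (\<forall>x. \<forall>\<^sub>F y in nhds x. f y = f x) \<and>
                  (\<exists>K. compact K \<and> (\<forall>x. x \<notin> K \<longrightarrow> f x = 0))}"

definition haar_poly :: "(cantor \<Rightarrow> complex) set" where
  "haar_poly = {f. \<exists>A c. finite A \<and> f = (\<lambda>x. \<Sum>(j, k)\<in>A. c j k * psi_jk j k x)}"

definition null_seq :: "(nat \<Rightarrow> cantor \<Rightarrow> complex) \<Rightarrow> bool" where
  "null_seq u \<longleftrightarrow>
     (\<exists>K. compact K \<and> (\<forall>i x. x \<notin> K \<longrightarrow> u i x = 0)) \<and>
     (\<exists>n::int. \<forall>i x. \<forall>y\<in>ball x (2 powi (- n)). u i y = u i x) \<and>
     uniform_limit UNIV u (\<lambda>_. 0) sequentially"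

text \<open>Continuous linear functionals on a subspace \<open>V\<close> of \<^const>\<open>test_fun\<close>. They are
  \<^const>\<open>extensional\<close>, so that equality of functionals is equality of their values on \<open>V\<close>.\<close>

definition dual :: "(cantor \<Rightarrow> complex) set \<Rightarrow> ((cantor \<Rightarrow> complex) \<Rightarrow> complex) set" where
  "dual V = {F \<in> extensional V.
     (\<forall>\<phi>\<in>V. \<forall>\<theta>\<in>V. F (\<lambda>x. \<phi> x + \<theta> x) = F \<phi> + F \<theta>) \<and>
     (\<forall>c. \<forall>\<phi>\<in>V. F (\<lambda>x. c * \<phi> x) = c * F \<phi>) \<and>
     (\<forall>u. (\<forall>i. u i \<in> V) \<and> null_seq u \<longrightarrow> (\<lambda>i. F (u i)) \<longlonglongrightarrow> 0)}"

text \<open>Only used for locally integrable \<open>f\<close> (continuous or in \<open>L\<^sub>2\<close>), where all integrals below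
  exist.\<close>

definition regular :: "(cantor \<Rightarrow> complex) set \<Rightarrow> (cantor \<Rightarrow> complex) \<Rightarrow> (cantor \<Rightarrow> complex) \<Rightarrow> complex" where
  "regular V f = (\<lambda>\<phi>\<in>V. LINT x|haar. f x * \<phi> x)"

definition in_L2 :: "(cantor \<Rightarrow> complex) \<Rightarrow> bool" where
  "in_L2 f \<longleftrightarrow> f \<in> borel_measurable haar \<and> integrable haar (\<lambda>x. (cmod (f x))\<^sup>2)"

definition haar_repr :: "((cantor \<Rightarrow> complex) \<Rightarrow> complex) \<Rightarrow> int \<Rightarrow> nat \<Rightarrow> complex" where
  "haar_repr F j k = F (psi_jk j k)"

text \<open>The element of \<open>dual test_fun\<close> whose quasi-Haar representation is the formal series
  with coefficients \<open>a\<close>, \<open>b\<close>. Paired with a test function, the series has only finitely many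
  nonzero terms.\<close>

definition quasi_haar_series ::
  "(nat \<Rightarrow> complex) \<Rightarrow> (nat \<Rightarrow> nat \<Rightarrow> complex) \<Rightarrow> (cantor \<Rightarrow> complex) \<Rightarrow> complex" where
  "quasi_haar_series a b = (\<lambda>\<phi>\<in>test_fun.
     (\<Sum>\<^sub>\<infinity>k. a k * regular test_fun (phi_jk 0 k) \<phi>) +
     (\<Sum>\<^sub>\<infinity>(j, k). b j k * regular test_fun (psi_jk (int j) k) \<phi>))"


section \<open>The modified Gibbs derivative\<close>

definition gibbs_symbol :: "real \<Rightarrow> cantor \<Rightarrow> real" where
  "gibbs_symbol \<alpha> x = (if x = 0 then 1 else cnorm x powr \<alpha>)"

definition gibbs :: "real \<Rightarrow> (cantor \<Rightarrow> complex) \<Rightarrow> cantor \<Rightarrow> complex" where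
  "gibbs \<alpha> \<phi> = (THE \<theta>. \<theta> \<in> haar_poly \<and>
     (\<forall>\<xi>. walsh_transform \<theta> \<xi> = of_real (gibbs_symbol \<alpha> \<xi>) * walsh_transform \<phi> \<xi>))"

definition gibbs_dual ::
  "real \<Rightarrow> ((cantor \<Rightarrow> complex) \<Rightarrow> complex) \<Rightarrow> (cantor \<Rightarrow> complex) \<Rightarrow> complex" where
  "gibbs_dual \<alpha> f = (\<lambda>\<phi>\<in>haar_poly. f (gibbs \<alpha> \<phi>))"

definition solves ::
  "real \<Rightarrow> real \<Rightarrow> ((cantor \<Rightarrow> complex) \<Rightarrow> complex) \<Rightarrow> ((cantor \<Rightarrow> complex) \<Rightarrow> complex) \<Rightarrow> bool" where
  "solves \<alpha> \<beta> g f \<longleftrightarrow> f \<in> dual haar_poly \<and>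
     (\<forall>\<phi>\<in>haar_poly. gibbs_dual \<alpha> f \<phi> + of_real \<beta> * f \<phi> = g \<phi>)"

definition sol_coeff ::
  "real \<Rightarrow> real \<Rightarrow> ((cantor \<Rightarrow> complex) \<Rightarrow> complex) \<Rightarrow> int \<Rightarrow> nat \<Rightarrow> complex" where
  "sol_coeff \<alpha> \<beta> g j k = g (psi_jk j k) / of_real (2 powr (real_of_int j * \<alpha>) + \<beta>)"

definition coeff_system ::
  "real \<Rightarrow> real \<Rightarrow> ((cantor \<Rightarrow> complex) \<Rightarrow> complex) \<Rightarrow> (nat \<Rightarrow> complex) \<Rightarrow> bool" where
  "coeff_system \<alpha> \<beta> g a \<longleftrightarrow> (\<forall>j\<ge>1. \<forall>k.
     (\<Sum>m = 0..<2 ^ (j - 1). a (2 ^ j * k + m)) - (\<Sum>m = 2 ^ (j - 1)..<2 ^ j. a (2 ^ j * k + m))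
     = of_real (2 powr (real j / 2)) * sol_coeff \<alpha> \<beta> g (- int j) k)"

definition sol_family ::
  "real \<Rightarrow> real \<Rightarrow> ((cantor \<Rightarrow> complex) \<Rightarrow> complex) \<Rightarrow> (nat \<Rightarrow> complex) \<Rightarrow> complex \<Rightarrow>
   (cantor \<Rightarrow> complex) \<Rightarrow> complex" where
  "sol_family \<alpha> \<beta> g a c = (\<lambda>\<phi>\<in>test_fun.
     quasi_haar_series a (\<lambda>j k. sol_coeff \<alpha> \<beta> g (int j) k) \<phi> + regular test_fun (\<lambda>_. c) \<phi>)"

end

theory Submission
  imports Defs
begin

text \<open>The Gibbs derivative is diagonal in the Haar basis: the Walsh transform of \<open>\<psi>\<^sub>j\<^sub>k\<close> lives on the
  sphere \<open>\<parallel>\<xi>\<parallel> = 2\<^sup>j\<close>, so \<open>\<psi>\<^sub>j\<^sub>k\<close> is an eigenfunction with eigenvalue \<open>2\<close> to the power \<open>j\<alpha>\<close>. The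
  equation therefore just prescribes the pairings of \<open>f\<close> with all \<open>\<psi>\<^sub>j\<^sub>k\<close>, which settles existence
  and uniqueness. The \<open>L\<^sub>2\<close> claim is Riesz--Fischer with a bounded multiplier.

  A functional on test functions that kills all Haar polynomials is a multiple of the integral,
  because \<open>\<phi> - (\<integral>\<phi>) \<one>\<^sub>I\<close> is a Haar polynomial for every test function \<open>\<phi>\<close>. This accounts for the
  constant \<open>c\<close>. The linear system for \<open>(a\<^sub>k)\<close> expresses the pairings with \<open>\<psi>\<^sub>-\<^sub>j\<^sub>,\<^sub>k\<close>, which is a finite
  signed sum of the \<open>\<phi>\<^sub>0\<^sub>k\<close>. Continuity of the solution comes from Abel summation, since the
  multiplier \<open>1 / (2\<^sup>j\<^sup>\<alpha> + \<beta>)\<close> has bounded variation over \<open>j \<ge> 0\<close>.\<close>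

section \<open>Cylinders\<close>

text \<open>Three objects are given only by description and must be pinned down before anything can
  be computed: \<open>haar\<close> by existence and uniqueness, \<open>lam_inv\<close> by locating
  the preimages of the integers, and \<open>gibbs\<close> by injectivity of the Walsh transform on
  test functions. Coordinates make this possible: balls become cylinders, and the cylinders of one
  level are numbered by binary digits.

  Continuity of functionals is automatic. This holds on \<open>test_fun\<close>, and it passes to
  \<open>haar_poly\<close> because a linear functional there extends linearly to
  \<open>test_fun\<close>. Hence arbitrary Haar coefficients define an element of
  \<open>dual haar_poly\<close>, and solving the equation amounts to dividing coefficient by
  coefficient.\<close>

definition cyl :: "int \<Rightarrow> cantor \<Rightarrow> cantor set" where
  "cyl n a = {x. \<forall>k<n. coord x k = coord a k}"

lemma mem_cyl: "x \<in> cyl n a \<longleftrightarrow> (\<forall>k<n. coord x k = coord a k)"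
  by (simp add: cyl_def)

lemma self_mem_cyl [simp]: "a \<in> cyl n a"
  by (simp add: mem_cyl)

lemma bit_add_eq_0_iff: "a + b = 0 \<longleftrightarrow> a = b" for a b :: bit
  by (cases a; cases b) auto

lemma cantor_add_self: "x + x = 0" for x :: cantor
  unfolding cantor_eq_iff coord_plus bit_add_eq_0_iff by simp

lemma cyl_eq_ball: "cyl n a = ball a (2 powi (- n))"
  unfolding cyl_def ball_def dist_cantor_def cnorm_less_iff coord_plus bit_add_eq_0_iff
  by auto

lemma cyl_eqI: "x \<in> cyl n a \<Longrightarrow> cyl n x = cyl n a"
  by (auto simp: cyl_def)

lemma mem_cyl_sym: "x \<in> cyl n a \<longleftrightarrow> a \<in> cyl n x"
  by (auto simp: cyl_def)

lemma cyl_mono: "m \<le> n \<Longrightarrow> cyl n a \<subseteq> cyl m a"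
  by (auto simp: cyl_def)

lemma mem_cyl_mono: "x \<in> cyl n a \<Longrightarrow> m \<le> n \<Longrightarrow> x \<in> cyl m a"
  by (auto simp: cyl_def)

lemma cyl_subset: "x \<in> cyl m a \<Longrightarrow> m \<le> n \<Longrightarrow> cyl n x \<subseteq> cyl m a"
  by (auto simp: cyl_def)

text \<open>Ultrametric dichotomy, together with \<open>cyl_subset\<close>: a finer cylinder lies
  inside a coarser one or misses it.\<close>

lemma cyl_disjoint: "b \<notin> cyl m a \<Longrightarrow> m \<le> n \<Longrightarrow> cyl n b \<inter> cyl m a = {}"
  by (force simp: cyl_def)

lemma open_cyl [simp]: "open (cyl n a)"
  by (simp add: cyl_eq_ball)

lemma closed_cyl [simp]: "closed (cyl n a)"
proof -
  have "cyl n b \<subseteq> - cyl n a" if "b \<notin> cyl n a" for b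
    using cyl_disjoint[OF that order_refl] by blast
  moreover have "b \<in> cyl n b" for b by simp
  ultimately have "- cyl n a = (\<Union>b\<in>- cyl n a. cyl n b)" by blast
  then have "open (- cyl n a)" by (metis open_UN open_cyl)
  then show ?thesis by (simp add: closed_def)
qed

lemma exists_cyl_subset:
  assumes "open U" "x \<in> U" shows "\<exists>n\<ge>m. cyl n x \<subseteq> U"
proof -
  obtain e where e: "e > 0" "ball x e \<subseteq> U" using assms open_contains_ball by blast
  obtain i :: nat where i: "(1 / 2) ^ i < e" using real_arch_pow_inv[of e "1/2"] e by auto
  let ?n = "max m (int i)"
  have "(2::real) powi (- ?n) \<le> 2 powi (- int i)" by (intro power_int_increasing) auto
  also have "\<dots> = (1 / 2) ^ i" by (simp add: power_int_minus divide_simps)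
  finally have "cyl ?n x \<subseteq> U" using i e unfolding cyl_eq_ball by auto
  then show ?thesis by (intro exI[of _ ?n]) auto
qed

text \<open>Coordinates are bounded below, so every point enters some cylinder around zero. Upward
  inductions on the level can start there, and these cylinders exhaust the group.\<close>

lemma exists_mem_cyl_zero: "\<exists>n\<le>m. x \<in> cyl n 0"
proof -
  obtain n where "\<forall>k<n. coord x k = 0" using coord_bounded_below by blast
  then show ?thesis by (intro exI[of _ "min m n"]) (auto simp: mem_cyl)
qed

text \<open>Translation by \<open>single n\<close> exchanges the two halves of every cylinder of
  level n.\<close>

definition single :: "int \<Rightarrow> cantor" where
  "single n = Abs_cantor (\<lambda>k. if k = n then 1 else 0)"

lemma coord_single [simp]: "coord (single n) k = (if k = n then 1 else 0)"
proof -
  have "(\<lambda>k. if k = n then 1 else 0 :: bit) \<in> {x. \<exists>n. \<forall>k<n. x k = 0}" by auto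
  then show ?thesis by (simp add: single_def Abs_cantor_inverse)
qed

lemma mem_cyl_Suc: "x \<in> cyl (n + 1) a \<longleftrightarrow> coord x n = coord a n \<and> x \<in> cyl n a"
proof -
  have "k < n + 1 \<longleftrightarrow> k = n \<or> k < n" for k by auto
  then show ?thesis by (auto simp: mem_cyl)
qed

lemma bit_add_1_eq_iff: "a = b + 1 \<longleftrightarrow> a \<noteq> b" for a b :: bit
  by (cases a; cases b) auto

lemma coord_add_single: "coord (a + single n) k = (if k = n then coord a k + 1 else coord a k)"
  unfolding coord_plus coord_single by simp

lemma cyl_split: "cyl n a = cyl (n + 1) a \<union> cyl (n + 1) (a + single n)"
proof (intro set_eqI)
  fix x
  have "x \<in> cyl n (a + single n) \<longleftrightarrow> x \<in> cyl n a"
    unfolding mem_cyl coord_add_single by auto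
  moreover have "coord x n = coord (a + single n) n \<longleftrightarrow> coord x n \<noteq> coord a n"
    unfolding coord_add_single by (simp only: bit_add_1_eq_iff refl if_True)
  ultimately show "x \<in> cyl n a \<longleftrightarrow> x \<in> cyl (n + 1) a \<union> cyl (n + 1) (a + single n)"
    unfolding Un_iff mem_cyl_Suc by blast
qed

lemma add_single_notin_cyl: "a + single n \<notin> cyl (n + 1) a"
  unfolding mem_cyl_Suc coord_add_single by (cases "coord a n") auto

lemma cyl_split_disjoint: "cyl (n + 1) a \<inter> cyl (n + 1) (a + single n) = {}"
  using cyl_disjoint[OF add_single_notin_cyl, of n "n + 1" a] by blast

section \<open>Total boundedness, completeness and compactness of cylinders\<close>

lemma cyl_finite_cover:
  "\<exists>T. finite T \<and> cyl m a \<subseteq> (\<Union>b\<in>T. cyl n b)"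
proof (cases "m \<le> n")
  case True
  then show ?thesis
  proof (induction n rule: int_ge_induct)
    case base
    show ?case by (intro exI[of _ "{a}"]) auto
  next
    case (step n)
    then obtain T where T: "finite T" "cyl m a \<subseteq> (\<Union>b\<in>T. cyl n b)" by blast
    note T(2)
    also have "(\<Union>b\<in>T. cyl n b) = (\<Union>b\<in>T \<union> (\<lambda>b. b + single n) ` T. cyl (n + 1) b)"
      unfolding cyl_split[of n] by blast
    finally show ?case using T(1) by (meson finite_UnI finite_imageI)
  qed
next
  case False
  then have "cyl m a \<subseteq> (\<Union>b\<in>{a}. cyl n b)" using cyl_mono[of n m a] by auto
  then show ?thesis by blast
qed

lemma complete_cyl: "complete (cyl n a)"
  unfolding complete_def
proof (intro allI impI)
  fix u assume "(\<forall>i. u i \<in> cyl n a) \<and> Cauchy u"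
  then have u: "\<And>i. u i \<in> cyl n a" and C: "Cauchy u" by auto
  have "\<exists>N. \<forall>i\<ge>N. u i \<in> cyl l (u N)" for l
  proof -
    obtain N where "\<forall>i\<ge>N. \<forall>j\<ge>N. dist (u i) (u j) < 2 powi (- l)"
      using C unfolding Cauchy_def by (metis zero_less_numeral zero_less_power_int)
    then show ?thesis by (intro exI[of _ N]) (auto simp: cyl_eq_ball)
  qed
  then obtain N where N: "\<And>l i. i \<ge> N l \<Longrightarrow> u i \<in> cyl l (u (N l))" by metis
  obtain z where z: "\<forall>k<z. coord a k = 0" using coord_bounded_below by blast
  \<comment> \<open>Below n the coordinates come from \<open>a\<close>, which puts the limit into
    the cylinder and keeps its coordinates bounded below. From n on, level k + 1 is used because it
    is the first whose cylinders fix coordinate k.\<close>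
  define xs where "xs = (\<lambda>k. if k < n then coord a k else coord (u (N (k + 1))) k)"
  have "\<forall>k<min n z. xs k = 0" using z by (simp add: xs_def)
  then have "xs \<in> {x. \<exists>n. \<forall>k<n. x k = 0}" by blast
  then have x: "coord (Abs_cantor xs) k = xs k" for k by (simp add: Abs_cantor_inverse)
  define x where "x = Abs_cantor xs"
  note x = x[folded x_def]
  have near: "u i \<in> cyl l x" if "i \<ge> N l" for i l
    unfolding mem_cyl
  proof (intro allI impI)
    fix k assume k: "k < l"
    show "coord (u i) k = coord x k"
    proof (cases "k < n")
      case True
      then show ?thesis using u[of i] by (simp add: mem_cyl x xs_def)
    next
      case False
      let ?i = "max (N l) (N (k + 1))"
      have "coord (u i) k = coord (u (N l)) k" using N[OF that] k by (simp add: mem_cyl)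
      also have "\<dots> = coord (u ?i) k" using N[of l ?i] k by (simp add: mem_cyl)
      also have "\<dots> = coord (u (N (k + 1))) k" using N[of "k + 1" ?i] by (simp add: mem_cyl)
      finally show ?thesis using False by (simp add: x xs_def)
    qed
  qed
  have "u \<longlonglongrightarrow> x"
  proof (rule topological_tendstoI)
    fix U assume "open U" "x \<in> U"
    then obtain l where "cyl l x \<subseteq> U" using exists_cyl_subset by blast
    then show "\<forall>\<^sub>F i in sequentially. u i \<in> U"
      using near[of l] unfolding eventually_sequentially by blast
  qed
  moreover have "x \<in> cyl n a" by (simp add: mem_cyl x xs_def)
  ultimately show "\<exists>x\<in>cyl n a. u \<longlonglongrightarrow> x" by blast
qed

lemma compact_cyl [simp]: "compact (cyl n a)"
  unfolding compact_eq_totally_bounded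
proof (intro conjI allI impI complete_cyl)
  fix e :: real assume "e > 0"
  obtain i :: nat where i: "(1 / 2) ^ i < e" using real_arch_pow_inv[of e "1/2"] \<open>e > 0\<close> by auto
  have "(1 / 2 :: real) ^ i = 2 powi (- int i)"
    by (simp add: power_int_minus divide_simps)
  then have sub: "cyl (int i) b \<subseteq> ball b e" for b using i by (auto simp: cyl_eq_ball)
  obtain T where T: "finite T" "cyl n a \<subseteq> (\<Union>b\<in>T. cyl (int i) b)"
    using cyl_finite_cover[of n a "int i"] by (elim exE conjE)
  note T(2)
  also have "(\<Union>b\<in>T. cyl (int i) b) \<subseteq> (\<Union>b\<in>T. ball b e)" by (intro UN_mono sub order_refl)
  finally show "\<exists>k. finite k \<and> cyl n a \<subseteq> (\<Union>x\<in>k. ball x e)" using T(1) by blast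
qed

text \<open>The point \<open>cpt j k\<close> is \<open>D\<^sup>-\<^sup>j (\<lambda>\<^sup>-\<^sup>1 k)\<close>; as \<open>k\<close> varies, these points represent all cylinders
  of level \<open>j\<close>.\<close>

definition cpt :: "int \<Rightarrow> nat \<Rightarrow> cantor" where
  "cpt j k = Abs_cantor (\<lambda>l. if l < j then of_bool (bit k (nat (j - l - 1))) else 0)"

lemma coord_cpt [simp]:
  "coord (cpt j k) l = (if l < j then of_bool (bit k (nat (j - l - 1))) else 0)"
proof -
  \<comment> \<open>Since k < 2^k, the number k has no binary digit at place k or beyond; hence the
    sequence vanishes far to the left.\<close>
  have "\<not> bit k (nat (j - l - 1))" if "l < j - int k" for l
  proof -
    have "k < 2 ^ nat (j - l - 1)" using that by (intro less_exp[THEN less_le_trans] power_increasing) auto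
    then show ?thesis by (simp add: bit_iff_odd)
  qed
  then have "(\<lambda>l. if l < j then of_bool (bit k (nat (j - l - 1))) else 0 :: bit)
      \<in> {x. \<exists>n. \<forall>k<n. x k = 0}" by (intro CollectI exI[of _ "j - int k"]) simp
  then show ?thesis unfolding cpt_def by (simp add: Abs_cantor_inverse)
qed

lemma cpt_zero [simp]: "cpt j 0 = 0"
  by (simp add: cantor_eq_iff)

lemma dilate_cpt: "dilate i (cpt j k) = cpt (j - i) k"
  by (simp add: cantor_eq_iff algebra_simps)

text \<open>Refining by one level shifts the binary digits of the index by one place and appends
  coordinate j as the new last digit.\<close>

lemma mem_cyl_cpt_step:
  assumes "x \<in> cyl j (cpt j k)"
  shows "x \<in> cyl (j + 1) (cpt (j + 1) (2 * k + of_bool (coord x j = 1)))"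
  unfolding mem_cyl
proof (intro allI impI)
  fix l assume l: "l < j + 1"
  show "coord x l = coord (cpt (j + 1) (2 * k + of_bool (coord x j = 1))) l"
  proof (cases "l = j")
    case True
    then show ?thesis by (cases "coord x j") (auto simp: bit_0)
  next
    case False
    then have n: "nat (j - l) = Suc (nat (j - l - 1))" using l by simp
    show ?thesis using assms l False by (simp add: mem_cyl n bit_Suc)
  qed
qed

lemma exists_cyl_cpt: "\<exists>k. x \<in> cyl j (cpt j k)"
proof -
  obtain n where n: "n \<le> j" "x \<in> cyl n 0" using exists_mem_cyl_zero by blast
  from n(1) show ?thesis
  proof (induction j rule: int_ge_induct)
    case base
    show ?case using n(2) by (intro exI[of _ 0]) simp
  next
    case (step j)
    then show ?case using mem_cyl_cpt_step by blast
  qed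
qed

text \<open>Coarsening by i levels deletes the last i binary digits of the index.\<close>

lemma cpt_mem_cyl_cpt_iff:
  "cpt j k \<in> cyl (j - int i) (cpt (j - int i) m) \<longleftrightarrow> m = k div 2 ^ i"
proof -
  have "cpt j k \<in> cyl (j - int i) (cpt (j - int i) m) \<longleftrightarrow>
      (\<forall>l<j - int i. bit k (nat (j - l - 1)) \<longleftrightarrow> bit m (nat (j - int i - l - 1)))"
    by (auto simp: mem_cyl)
  also have "\<dots> \<longleftrightarrow> (\<forall>q. bit k (i + q) \<longleftrightarrow> bit m q)"
  proof (rule iffI; intro allI impI)
    fix q assume *: "\<forall>l<j - int i. bit k (nat (j - l - 1)) \<longleftrightarrow> bit m (nat (j - int i - l - 1))"
    have "nat (int i + int q) = i + q" by simp
    then show "bit k (i + q) \<longleftrightarrow> bit m q" using *[rule_format, of "j - int i - int q - 1"] by simp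
  next
    fix l assume *: "\<forall>q. bit k (i + q) \<longleftrightarrow> bit m q" and l: "l < j - int i"
    have "i + nat (j - int i - l - 1) = nat (j - l - 1)" using l by simp
    then show "bit k (nat (j - l - 1)) \<longleftrightarrow> bit m (nat (j - int i - l - 1))" using * by metis
  qed
  also have "\<dots> \<longleftrightarrow> drop_bit i k = m" by (auto simp: bit_eq_iff bit_drop_bit_eq)
  finally show ?thesis by (auto simp: drop_bit_eq_div)
qed

lemma cpt_mem_cyl_cpt_same: "cpt j k \<in> cyl j (cpt j m) \<longleftrightarrow> m = k"
  using cpt_mem_cyl_cpt_iff[of j k 0 m] by simp

text \<open>With \<open>exists_cyl_cpt\<close>, this makes the cylinders of each level a partition
  of the group, indexed by the natural numbers without repetition.\<close>

lemma cyl_cpt_unique: "x \<in> cyl j (cpt j k) \<Longrightarrow> x \<in> cyl j (cpt j m) \<Longrightarrow> m = k"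
  using cpt_mem_cyl_cpt_same[of j k m] cyl_eqI[of x j "cpt j k"] cyl_eqI[of x j "cpt j m"] by auto

lemma cyl_eq_cyl_cpt: "\<exists>k. cyl n a = cyl n (cpt n k)"
  using exists_cyl_cpt cyl_eqI by blast

section \<open>Cylinders as a countable basis generating the Borel sets\<close>

lemma countable_cyls: "countable (range (\<lambda>(n, a). cyl n a))"
proof -
  have "cyl n a \<in> range (\<lambda>(n, k). cyl n (cpt n k))" for n a
    using cyl_eq_cyl_cpt[of n a] by force
  then have "range (\<lambda>(n, a). cyl n a) \<subseteq> range (\<lambda>(n, k). cyl n (cpt n k))" by auto
  then show ?thesis by (rule countable_subset) simp
qed

lemma topological_basis_cyls: "topological_basis (insert {} (range (\<lambda>(n, a). cyl n a)))"
proof (rule topological_basisI)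
  fix U and x :: cantor assume "open U" "x \<in> U"
  then obtain n where "cyl n x \<subseteq> U" using exists_cyl_subset by blast
  then show "\<exists>B\<in>insert {} (range (\<lambda>(n, a). cyl n a)). x \<in> B \<and> B \<subseteq> U"
    by (intro bexI[of _ "cyl n x"]) auto
qed auto

lemma borel_eq_cyls: "borel = sigma UNIV (insert {} (range (\<lambda>(n, a). cyl n a)))"
  by (rule borel_eq_countable_basis[OF _ topological_basis_cyls]) (simp add: countable_cyls)

section \<open>Binary digits and the inverse of \<lambda> at the integers\<close>

lemma sum_of_bool_bit: "k < 2 ^ n \<Longrightarrow> (\<Sum>i<n. of_bool (bit k i) * 2 ^ i) = (k :: nat)"
  using take_bit_sum[of n k] take_bit_nat_eq_self[of k n]
  by (simp add: push_bit_eq_mult lessThan_atLeast0)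

text \<open>The coordinates at negative places are the binary digits of k, so they contribute the
  integer part of \<lambda>.\<close>

lemma lam_term_has_sum_neg:
  assumes "x \<in> cyl 0 (cpt 0 k)"
  shows "((\<lambda>j. of_bit (coord x j) * 2 powi (- j - 1)) has_sum real k) {..<0}"
proof -
  let ?h = "\<lambda>i::nat. - int i - 1"
  have bij: "bij_betw ?h UNIV {..<0}"
    by (rule bij_betwI[where g = "\<lambda>j. nat (- j - 1)"]) auto
  have t: "of_bit (coord x (?h i)) * 2 powi (- ?h i - 1) = (of_bool (bit k i) * 2 ^ i :: real)" for i
    using assms by (simp add: mem_cyl)
  have "((\<lambda>i. of_bool (bit k i) * 2 ^ i :: real) has_sum (\<Sum>i<k. of_bool (bit k i) * 2 ^ i)) UNIV"
  proof (rule has_sum_finite_neutralI)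
    fix i assume "i \<in> UNIV - {..<k}"
    then have "k \<le> i" by simp
    then have "k < 2 ^ i" using less_exp[of k] power_increasing[of k i "2::nat"] by linarith
    then show "of_bool (bit k i) * 2 ^ i = (0::real)" by (simp add: bit_iff_odd)
  qed auto
  moreover have "(\<Sum>i<k. of_bool (bit k i) * 2 ^ i) = real k"
    using arg_cong[OF sum_of_bool_bit[of k k], of real] by simp
  ultimately show ?thesis
    using has_sum_reindex_bij_betw[OF bij, of "\<lambda>j. of_bit (coord x j) * 2 powi (- j - 1)" "real k"] t
    by simp
qed

text \<open>The coordinates from place 0 on give the fractional part. The bound by 1 is strict
  because sequences that are eventually 1 are excluded.\<close>

lemma lam_term_has_sum_nonneg:
  assumes "\<not> (\<forall>\<^sub>F k in at_top. coord x k = 1)"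
  obtains s where "((\<lambda>j. of_bit (coord x j) * 2 powi (- j - 1)) has_sum s) {0..}"
    "0 \<le> s" "s < (1::real)" "s = 0 \<Longrightarrow> \<forall>k\<ge>0. coord x k = 0"
proof -
  have bij: "bij_betw int UNIV {0..}"
    by (rule bij_betwI[where g = nat]) auto
  define t where "t i = of_bit (coord x (int i)) * (1 / 2 :: real) ^ Suc i" for i
  have te: "of_bit (coord x (int i)) * 2 powi (- int i - 1) = t i" for i
  proof -
    have "- int i - 1 = - int (Suc i)" by simp
    then have "(2::real) powi (- int i - 1) = (1 / 2) ^ Suc i"
      by (simp only: power_int_minus power_int_of_nat) (simp add: power_divide divide_simps)
    then show ?thesis by (simp add: t_def)
  qed
  have le: "t i \<le> (1 / 2) ^ Suc i" "0 \<le> t i" for i by (auto simp: t_def)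
  have sm: "summable t"
    by (rule summable_comparison_test[OF _ sums_summable[OF power_half_series]]) (use le in auto)
  have hs: "(t has_sum suminf t) UNIV"
    using sums_nonneg_imp_has_sum[of t "suminf t"] le summable_sums[OF sm] by simp
  obtain j where j: "j \<ge> 0" "coord x j \<noteq> 1"
    using assms unfolding eventually_at_top_linorder by blast
  let ?d = "\<lambda>i. (1 / 2) ^ Suc i - t i"
  \<comment> \<open>The digit 0 at place \<open>j\<close> makes the series strictly smaller than the
    full geometric series, whose sum is 1.\<close>
  have "0 < suminf ?d"
  proof (rule suminf_pos2[where i = "nat j"])
    show "summable ?d" by (intro summable_diff sm sums_summable[OF power_half_series])
    show "0 \<le> ?d n" for n using le[of n] by simp
    show "0 < ?d (nat j)" using j by (simp add: t_def)
  qed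
  also have "suminf ?d = 1 - suminf t"
    using suminf_diff[OF sums_summable[OF power_half_series] sm] sums_unique[OF power_half_series]
    by simp
  finally have "suminf t < 1" by simp
  moreover have "\<forall>k\<ge>0. coord x k = 0" if "suminf t = 0"
  proof (intro allI impI)
    fix k :: int assume "k \<ge> 0"
    have "t (nat k) = 0" using suminf_eq_zero_iff[OF sm] le that by blast
    then show "coord x k = 0" using \<open>k \<ge> 0\<close> by (cases "coord x k") (auto simp: t_def)
  qed
  moreover have "((\<lambda>j. of_bit (coord x j) * 2 powi (- j - 1)) has_sum suminf t) {0..}"
    using hs has_sum_reindex_bij_betw[OF bij, of "\<lambda>j. of_bit (coord x j) * 2 powi (- j - 1)" "suminf t"]
    unfolding te by blast
  ultimately show ?thesis using that suminf_nonneg[OF sm] le by blast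
qed

text \<open>\<open>lam_inv\<close> chooses some preimage, so its value follows from uniqueness: the
  integer part of \<lambda> determines the coordinates left of 0, and a vanishing fractional part
  forces all the others to be 0.\<close>

lemma lam_inv_of_nat: "lam_inv (real k) = cpt 0 k"
proof -
  let ?A = "{x. \<not> (\<forall>\<^sub>F k in at_top. coord x k = 1)}"
  have A: "cpt 0 m \<in> ?A" for m
    unfolding mem_Collect_eq eventually_at_top_linorder
    by (metis bit_not_one_iff coord_cpt linorder_not_less max.cobounded1 max.cobounded2)
  have split: "\<exists>m s. lam x = real m + s \<and> 0 \<le> s \<and> s < 1 \<and> x \<in> cyl 0 (cpt 0 m) \<and>
      (s = 0 \<longrightarrow> x = cpt 0 m)" if x: "x \<in> ?A" for x
  proof -
    obtain m where m: "x \<in> cyl 0 (cpt 0 m)" using exists_cyl_cpt by blast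
    obtain s where s: "((\<lambda>j. of_bit (coord x j) * 2 powi (- j - 1)) has_sum s) {0..}"
      "0 \<le> s" "s < (1::real)" "s = 0 \<Longrightarrow> \<forall>k\<ge>0. coord x k = 0"
      using lam_term_has_sum_nonneg x by blast
    have "{..<0} \<union> {0..} = (UNIV :: int set)" "{..<0} \<inter> {0..} = ({} :: int set)" by auto
    then have "((\<lambda>j. of_bit (coord x j) * 2 powi (- j - 1)) has_sum (real m + s)) UNIV"
      using has_sum_Un_disjoint[OF lam_term_has_sum_neg[OF m] s(1)] by simp
    then have "lam x = real m + s" unfolding lam_def by (rule infsumI)
    moreover have "x = cpt 0 m" if "s = 0"
      using m s(4)[OF that] by (auto simp: cantor_eq_iff mem_cyl)
    ultimately show ?thesis using s m by blast
  qed
  have lam_cpt: "lam (cpt 0 m) = real m" for m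
  proof -
    have "((\<lambda>j. of_bit (coord (cpt 0 m) j) * 2 powi (- j - 1)) has_sum (0::real)) {0..}"
      by (intro has_sum_0) simp
    moreover have "{..<0} \<union> {0..} = (UNIV :: int set)" "{..<0} \<inter> {0..} = ({} :: int set)" by auto
    ultimately have "((\<lambda>j. of_bit (coord (cpt 0 m) j) * 2 powi (- j - 1)) has_sum (real m + 0)) UNIV"
      using has_sum_Un_disjoint[OF lam_term_has_sum_neg[OF self_mem_cyl]] by fastforce
    then show ?thesis unfolding lam_def by (simp add: infsumI)
  qed
  have "real k \<in> lam ` ?A" using lam_cpt[of k] A by (metis image_eqI)
  then have "lam_inv (real k) \<in> ?A" "lam (lam_inv (real k)) = real k"
    unfolding lam_inv_def by (rule inv_into_into, rule f_inv_into_f)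
  then obtain m s where s: "real k = real m + s" "0 \<le> s" "s < 1"
      "s = 0 \<longrightarrow> lam_inv (real k) = cpt 0 m"
    using split by metis
  then have "k = m" by linarith
  moreover from this have "s = 0" using s(1) by simp
  ultimately show ?thesis using s(4) by simp
qed

section \<open>Haar measure\<close>

lemma Int_stable_cyls: "Int_stable (insert {} (range (\<lambda>(n, a). cyl n a)))"
proof -
  have "cyl m b \<inter> cyl n a \<in> {{}, cyl n a}" if "m \<le> n" for m n a b
    using cyl_disjoint[of a m b n] cyl_subset[of a m b n] that by blast
  then have "cyl m b \<inter> cyl n a \<in> {{}, cyl n a, cyl m b}" for m n a b
    by (metis Int_commute insertCI insertE linear singletonD)
  then show ?thesis unfolding Int_stable_def by fast
qed

text \<open>Cylinders together with the empty set are stable under intersection, and the cylinders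
  \<open>cyl (- int i) 0\<close>, of finite measure, exhaust the group.\<close>

lemma measure_eqI_cyls:
  assumes "sets M = sets borel" "sets N = sets borel"
    and "\<And>n a. emeasure M (cyl n a) = emeasure N (cyl n a)"
    and "\<And>n. emeasure M (cyl n 0) \<noteq> \<infinity>"
  shows "M = N"
proof (rule measure_eqI_generator_eq[OF Int_stable_cyls, where \<Omega> = UNIV])
  show "emeasure M X = emeasure N X" if "X \<in> insert {} (range (\<lambda>(n, a). cyl n a))" for X
    using that assms(3) by auto
  show "sets M = sigma_sets UNIV (insert {} (range (\<lambda>(n, a). cyl n a)))"
    "sets N = sigma_sets UNIV (insert {} (range (\<lambda>(n, a). cyl n a)))"
    using assms(1,2) by (simp_all add: borel_eq_cyls)
  show "range (\<lambda>i. cyl (- int i) 0) \<subseteq> insert {} (range (\<lambda>(n, a). cyl n a))" by auto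
  show "(\<Union>i. cyl (- int i) 0) = UNIV"
  proof (intro equalityI subset_UNIV subsetI)
    fix x :: cantor
    obtain n where "n \<le> 0" "x \<in> cyl n 0" using exists_mem_cyl_zero by blast
    then have "x \<in> cyl (- int (nat (- n))) 0" by simp
    then show "x \<in> (\<Union>i. cyl (- int i) 0)" by blast
  qed
qed (use assms(4) in auto)

lemma cantor_add_cancel: "a + (a + x) = x" for a x :: cantor
  by (metis add.assoc add.left_neutral cantor_add_self)

text \<open>Every element has order at most two, so each translation is its own inverse.\<close>

lemma image_add_eq_vimage: "(+) a ` A = (+) a -` A" for a :: cantor
proof (intro set_eqI iffI)
  fix x assume "x \<in> (+) a -` A"
  then show "x \<in> (+) a ` A" using cantor_add_cancel[of a x] by (metis image_eqI vimageD)
qed (auto simp: cantor_add_cancel)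

lemma add_mem_cyl_iff: "a + x \<in> cyl n b \<longleftrightarrow> x \<in> cyl n (a + b)"
proof -
  have "p + q = r \<longleftrightarrow> q = p + r" for p q r :: bit by (cases p; cases q; cases r) auto
  then show ?thesis unfolding mem_cyl coord_plus by simp
qed

lemma vimage_add_cyl: "(+) a -` cyl n b = cyl n (a + b)"
  by (auto simp only: vimage_eq add_mem_cyl_iff)

lemma continuous_on_cantor_add: "continuous_on A ((+) a)" for a :: cantor
proof -
  have "dist (a + x) (a + y) = dist x y" for x y
    unfolding dist_cantor_def by (metis add.assoc add.commute cantor_add_cancel)
  then show ?thesis unfolding continuous_on_iff by auto
qed

lemma measurable_cantor_add [measurable]: "(+) a \<in> borel_measurable borel" for a :: cantor
  by (intro borel_measurable_continuous_onI continuous_on_cantor_add)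

lemma cyl_borel [measurable, simp]: "cyl n a \<in> sets borel"
  by (simp add: borel_open)

lemma unit_ball_eq_cyl: "unit_ball = cyl 0 0"
  by (auto simp: unit_ball_iff mem_cyl)

text \<open>Invariance gives all cylinders of one level the same measure, and splitting halves it at
  each level. The normalisation at level 0 then propagates in both directions.\<close>

lemma is_haar_measure_cyl:
  assumes "is_haar_measure \<mu>"
  shows "emeasure \<mu> (cyl n a) = ennreal (2 powi (- n))"
proof -
  have st: "sets \<mu> = sets borel" and inv: "\<And>a A. A \<in> sets borel \<Longrightarrow> emeasure \<mu> ((+) a ` A) = emeasure \<mu> A"
    and one: "emeasure \<mu> (cyl 0 0) = 1"
    using assms unfolding is_haar_measure_def unit_ball_eq_cyl by auto
  have tr: "emeasure \<mu> (cyl n a) = emeasure \<mu> (cyl n 0)" for n a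
    using inv[of "cyl n 0" a] unfolding image_add_eq_vimage vimage_add_cyl by simp
  have half: "emeasure \<mu> (cyl n 0) = 2 * emeasure \<mu> (cyl (n + 1) 0)" for n
  proof -
    have "emeasure \<mu> (cyl n 0) = emeasure \<mu> (cyl (n + 1) 0) + emeasure \<mu> (cyl (n + 1) (0 + single n))"
      unfolding cyl_split[of n 0] by (rule plus_emeasure[symmetric]) (use cyl_split_disjoint[of n 0] in \<open>auto simp: st\<close>)
    then show ?thesis using tr by (simp add: mult_2)
  qed
  have two: "2 * ennreal (2 powi (- (m + 1))) = ennreal (2 powi (- m))" for m
  proof -
    have "- m = - (m + 1) + 1" by simp
    then have "(2::real) powi (- m) = 2 * 2 powi (- (m + 1))"
      by (metis power_int_add_1' zero_neq_numeral)
    then show ?thesis by (simp add: ennreal_mult)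
  qed
  have "emeasure \<mu> (cyl n 0) = ennreal (2 powi (- n))"
  proof (induction n rule: int_induct[where k = 0])
    case base
    show ?case using one by simp
  next
    case (step1 i)
    have "2 * emeasure \<mu> (cyl (i + 1) 0) = 2 * ennreal (2 powi (- (i + 1)))"
      unfolding two using step1(2) half[of i] by metis
    then show ?case by (subst (asm) ennreal_mult_cancel_left) auto
  next
    case (step2 i)
    then show ?case using half[of "i - 1"] two[of "i - 1"] by simp
  qed
  then show ?thesis using tr[of n a] by simp
qed

text \<open>Haar measure is obtained as the image of Lebesgue measure on the half-line under the binary
  expansion, which maps dyadic intervals to cylinders.\<close>

definition dyadic_expansion :: "real \<Rightarrow> cantor" where
  "dyadic_expansion t = Abs_cantor (\<lambda>l. if 0 \<le> t \<and> odd \<lfloor>t * 2 powi (l + 1)\<rfloor> then 1 else 0)"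

lemma coord_dyadic_expansion:
  "coord (dyadic_expansion t) l = (if 0 \<le> t \<and> odd \<lfloor>t * 2 powi (l + 1)\<rfloor> then 1 else 0)"
proof -
  have "\<exists>n. \<forall>l<n. \<lfloor>t * 2 powi (l + 1)\<rfloor> = 0" if "0 \<le> t"
  proof -
    obtain i :: nat where i: "t < 2 ^ i" using real_arch_pow[of 2 t] by auto
    have "\<lfloor>t * 2 powi (l + 1)\<rfloor> = 0" if l: "l < - int i" for l
    proof -
      have "t * 2 powi (l + 1) < 2 ^ i * 2 powi (l + 1)" using i by simp
      also have "\<dots> = 2 powi (int i + (l + 1))" by (subst power_int_add) (auto simp: power_int_of_nat)
      also have "\<dots> \<le> 2 powi 0" using l by (intro power_int_increasing) auto
      finally show ?thesis using \<open>0 \<le> t\<close> by (simp add: floor_eq_iff)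
    qed
    then show ?thesis by blast
  qed
  then have "(\<lambda>l. if 0 \<le> t \<and> odd \<lfloor>t * 2 powi (l + 1)\<rfloor> then 1 else 0 :: bit)
      \<in> {x. \<exists>n. \<forall>k<n. x k = 0}" by force
  then show ?thesis by (simp add: dyadic_expansion_def Abs_cantor_inverse)
qed

text \<open>The level-n index of t is the integer part of t * 2^n. Coordinate l < n is a binary
  digit of that integer, because the integer part of t * 2^(l+1) arises from it by division by
  2^(n-l-1).\<close>

lemma dyadic_expansion_mem_cyl:
  assumes "0 \<le> t"
  shows "dyadic_expansion t \<in> cyl n (cpt n k) \<longleftrightarrow> nat \<lfloor>t * 2 powi n\<rfloor> = k"
proof -
  have "dyadic_expansion t \<in> cyl n (cpt n (nat \<lfloor>t * 2 powi n\<rfloor>))"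
    unfolding mem_cyl
  proof (intro allI impI)
    fix l assume l: "l < n"
    define m where "m = nat (n - l - 1)"
    have "t * 2 powi (l + 1) = t * 2 powi (n - int m)" using l by (simp add: m_def)
    also have "\<dots> = t * 2 powi n / real_of_int (2 ^ m)" by (subst power_int_diff) (auto simp: power_int_of_nat)
    finally have "\<lfloor>t * 2 powi (l + 1)\<rfloor> = \<lfloor>t * 2 powi n\<rfloor> div 2 ^ m"
      using floor_divide_real_eq_div[of "2 ^ m" "t * 2 powi n"] by simp
    moreover have "\<lfloor>t * 2 powi n\<rfloor> = int (nat \<lfloor>t * 2 powi n\<rfloor>)" using assms by simp
    ultimately have "\<lfloor>t * 2 powi (l + 1)\<rfloor> = int (nat \<lfloor>t * 2 powi n\<rfloor> div 2 ^ m)"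
      by (metis of_nat_div of_nat_numeral of_nat_power)
    then have "odd \<lfloor>t * 2 powi (l + 1)\<rfloor> \<longleftrightarrow> bit (nat \<lfloor>t * 2 powi n\<rfloor>) m"
      by (simp add: bit_iff_odd)
    then show "coord (dyadic_expansion t) l = coord (cpt n (nat \<lfloor>t * 2 powi n\<rfloor>)) l"
      unfolding coord_dyadic_expansion coord_cpt using l assms by (auto simp: m_def)
  qed
  then show ?thesis using cyl_cpt_unique by blast
qed

lemma dyadic_expansion_vimage_cyl:
  "dyadic_expansion -` cyl n (cpt n k) \<inter> {0..} = {real k * 2 powi (- n)..<(real k + 1) * 2 powi (- n)}"
proof (intro set_eqI)
  fix t :: real
  define P :: real where "P = 2 powi n"
  have p: "P > 0" "2 powi (- n) = 1 / P" by (auto simp: P_def power_int_minus divide_simps)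
  show "t \<in> dyadic_expansion -` cyl n (cpt n k) \<inter> {0..} \<longleftrightarrow>
      t \<in> {real k * 2 powi (- n)..<(real k + 1) * 2 powi (- n)}"
  proof (cases "0 \<le> t")
    case True
    then have "nat \<lfloor>t * P\<rfloor> = k \<longleftrightarrow> \<lfloor>t * P\<rfloor> = int k" using p(1) by auto
    also have "\<dots> \<longleftrightarrow> real k \<le> t * P \<and> t * P < real k + 1" by (simp add: floor_eq_iff)
    finally show ?thesis
      using True p(1) dyadic_expansion_mem_cyl[OF True, of n k, folded P_def]
      unfolding p(2) by (simp add: field_simps)
  next
    case False
    moreover have "0 \<le> real k * 2 powi (- n)" by simp
    ultimately have "\<not> real k * 2 powi (- n) \<le> t" by linarith
    then show ?thesis using False by simp
  qed
qed

lemma measurable_dyadic_expansion: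
  "dyadic_expansion \<in> measurable (restrict_space lborel {0..}) borel"
  unfolding borel_eq_cyls
proof (rule measurable_measure_of)
  fix B assume "B \<in> insert {} (range (\<lambda>(n, a). cyl n a))"
  then consider "B = {}" | n k where "B = cyl n (cpt n k)" using cyl_eq_cyl_cpt by fast
  then show "dyadic_expansion -` B \<inter> space (restrict_space lborel {0..}) \<in> sets (restrict_space lborel {0..})"
  proof cases
    case 2
    have "{real k * 2 powi (- n)..<(real k + 1) * 2 powi (- n)} \<subseteq> {0..}"
      using order_trans[of 0 "real k * 2 powi (- n)"] by auto
    then show ?thesis
      by (auto simp: 2 dyadic_expansion_vimage_cyl space_restrict_space sets_restrict_space_iff)
  qed simp
qed auto

lemma emeasure_distr_dyadic_expansion:
  "emeasure (distr (restrict_space lborel {0..}) borel dyadic_expansion) (cyl n a) = ennreal (2 powi (- n))"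
proof -
  obtain k where k: "cyl n a = cyl n (cpt n k)" using cyl_eq_cyl_cpt by blast
  let ?I = "{real k * 2 powi (- n)..<(real k + 1) * 2 powi (- n)}"
  have "emeasure (distr (restrict_space lborel {0..}) borel dyadic_expansion) (cyl n a) =
      emeasure (restrict_space lborel {0..}) ?I"
    by (subst emeasure_distr[OF measurable_dyadic_expansion])
       (auto simp: k dyadic_expansion_vimage_cyl space_restrict_space)
  also have "\<dots> = emeasure lborel ?I"
    using order_trans[of 0 "real k * 2 powi (- n)"] by (intro emeasure_restrict_space) auto
  also have "\<dots> = ennreal (2 powi (- n))" by (simp add: algebra_simps)
  finally show ?thesis .
qed

text \<open>Dyadic addition on the half-line is never analysed. A translate of a cylinder is a
  cylinder of the same level, so the translated measure agrees with the original on cylinders and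
  hence everywhere.\<close>

lemma is_haar_measure_dyadic:
  "is_haar_measure (distr (restrict_space lborel {0..}) borel dyadic_expansion)" (is "is_haar_measure ?\<mu>")
  unfolding is_haar_measure_def
proof (intro conjI allI ballI)
  show "emeasure ?\<mu> unit_ball = 1"
    by (simp add: unit_ball_eq_cyl emeasure_distr_dyadic_expansion)
  fix a :: cantor and A :: "cantor set" assume A: "A \<in> sets borel"
  have ms: "(+) a \<in> measurable ?\<mu> borel" by (simp add: measurable_cantor_add)
  have "distr ?\<mu> borel ((+) a) = ?\<mu>"
    by (rule measure_eqI_cyls) (auto simp: emeasure_distr[OF ms] vimage_add_cyl emeasure_distr_dyadic_expansion)
  then have "emeasure ?\<mu> A = emeasure (distr ?\<mu> borel ((+) a)) A" by simp
  also have "\<dots> = emeasure ?\<mu> ((+) a ` A)"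
    by (subst emeasure_distr[OF ms A]) (simp add: image_add_eq_vimage)
  finally show "emeasure ?\<mu> ((+) a ` A) = emeasure ?\<mu> A" ..
qed simp

text \<open>\<open>haar\<close> is a definite description, so this needs both a Haar measure and its
  uniqueness; the latter holds because the values on cylinders are forced.\<close>

lemma is_haar_measure_haar: "is_haar_measure haar"
  unfolding haar_def
proof (rule theI)
  show "is_haar_measure (distr (restrict_space lborel {0..}) borel dyadic_expansion)"
    by (rule is_haar_measure_dyadic)
  fix \<mu> assume "is_haar_measure \<mu>"
  then show "\<mu> = distr (restrict_space lborel {0..}) borel dyadic_expansion"
    by (intro measure_eqI_cyls)
       (auto simp: is_haar_measure_cyl emeasure_distr_dyadic_expansion is_haar_measure_def)
qed

lemma sets_haar [measurable_cong, simp]: "sets haar = sets borel"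
  using is_haar_measure_haar by (simp add: is_haar_measure_def)

lemma space_haar [simp]: "space haar = UNIV"
  using sets_eq_imp_space_eq[OF sets_haar] by simp

lemma emeasure_haar_cyl [simp]: "emeasure haar (cyl n a) = ennreal (2 powi (- n))"
  by (rule is_haar_measure_cyl[OF is_haar_measure_haar])

lemma measure_haar_cyl [simp]: "measure haar (cyl n a) = 2 powi (- n)"
  by (simp add: measure_def)

lemma distr_haar_add: "distr haar borel ((+) a) = haar"
proof (rule measure_eqI_cyls)
  have ms: "(+) a \<in> measurable haar borel" by measurable
  show "emeasure (distr haar borel ((+) a)) (cyl n b) = emeasure haar (cyl n b)" for n b
    by (subst emeasure_distr[OF ms]) (simp_all add: vimage_add_cyl)
  then show "emeasure (distr haar borel ((+) a)) (cyl n 0) \<noteq> \<infinity>" for n by simp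
qed auto

lemma integral_haar_add:
  fixes f :: "cantor \<Rightarrow> complex"
  assumes "f \<in> borel_measurable borel"
  shows "(LINT x|haar. f (a + x)) = (LINT x|haar. f x)"
  using integral_distr[of "(+) a" haar borel f] assms by (simp add: distr_haar_add)

section \<open>Locally integrable functions\<close>

text \<open>Finitely many cylinders cover any compact set, and cylinders are compact themselves, so
  this is integrability over compact sets.\<close>

definition locally_integrable :: "(cantor \<Rightarrow> complex) \<Rightarrow> bool" where
  "locally_integrable f \<longleftrightarrow> f \<in> borel_measurable borel \<and>
     (\<forall>n a. integrable haar (\<lambda>x. indicator (cyl n a) x * f x))"

definition cyl_integral :: "int \<Rightarrow> cantor \<Rightarrow> (cantor \<Rightarrow> complex) \<Rightarrow> complex" where
  "cyl_integral n a f = (LINT x|haar. indicator (cyl n a) x * f x)"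

lemma locally_integrableD:
  assumes "locally_integrable f"
  shows "f \<in> borel_measurable borel" "integrable haar (\<lambda>x. indicator (cyl n a) x * f x)"
    "integrable haar (\<lambda>x. f x * indicator (cyl n a) x)"
  using assms by (auto simp: locally_integrable_def mult.commute)

lemma integrable_cyl_bounded:
  fixes f :: "cantor \<Rightarrow> complex"
  assumes "f \<in> borel_measurable borel" "\<And>x. x \<in> cyl n a \<Longrightarrow> norm (f x) \<le> B"
  shows "integrable haar (\<lambda>x. indicator (cyl n a) x * f x)"
proof -
  have "integrable haar (\<lambda>x. indicator (cyl n a) x *\<^sub>R f x)"
    by (rule integrableI_bounded_set_indicator[where B = B]) (use assms in auto)
  moreover have "(\<lambda>x. indicator (cyl n a) x *\<^sub>R f x) = (\<lambda>x. indicator (cyl n a) x * f x)"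
    by (auto simp: indicator_def)
  ultimately show ?thesis by simp
qed

lemma bounded_on_cyl:
  fixes f :: "cantor \<Rightarrow> complex"
  assumes "continuous_on UNIV f"
  obtains B where "\<And>x. x \<in> cyl n a \<Longrightarrow> norm (f x) \<le> B" "0 \<le> B"
proof -
  have "bounded (f ` cyl n a)"
    using assms by (intro compact_imp_bounded compact_continuous_image compact_cyl)
      (auto intro: continuous_on_subset)
  then show ?thesis using that unfolding bounded_pos by (metis image_eqI less_eq_real_def)
qed

lemma locally_integrable_continuous:
  assumes "continuous_on UNIV f" shows "locally_integrable f"
  unfolding locally_integrable_def
proof (intro conjI allI)
  show m: "f \<in> borel_measurable borel" using assms by (rule borel_measurable_continuous_onI)
  fix n a
  obtain B where "\<And>x. x \<in> cyl n a \<Longrightarrow> norm (f x) \<le> B" using bounded_on_cyl[OF assms, where n = n and a = a] by auto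
  then show "integrable haar (\<lambda>x. indicator (cyl n a) x * f x)" by (rule integrable_cyl_bounded[OF m])
qed

text \<open>Cylinders have finite measure, and |f| \<le> 1 + |f|^2.\<close>

lemma locally_integrable_L2:
  assumes "in_L2 f" shows "locally_integrable f"
  unfolding locally_integrable_def
proof (intro conjI allI)
  show m: "f \<in> borel_measurable borel"
    using assms measurable_cong_sets[OF sets_haar refl] unfolding in_L2_def by blast
  fix n a
  show "integrable haar (\<lambda>x. indicator (cyl n a) x * f x)"
  proof (rule Bochner_Integration.integrable_bound)
    show "integrable haar (\<lambda>x. indicator (cyl n a) x + (cmod (f x))\<^sup>2)"
      using assms unfolding in_L2_def by (intro Bochner_Integration.integrable_add integrable_real_indicator) auto
    show "(\<lambda>x. indicator (cyl n a) x * f x) \<in> borel_measurable haar" using m by measurable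
    have "t \<le> 1 + t\<^sup>2" for t :: real
      using zero_le_power2[of "t - 1"] zero_le_power2[of t] by (simp add: power2_diff; linarith)
    then show "AE x in haar. norm (indicator (cyl n a) x * f x) \<le> norm (indicator (cyl n a) x + (cmod (f x))\<^sup>2)"
      by (auto simp: indicator_def)
  qed
qed

lemma cyl_integral_cong:
  "(\<And>x. x \<in> cyl n a \<Longrightarrow> f x = g x) \<Longrightarrow> cyl_integral n a f = cyl_integral n a g"
  unfolding cyl_integral_def by (rule Bochner_Integration.integral_cong) (auto simp: indicator_def)

lemma integral_indicator_cyl: "(LINT x|haar. indicator (cyl n a) x) = complex_of_real (2 powi (- n))"
proof -
  have "(LINT x|haar. indicator (cyl n a) x) = (LINT x|haar. complex_of_real (indicator (cyl n a) x))"
    by (rule Bochner_Integration.integral_cong) (auto simp: indicator_def)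
  then show ?thesis by simp
qed

lemma cyl_integral_const: "cyl_integral n a (\<lambda>_. c) = of_real (2 powi (- n)) * c"
  by (simp add: cyl_integral_def integral_indicator_cyl)

lemma indicator_cyl_split:
  "indicator (cyl n a) x = (indicator (cyl (n + 1) a) x + indicator (cyl (n + 1) (a + single n)) x :: complex)"
  using cyl_split[of n a] cyl_split_disjoint[of n a] by (auto simp: indicator_def)

lemma cyl_integral_split:
  assumes "locally_integrable f"
  shows "cyl_integral n a f = cyl_integral (n + 1) a f + cyl_integral (n + 1) (a + single n) f"
  unfolding cyl_integral_def indicator_cyl_split[of n a] distrib_right
  by (rule Bochner_Integration.integral_add) (rule locally_integrableD[OF assms])+

section \<open>The Haar functions\<close>

lemma dilate_add_mem_cyl: "dilate j x + y \<in> cyl n a \<longleftrightarrow> x \<in> cyl (n + j) (dilate (- j) (y + a))"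
proof -
  have "p + q = r \<longleftrightarrow> p = q + r" for p q r :: bit by (cases p; cases q; cases r) auto
  then have "dilate j x + y \<in> cyl n a \<longleftrightarrow> (\<forall>k<n. coord x (k + j) = coord (y + a) k)"
    unfolding mem_cyl coord_plus coord_dilate by simp
  also have "\<dots> \<longleftrightarrow> (\<forall>k<n + j. coord x k = coord (y + a) (k - j))"
  proof (intro iffI allI impI)
    fix k assume "\<forall>k<n. coord x (k + j) = coord (y + a) k" "k < n + j"
    from this(1)[rule_format, of "k - j"] this(2)
    show "coord x k = coord (y + a) (k - j)" by (simp del: coord_plus)
  next
    fix k assume "\<forall>k<n + j. coord x k = coord (y + a) (k - j)" "k < n"
    from this(1)[rule_format, of "k + j"] this(2)
    show "coord x (k + j) = coord (y + a) k" by (simp del: coord_plus)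
  qed
  finally show ?thesis by (simp add: mem_cyl del: coord_plus)
qed

lemma phi_jk_eq: "phi_jk j k x = of_real (2 powr (j / 2)) * indicator (cyl j (cpt j k)) x"
  unfolding shift_dilate_def haar_phi_def unit_ball_eq_cyl lam_inv_of_nat indicator_def
    dilate_add_mem_cyl by (simp add: dilate_cpt)

lemma phi_0k_eq: "phi_jk 0 k x = indicator (cyl 0 (cpt 0 k)) x"
  by (simp add: phi_jk_eq)

lemma haar_psi_eq: "haar_psi x = indicator (cyl 1 0) x - indicator (cyl 1 (single 0)) x"
proof -
  have "cpt 1 1 = single 0" by (auto simp: cantor_eq_iff bit_Suc_0_iff)
  moreover have "complex_of_real (2 powr - (1 / 2)) * of_real (2 powr (1 / 2)) = 1"
    unfolding of_real_mult[symmetric] powr_add[symmetric] by simp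
  ultimately show ?thesis
    using phi_jk_eq[of 1 0 x] phi_jk_eq[of 1 1 x]
    unfolding haar_psi_def of_nat_0 of_nat_1 by (simp add: algebra_simps flip: mult.assoc)
qed

text \<open>The working form of the Haar functions: plus on one half of
  \<open>cyl j (cpt j k)\<close>, minus on the other. From here on the definition by dilation and
  \<open>lam_inv\<close> is not unfolded again.\<close>

lemma psi_jk_eq: "psi_jk j k x = of_real (2 powr (j / 2)) *
    (indicator (cyl (j + 1) (cpt j k)) x - indicator (cyl (j + 1) (cpt j k + single j)) x)"
proof -
  have "dilate (- j) (cpt 0 k + single 0) = cpt j k + single j"
    unfolding cantor_eq_iff coord_dilate coord_plus coord_cpt coord_single by (auto simp: algebra_simps)
  then show ?thesis
    unfolding shift_dilate_def haar_psi_eq lam_inv_of_nat indicator_def dilate_add_mem_cyl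
    by (simp add: dilate_cpt add.commute)
qed

lemma integral_mult_psi:
  assumes "locally_integrable f"
  shows "(LINT x|haar. f x * psi_jk j k x) = of_real (2 powr (j / 2)) *
      (cyl_integral (j + 1) (cpt j k) f - cyl_integral (j + 1) (cpt j k + single j) f)"
    "integrable haar (\<lambda>x. f x * psi_jk j k x)"
proof -
  have e: "f x * psi_jk j k x = of_real (2 powr (j / 2)) * (indicator (cyl (j + 1) (cpt j k)) x * f x
      - indicator (cyl (j + 1) (cpt j k + single j)) x * f x)" for x
    unfolding psi_jk_eq by (simp add: algebra_simps)
  show "(LINT x|haar. f x * psi_jk j k x) = of_real (2 powr (j / 2)) *
      (cyl_integral (j + 1) (cpt j k) f - cyl_integral (j + 1) (cpt j k + single j) f)"
    unfolding e cyl_integral_def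
    by (subst integral_mult_right_zero, subst Bochner_Integration.integral_diff)
       (auto intro: locally_integrableD[OF assms])
  show "integrable haar (\<lambda>x. f x * psi_jk j k x)"
    unfolding e by (intro integrable_mult_right Bochner_Integration.integrable_diff locally_integrableD[OF assms])
qed

lemma integral_mult_phi:
  "(LINT x|haar. f x * phi_jk 0 k x) = cyl_integral 0 (cpt 0 k) f"
  unfolding cyl_integral_def phi_0k_eq by (simp add: mult.commute)

text \<open>The basic cancellation: the two halves have equal measure. Orthogonality of the system
  and the vanishing of the fine coefficients of test functions both come from it.\<close>

lemma integral_mult_psi_const:
  assumes "\<And>x. x \<in> cyl j (cpt j k) \<Longrightarrow> f x = c"
  shows "(LINT x|haar. f x * psi_jk j k x) = 0"
proof -
  have "f x * psi_jk j k x = c * psi_jk j k x" for x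
    using assms[of x] cyl_split[of j "cpt j k"] unfolding psi_jk_eq by (auto simp: indicator_def)
  then have "(LINT x|haar. f x * psi_jk j k x) = (LINT x|haar. c * psi_jk j k x)" by (simp only:)
  also have "\<dots> = 0"
    by (subst integral_mult_psi[OF locally_integrable_continuous]) (simp_all add: cyl_integral_const)
  finally show ?thesis .
qed

lemma psi_jk_support: "x \<notin> cyl j (cpt j k) \<Longrightarrow> psi_jk j k x = 0"
  using cyl_split[of j "cpt j k"] unfolding psi_jk_eq by (auto simp: indicator_def)

lemma psi_jk_const: "y \<in> cyl n x \<Longrightarrow> j < n \<Longrightarrow> psi_jk j k y = psi_jk j k x"
  unfolding psi_jk_eq indicator_def
  using cyl_eqI[of y "j + 1" x] mem_cyl_mono[of y n x "j + 1"] mem_cyl_sym by fastforce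

lemma indicator_cyl_const:
  "y \<in> cyl n x \<Longrightarrow> m \<le> n \<Longrightarrow> indicator (cyl m a) y = (indicator (cyl m a) x :: complex)"
  using mem_cyl_mono[of y n x m] cyl_eqI[of y m x] mem_cyl_sym by (fastforce simp: indicator_def)

lemma continuous_on_locally_const:
  fixes f :: "cantor \<Rightarrow> complex"
  assumes "\<And>x. \<forall>\<^sub>F y in nhds x. f y = f x"
  shows "continuous_on UNIV f"
  unfolding continuous_on_def
proof
  fix x
  have "\<forall>\<^sub>F y in at x. f y = f x"
    using assms[of x] by (simp add: eventually_nhds_conv_at)
  then show "(f \<longlongrightarrow> f x) (at x)" by (rule tendsto_eventually)
qed

lemma eventually_nhds_cyl: "(\<And>y. y \<in> cyl n x \<Longrightarrow> P y) \<Longrightarrow> \<forall>\<^sub>F y in nhds x. P y"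
  unfolding eventually_nhds by (intro exI[of _ "cyl n x"]) simp

lemma continuous_indicator_cyl: "continuous_on UNIV (\<lambda>x. indicator (cyl n a) x :: complex)"
  by (rule continuous_on_locally_const, rule eventually_nhds_cyl[of n]) (rule indicator_cyl_const, auto)

lemma continuous_psi: "continuous_on UNIV (psi_jk j k)"
  by (rule continuous_on_locally_const, rule eventually_nhds_cyl[of "j + 1"]) (rule psi_jk_const, auto)

lemma integral_phi_psi:
  assumes "0 \<le> j" shows "(LINT x|haar. phi_jk 0 i x * psi_jk j k x) = 0"
  by (rule integral_mult_psi_const[where c = "phi_jk 0 i (cpt j k)"])
     (use assms in \<open>auto simp: phi_0k_eq intro!: indicator_cyl_const\<close>)

lemma integral_phi_phi: "(LINT x|haar. phi_jk 0 i x * phi_jk 0 k x) = of_bool (i = k)"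
proof -
  have "(LINT x|haar. phi_jk 0 i x * phi_jk 0 k x) = cyl_integral 0 (cpt 0 k) (\<lambda>_. of_bool (i = k))"
    unfolding integral_mult_phi
    using cyl_cpt_unique by (intro cyl_integral_cong) (fastforce simp: phi_0k_eq indicator_def)
  then show ?thesis by (simp add: cyl_integral_const)
qed

text \<open>On different levels the coarser function is constant on the support of the finer one; on
  the same level the supports are disjoint. The functions are real, so no conjugate appears.\<close>

lemma psi_orthonormal: "(LINT x|haar. psi_jk i l x * psi_jk j k x) = of_bool (i = j \<and> l = k)"
proof -
  have lt: "(LINT x|haar. psi_jk i l x * psi_jk j k x) = 0" if "i < j" for i l j k
    by (rule integral_mult_psi_const[where c = "psi_jk i l (cpt j k)"]) (use that in \<open>auto intro!: psi_jk_const\<close>)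
  consider "i < j" | "j < i" | "i = j" "l \<noteq> k" | "i = j" "l = k" by linarith
  then show ?thesis
  proof cases
    case 1
    then show ?thesis using lt by simp
  next
    case 2
    then show ?thesis using lt[of j i k l] by (simp add: mult.commute)
  next
    case 3
    then show ?thesis
      by (subst integral_mult_psi_const[where c = 0])
         (use cyl_cpt_unique[of _ j k l] psi_jk_support in auto)
  next
    case 4
    let ?h = "complex_of_real (2 powr (j / 2))"
    have 1: "cyl_integral (j + 1) (cpt j k) (psi_jk j k) = of_real (2 powi (- (j + 1))) * ?h"
      unfolding cyl_integral_const[of "j + 1" "cpt j k", symmetric]
      by (rule cyl_integral_cong) (use cyl_split_disjoint[of j "cpt j k"] in \<open>auto simp: psi_jk_eq indicator_def\<close>)
    have 2: "cyl_integral (j + 1) (cpt j k + single j) (psi_jk j k) = of_real (2 powi (- (j + 1))) * (- ?h)"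
      unfolding cyl_integral_const[of "j + 1" "cpt j k + single j", symmetric]
      by (rule cyl_integral_cong) (use cyl_split_disjoint[of j "cpt j k"] in \<open>auto simp: psi_jk_eq indicator_def\<close>)
    have hh: "2 powr (j / 2) * 2 powr (j / 2) = (2::real) powi j"
      by (simp add: powr_real_of_int' flip: powr_add)
    have "(LINT x|haar. psi_jk j k x * psi_jk j k x) = of_real (2 powr (j / 2) * 2 powr (j / 2) * 2 powi (- (j + 1)) * 2)"
      unfolding integral_mult_psi[OF locally_integrable_continuous[OF continuous_psi]] 1 2 by (simp add: algebra_simps)
    also have "2 powr (j / 2) * 2 powr (j / 2) * 2 powi (- (j + 1)) * 2 = (1::real)"
      unfolding hh by (subst power_int_minus, subst power_int_add) simp_all
    finally show ?thesis using 4 by simp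
  qed
qed

section \<open>Test functions and linear functionals\<close>

text \<open>Functions range over subsets of a function type, so subspaces and linearity are
  expressed relative to a carrier set.\<close>

definition function_space :: "(cantor \<Rightarrow> complex) set \<Rightarrow> bool" where
  "function_space V \<longleftrightarrow> (\<lambda>_. 0) \<in> V \<and> (\<forall>\<phi>\<in>V. \<forall>\<theta>\<in>V. (\<lambda>x. \<phi> x + \<theta> x) \<in> V) \<and>
     (\<forall>c. \<forall>\<phi>\<in>V. (\<lambda>x. c * \<phi> x) \<in> V)"

definition linear_functional ::
  "(cantor \<Rightarrow> complex) set \<Rightarrow> ((cantor \<Rightarrow> complex) \<Rightarrow> complex) \<Rightarrow> bool" where
  "linear_functional V F \<longleftrightarrow> (\<forall>\<phi>\<in>V. \<forall>\<theta>\<in>V. F (\<lambda>x. \<phi> x + \<theta> x) = F \<phi> + F \<theta>) \<and>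
     (\<forall>c. \<forall>\<phi>\<in>V. F (\<lambda>x. c * \<phi> x) = c * F \<phi>)"

lemma function_spaceD:
  assumes "function_space V"
  shows "(\<lambda>_. 0) \<in> V" "\<phi> \<in> V \<Longrightarrow> \<theta> \<in> V \<Longrightarrow> (\<lambda>x. \<phi> x + \<theta> x) \<in> V" "\<phi> \<in> V \<Longrightarrow> (\<lambda>x. c * \<phi> x) \<in> V"
  using assms by (auto simp: function_space_def)

lemma function_space_diff:
  assumes "function_space V" "\<phi> \<in> V" "\<theta> \<in> V" shows "(\<lambda>x. \<phi> x - \<theta> x) \<in> V"
  using function_spaceD(2)[OF assms(1,2) function_spaceD(3)[OF assms(1,3), of "-1"]] by simp

lemma linear_functionalD:
  assumes "linear_functional V F"
  shows "\<phi> \<in> V \<Longrightarrow> \<theta> \<in> V \<Longrightarrow> F (\<lambda>x. \<phi> x + \<theta> x) = F \<phi> + F \<theta>" "\<phi> \<in> V \<Longrightarrow> F (\<lambda>x. c * \<phi> x) = c * F \<phi>"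
  using assms by (auto simp: linear_functional_def)

lemma linear_functional_subset: "linear_functional V F \<Longrightarrow> U \<subseteq> V \<Longrightarrow> linear_functional U F"
  unfolding linear_functional_def by blast

lemma linear_functional_cong:
  assumes "function_space V" "\<And>\<phi>. \<phi> \<in> V \<Longrightarrow> F \<phi> = G \<phi>"
  shows "linear_functional V F \<longleftrightarrow> linear_functional V G"
  using assms(2) function_spaceD[OF assms(1)] unfolding linear_functional_def by simp

lemma linear_functional_add:
  "linear_functional V F \<Longrightarrow> linear_functional V G \<Longrightarrow> linear_functional V (\<lambda>\<phi>. F \<phi> + G \<phi>)"
  unfolding linear_functional_def by (simp add: algebra_simps)

lemma linear_functional_mult: "linear_functional V F \<Longrightarrow> linear_functional V (\<lambda>\<phi>. c * F \<phi>)"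
  unfolding linear_functional_def by (simp add: algebra_simps)

lemma function_space_sum:
  assumes V: "function_space V" and "finite A" "\<And>i. i \<in> A \<Longrightarrow> \<phi> i \<in> V"
  shows "(\<lambda>x. \<Sum>i\<in>A. c i * \<phi> i x) \<in> V"
  using assms(2,3) by (induction A rule: finite_induct) (auto intro!: function_spaceD[OF V])

lemma linear_functional_sum:
  assumes V: "function_space V" and F: "linear_functional V F"
    and "finite A" "\<And>i. i \<in> A \<Longrightarrow> \<phi> i \<in> V"
  shows "F (\<lambda>x. \<Sum>i\<in>A. c i * \<phi> i x) = (\<Sum>i\<in>A. c i * F (\<phi> i))"
  using assms(3,4)
proof (induction A rule: finite_induct)
  case empty
  show ?case using linear_functionalD(2)[OF F function_spaceD(1)[OF V], of 0] by simp
next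
  case (insert i A)
  then show ?case
    using linear_functionalD(1)[OF F function_spaceD(3)[OF V] function_space_sum[OF V], of "\<phi> i" A \<phi> "c i" c]
      linear_functionalD(2)[OF F, of "\<phi> i" "c i"] by simp
qed

lemma function_space_test_fun: "function_space test_fun"
  unfolding function_space_def
proof (intro conjI ballI allI)
  show "(\<lambda>_. 0) \<in> test_fun" by (auto simp: test_fun_def)
next
  fix \<phi> \<theta> assume "\<phi> \<in> test_fun" "\<theta> \<in> test_fun"
  then obtain K L where K: "\<And>x. \<forall>\<^sub>F y in nhds x. \<phi> y = \<phi> x" "compact K" "\<forall>x. x \<notin> K \<longrightarrow> \<phi> x = 0"
    and L: "\<And>x. \<forall>\<^sub>F y in nhds x. \<theta> y = \<theta> x" "compact L" "\<forall>x. x \<notin> L \<longrightarrow> \<theta> x = 0"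
    by (auto simp: test_fun_def)
  have "\<forall>\<^sub>F y in nhds x. \<phi> y + \<theta> y = \<phi> x + \<theta> x" for x
    using K(1)[of x] L(1)[of x] by eventually_elim simp
  moreover have "compact (K \<union> L)" "\<forall>x. x \<notin> K \<union> L \<longrightarrow> \<phi> x + \<theta> x = 0" using K L by auto
  ultimately show "(\<lambda>x. \<phi> x + \<theta> x) \<in> test_fun" unfolding test_fun_def by blast
next
  fix c \<phi> assume "\<phi> \<in> test_fun"
  then obtain K where K: "\<And>x. \<forall>\<^sub>F y in nhds x. \<phi> y = \<phi> x" "compact K" "\<forall>x. x \<notin> K \<longrightarrow> \<phi> x = 0"
    by (auto simp: test_fun_def)
  have "\<forall>\<^sub>F y in nhds x. c * \<phi> y = c * \<phi> x" for x
    using K(1)[of x] by eventually_elim simp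
  then show "(\<lambda>x. c * \<phi> x) \<in> test_fun" using K(2,3) unfolding test_fun_def by auto
qed

lemma indicator_cyl_test_fun: "(\<lambda>x. indicator (cyl n a) x) \<in> test_fun"
proof -
  have "\<forall>\<^sub>F y in nhds x. indicator (cyl n a) y = (indicator (cyl n a) x :: complex)" for x
    by (rule eventually_nhds_cyl[of n]) (rule indicator_cyl_const, auto)
  moreover have "\<forall>x. x \<notin> cyl n a \<longrightarrow> indicator (cyl n a) x = (0 :: complex)" by simp
  ultimately show ?thesis unfolding test_fun_def using compact_cyl by blast
qed

lemma psi_test_fun: "psi_jk j k \<in> test_fun"
proof -
  have "psi_jk j k = (\<lambda>x. of_real (2 powr (j / 2)) *
      (indicator (cyl (j + 1) (cpt j k)) x - indicator (cyl (j + 1) (cpt j k + single j)) x))"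
    by (rule ext) (rule psi_jk_eq)
  then show ?thesis
    using function_space_diff[OF function_space_test_fun indicator_cyl_test_fun indicator_cyl_test_fun]
      function_spaceD(3)[OF function_space_test_fun] by simp
qed

lemma phi_test_fun: "phi_jk 0 k \<in> test_fun"
proof -
  have "phi_jk 0 k = (\<lambda>x. indicator (cyl 0 (cpt 0 k)) x)"
    by (rule ext) (rule phi_0k_eq)
  then show ?thesis using indicator_cyl_test_fun by simp
qed

lemma test_fun_continuous: "\<phi> \<in> test_fun \<Longrightarrow> continuous_on UNIV \<phi>"
  by (rule continuous_on_locally_const) (simp add: test_fun_def)

text \<open>The cylinders of one level form an open partition, so a finite subcover of
  \<open>K\<close> must contain every cylinder that meets \<open>K\<close>.\<close>

lemma finite_cpt_meeting_compact:
  assumes "compact K" shows "finite {k. cyl m (cpt m k) \<inter> K \<noteq> {}}"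
proof -
  have "K \<subseteq> (\<Union>k. cyl m (cpt m k))" using exists_cyl_cpt by blast
  then obtain C where C: "finite C" "K \<subseteq> (\<Union>k\<in>C. cyl m (cpt m k))"
    using compactE_image[OF assms, of UNIV "\<lambda>k. cyl m (cpt m k)"] by auto
  have "{k. cyl m (cpt m k) \<inter> K \<noteq> {}} \<subseteq> C"
  proof
    fix k assume "k \<in> {k. cyl m (cpt m k) \<inter> K \<noteq> {}}"
    then obtain x where x: "x \<in> cyl m (cpt m k)" "x \<in> K" by auto
    then obtain l where "l \<in> C" "x \<in> cyl m (cpt m l)" using C(2) by auto
    then show "k \<in> C" using cyl_cpt_unique[OF x(1)] by auto
  qed
  then show ?thesis using C(1) finite_subset by auto
qed

lemma step_function_eq:
  assumes const: "\<And>x y. y \<in> cyl m x \<Longrightarrow> \<phi> y = (\<phi> x :: complex)"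
    and supp: "\<And>x. x \<notin> K \<Longrightarrow> \<phi> x = 0"
    and T: "finite T" "{k. cyl m (cpt m k) \<inter> K \<noteq> {}} \<subseteq> T"
  shows "\<phi> x = (\<Sum>k\<in>T. \<phi> (cpt m k) * indicator (cyl m (cpt m k)) x)"
proof -
  obtain k where k: "x \<in> cyl m (cpt m k)" using exists_cyl_cpt by auto
  have ind: "indicator (cyl m (cpt m l)) x = (if l = k then 1 else 0 :: complex)" for l
    by (cases "l = k") (use k cyl_cpt_unique[OF k, of l] in \<open>auto simp: indicator_def\<close>)
  have e: "\<phi> (cpt m k) = \<phi> x" using const k by simp
  have "(\<Sum>k\<in>T. \<phi> (cpt m k) * indicator (cyl m (cpt m k)) x) = (if k \<in> T then \<phi> x else 0)"
    unfolding ind using T(1) e by (simp add: if_distrib cong: if_cong)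
  moreover have "\<phi> x = 0" if "k \<notin> T"
  proof -
    have "x \<notin> K" using that k T(2) by auto
    then show ?thesis by (rule supp)
  qed
  ultimately show ?thesis by auto
qed

text \<open>Local constancy becomes uniform by compactness: finitely many cylinders of constancy
  cover the support, and the finest of their levels serves everywhere.\<close>

lemma test_fun_uniform:
  assumes "\<phi> \<in> test_fun"
  obtains m K where "m \<ge> n" "\<And>x y. y \<in> cyl m x \<Longrightarrow> \<phi> y = \<phi> x" "compact K" "\<And>x. x \<notin> K \<Longrightarrow> \<phi> x = 0"
proof -
  obtain K where K: "compact K" "\<And>x. x \<notin> K \<Longrightarrow> \<phi> x = 0" and lc: "\<And>x. \<forall>\<^sub>F y in nhds x. \<phi> y = \<phi> x"
    using assms by (auto simp: test_fun_def)
  have "\<exists>l\<ge>n. \<forall>y\<in>cyl l x. \<phi> y = \<phi> x" for x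
  proof -
    obtain S where S: "open S" "x \<in> S" "\<forall>y\<in>S. \<phi> y = \<phi> x" using lc[of x] by (auto simp: eventually_nhds)
    obtain l where "l \<ge> n" "cyl l x \<subseteq> S" using exists_cyl_subset[OF S(1,2), of n] by (elim exE conjE)
    then show ?thesis using S(3) by (intro exI[of _ l]) auto
  qed
  then obtain l where l: "\<And>x. l x \<ge> n" "\<And>x y. y \<in> cyl (l x) x \<Longrightarrow> \<phi> y = \<phi> x" by metis
  have "K \<subseteq> (\<Union>x. cyl (l x) x)" using self_mem_cyl by blast
  then obtain C where C: "finite C" "K \<subseteq> (\<Union>x\<in>C. cyl (l x) x)"
    using compactE_image[OF K(1), of UNIV "\<lambda>x. cyl (l x) x"] by auto
  define m where "m = Max (insert n (l ` C))"
  have m: "m \<ge> n" "\<And>x. x \<in> C \<Longrightarrow> l x \<le> m" using C(1) by (auto simp: m_def)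
  have key: "\<phi> y = \<phi> z" if z: "z \<in> K" and y: "y \<in> cyl m z" for y z
  proof -
    obtain c where c: "c \<in> C" "z \<in> cyl (l c) c" using z C(2) by auto
    have "y \<in> cyl (l c) z" using y m(2)[OF c(1)] by (rule mem_cyl_mono)
    then have "y \<in> cyl (l c) c" using cyl_eqI[OF c(2)] by simp
    then show ?thesis using l(2) c(2) by metis
  qed
  have "\<phi> y = \<phi> x" if y: "y \<in> cyl m x" for x y
  proof -
    \<comment> \<open>The covering argument needs one of the two points in \<open>K\<close>;
      membership in a cylinder is symmetric, and outside \<open>K\<close> both values are 0.\<close>
    consider "x \<in> K" | "y \<in> K" | "x \<notin> K" "y \<notin> K" by auto
    then show ?thesis
    proof cases
      case 1
      then show ?thesis using y by (rule key)
    next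
      case 2
      have "x \<in> cyl m y" using y mem_cyl_sym by simp
      then show ?thesis using key[OF 2, of x] by simp
    next
      case 3
      then show ?thesis using K(2) by simp
    qed
  qed
  then show ?thesis by (rule that[OF m(1) _ K])
qed

lemma test_fun_step:
  assumes "\<phi> \<in> test_fun"
  obtains m T where "m \<ge> n" "finite T" "\<phi> = (\<lambda>x. \<Sum>k\<in>T. \<phi> (cpt m k) * indicator (cyl m (cpt m k)) x)"
proof -
  obtain m K where mK: "m \<ge> n" "\<And>x y. y \<in> cyl m x \<Longrightarrow> \<phi> y = \<phi> x" "compact K" "\<And>x. x \<notin> K \<Longrightarrow> \<phi> x = 0"
    using test_fun_uniform[OF assms, of n] by auto
  let ?T = "{k. cyl m (cpt m k) \<inter> K \<noteq> {}}"
  have "\<phi> = (\<lambda>x. \<Sum>k\<in>?T. \<phi> (cpt m k) * indicator (cyl m (cpt m k)) x)"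
    by (rule ext, rule step_function_eq[OF mK(2) mK(4)]) (auto intro: finite_cpt_meeting_compact mK(3))
  then show ?thesis by (rule that[OF mK(1) finite_cpt_meeting_compact[OF mK(3)]])
qed

lemma integrable_mult_test_fun:
  assumes "locally_integrable f" "\<phi> \<in> test_fun"
  shows "integrable haar (\<lambda>x. f x * \<phi> x)"
proof -
  obtain m T where "m \<ge> 0" and T: "finite T" "\<phi> = (\<lambda>x. \<Sum>k\<in>T. \<phi> (cpt m k) * indicator (cyl m (cpt m k)) x)"
    by (rule test_fun_step[OF assms(2)])
  have "(\<lambda>x. f x * \<phi> x) = (\<lambda>x. \<Sum>k\<in>T. \<phi> (cpt m k) * (f x * indicator (cyl m (cpt m k)) x))"
    by (subst T(2)) (simp add: sum_distrib_left algebra_simps)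
  then show ?thesis
    using locally_integrableD(3)[OF assms(1)] by (simp add: T(1))
qed

lemma integrable_test_fun:
  assumes "\<phi> \<in> test_fun" shows "integrable haar \<phi>"
proof -
  have "integrable haar (\<lambda>x. 1 * \<phi> x)"
    by (rule integrable_mult_test_fun[OF locally_integrable_continuous[OF continuous_on_const] assms])
  then show ?thesis by simp
qed

lemma linear_functional_regular:
  assumes "locally_integrable f"
  shows "linear_functional test_fun (\<lambda>\<phi>. LINT x|haar. f x * \<phi> x)"
  unfolding linear_functional_def
proof (intro conjI ballI allI)
  fix \<phi> \<theta> assume "\<phi> \<in> test_fun" "\<theta> \<in> test_fun"
  then show "(LINT x|haar. f x * (\<phi> x + \<theta> x)) = (LINT x|haar. f x * \<phi> x) + (LINT x|haar. f x * \<theta> x)"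
    unfolding distrib_left by (intro Bochner_Integration.integral_add integrable_mult_test_fun assms)
next
  fix c \<phi>
  have "(LINT x|haar. f x * (c * \<phi> x)) = (LINT x|haar. c * (f x * \<phi> x))" by (simp add: mult.left_commute)
  then show "(LINT x|haar. f x * (c * \<phi> x)) = c * (LINT x|haar. f x * \<phi> x)" by simp
qed

text \<open>The members of a null sequence lie in one finite-dimensional space of step functions, so
  linearity alone gives continuity.\<close>

lemma linear_functional_null_seq:
  assumes F: "linear_functional test_fun F" and u: "null_seq u" "\<And>i. u i \<in> test_fun"
  shows "(\<lambda>i. F (u i)) \<longlonglongrightarrow> 0"
proof -
  obtain K n where K: "compact K" "\<And>i x. x \<notin> K \<Longrightarrow> u i x = 0"
    and n: "\<And>i x y. y \<in> cyl n x \<Longrightarrow> u i y = u i x"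
    and lim: "uniform_limit UNIV u (\<lambda>_. 0) sequentially"
    using u(1) unfolding null_seq_def cyl_eq_ball by blast
  let ?T = "{k. cyl n (cpt n k) \<inter> K \<noteq> {}}"
  have T: "finite ?T" by (rule finite_cpt_meeting_compact[OF K(1)])
  have "F (u i) = (\<Sum>k\<in>?T. u i (cpt n k) * F (\<lambda>x. indicator (cyl n (cpt n k)) x))" for i
  proof -
    have "u i = (\<lambda>x. \<Sum>k\<in>?T. u i (cpt n k) * indicator (cyl n (cpt n k)) x)"
      by (rule ext, rule step_function_eq[OF n K(2) T order_refl]) auto
    then have "F (u i) = F (\<lambda>x. \<Sum>k\<in>?T. u i (cpt n k) * indicator (cyl n (cpt n k)) x)" by (rule arg_cong)
    also have "\<dots> = (\<Sum>k\<in>?T. u i (cpt n k) * F (\<lambda>x. indicator (cyl n (cpt n k)) x))"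
      by (rule linear_functional_sum[OF function_space_test_fun F T]) (rule indicator_cyl_test_fun)
    finally show ?thesis .
  qed
  moreover have "(\<lambda>i. \<Sum>k\<in>?T. u i (cpt n k) * F (\<lambda>x. indicator (cyl n (cpt n k)) x)) \<longlonglongrightarrow>
      (\<Sum>k\<in>?T. 0 * F (\<lambda>x. indicator (cyl n (cpt n k)) x))"
    by (intro tendsto_intros tendsto_uniform_limitI[OF lim]) auto
  ultimately show ?thesis by simp
qed

lemma dual_test_fun_iff:
  "F \<in> dual test_fun \<longleftrightarrow> F \<in> extensional test_fun \<and> linear_functional test_fun F"
  using linear_functional_null_seq[of F] unfolding dual_def linear_functional_def by blast

section \<open>Haar polynomials and their place among the test functions\<close>

lemma haar_polyI: "finite A \<Longrightarrow> (\<lambda>x. \<Sum>(j, k)\<in>A. c j k * psi_jk j k x) \<in> haar_poly"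
  unfolding haar_poly_def by blast

lemma haar_polyE:
  assumes "\<phi> \<in> haar_poly"
  obtains A c where "finite A" "\<phi> = (\<lambda>x. \<Sum>i\<in>A. c i * psi_jk (fst i) (snd i) x)"
proof -
  obtain A c where "finite A" "\<phi> = (\<lambda>x. \<Sum>(j, k)\<in>A. c j k * psi_jk j k x)"
    using assms unfolding haar_poly_def by auto
  then show ?thesis using that[of A "\<lambda>i. c (fst i) (snd i)"] by (simp add: case_prod_beta)
qed

lemma psi_haar_poly: "psi_jk j k \<in> haar_poly"
  using haar_polyI[of "{(j, k)}" "\<lambda>_ _. 1"] by simp

lemma function_space_haar_poly: "function_space haar_poly"
  unfolding function_space_def
proof (intro conjI ballI allI)
  show "(\<lambda>_. 0) \<in> haar_poly" using haar_polyI[of "{}"] by simp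
next
  fix \<phi> \<theta> assume \<phi>: "\<phi> \<in> haar_poly" and \<theta>: "\<theta> \<in> haar_poly"
  obtain A c where A: "finite A" "\<phi> = (\<lambda>x. \<Sum>i\<in>A. c i * psi_jk (fst i) (snd i) x)"
    by (rule haar_polyE[OF \<phi>])
  obtain B d where B: "finite B" "\<theta> = (\<lambda>x. \<Sum>i\<in>B. d i * psi_jk (fst i) (snd i) x)"
    by (rule haar_polyE[OF \<theta>])
  \<comment> \<open>Both sums are extended to the union of the index sets, with coefficient 0 for
    absent terms.\<close>
  let ?c = "\<lambda>i. (if i \<in> A then c i else 0) + (if i \<in> B then d i else 0)"
  have "\<phi> x + \<theta> x = (\<Sum>i\<in>A \<union> B. ?c i * psi_jk (fst i) (snd i) x)" for x
  proof -
    have "\<phi> x = (\<Sum>i\<in>A \<union> B. (if i \<in> A then c i else 0) * psi_jk (fst i) (snd i) x)"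
      unfolding A(2) by (rule sum.mono_neutral_cong_left) (use A(1) B(1) in auto)
    moreover have "\<theta> x = (\<Sum>i\<in>A \<union> B. (if i \<in> B then d i else 0) * psi_jk (fst i) (snd i) x)"
      unfolding B(2) by (rule sum.mono_neutral_cong_left) (use A(1) B(1) in auto)
    ultimately show ?thesis by (simp add: sum.distrib[symmetric] distrib_right)
  qed
  then have "(\<lambda>x. \<phi> x + \<theta> x) = (\<lambda>x. \<Sum>(j, k)\<in>A \<union> B. ?c (j, k) * psi_jk j k x)"
    by (simp add: case_prod_beta cong: if_cong)
  then show "(\<lambda>x. \<phi> x + \<theta> x) \<in> haar_poly"
    using haar_polyI[of "A \<union> B" "\<lambda>j k. ?c (j, k)"] A(1) B(1) by simp
next
  fix b \<phi> assume "\<phi> \<in> haar_poly"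
  then obtain A c where A: "finite A" "\<phi> = (\<lambda>x. \<Sum>i\<in>A. c i * psi_jk (fst i) (snd i) x)"
    by (rule haar_polyE)
  have "(\<lambda>x. b * \<phi> x) = (\<lambda>x. \<Sum>(j, k)\<in>A. (b * c (j, k)) * psi_jk j k x)"
    unfolding A(2) by (simp add: case_prod_beta sum_distrib_left mult.assoc)
  then show "(\<lambda>x. b * \<phi> x) \<in> haar_poly"
    using haar_polyI[OF A(1), of "\<lambda>j k. b * c (j, k)"] by simp
qed

lemma haar_poly_subset_test_fun: "haar_poly \<subseteq> test_fun"
proof
  fix \<phi> assume "\<phi> \<in> haar_poly"
  then obtain A c where A: "finite A" "\<phi> = (\<lambda>x. \<Sum>i\<in>A. c i * psi_jk (fst i) (snd i) x)"
    by (rule haar_polyE)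
  show "\<phi> \<in> test_fun"
    unfolding A(2) by (rule function_space_sum[OF function_space_test_fun A(1) psi_test_fun])
qed

lemma linear_functional_haar_poly_eqI:
  assumes "linear_functional haar_poly F" "linear_functional haar_poly G"
    and "\<And>j k. F (psi_jk j k) = G (psi_jk j k)" and "\<phi> \<in> haar_poly"
  shows "F \<phi> = G \<phi>"
proof -
  obtain A c where A: "finite A" "\<phi> = (\<lambda>x. \<Sum>i\<in>A. c i * psi_jk (fst i) (snd i) x)"
    by (rule haar_polyE[OF assms(4)])
  show ?thesis
    unfolding A(2)
    by (subst (1 2) linear_functional_sum[OF function_space_haar_poly _ A(1) psi_haar_poly])
       (simp_all add: assms)
qed

text \<open>Halving a cylinder costs one Haar function; this drives all expansions of test functions.\<close>

lemma indicator_cyl_refine: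
  obtains c k where "(\<lambda>x. indicator (cyl (n + 1) a) x) =
    (\<lambda>x. 1 / 2 * indicator (cyl n a) x + c * psi_jk n k x)"
proof -
  obtain k where k: "a \<in> cyl n (cpt n k)" using exists_cyl_cpt by auto
  let ?p = "cpt n k" and ?r = "of_real (2 powr (- n / 2)) :: complex"
  have eq: "cyl n a = cyl n ?p" using cyl_eqI[OF k] .
  have "?r * of_real (2 powr (n / 2)) = of_real (2 powr (- n / 2) * 2 powr (n / 2))" by simp
  also have "\<dots> = 1" by (simp flip: powr_add)
  finally have r: "?r * psi_jk n k x = indicator (cyl (n + 1) ?p) x - indicator (cyl (n + 1) (?p + single n)) x" for x
    unfolding psi_jk_eq mult.assoc[symmetric] by simp
  have r1: "?r / 2 * psi_jk n k x = 1 / 2 * (indicator (cyl (n + 1) ?p) x - indicator (cyl (n + 1) (?p + single n)) x)" for x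
    unfolding r[symmetric] by simp
  have r2: "- ?r / 2 * psi_jk n k x = - (?r / 2 * psi_jk n k x)" for x by simp
  note s = indicator_cyl_split[of n ?p]
  consider "a \<in> cyl (n + 1) ?p" | "a \<in> cyl (n + 1) (?p + single n)"
    using k cyl_split[of n ?p] by auto
  then show ?thesis
  proof cases
    case 1
    then have "indicator (cyl (n + 1) a) x = 1 / 2 * indicator (cyl n a) x + (?r / 2) * psi_jk n k x" for x
      unfolding r1 eq s cyl_eqI[OF 1] by (simp add: field_simps)
    then show ?thesis using that by blast
  next
    case 2
    then have "indicator (cyl (n + 1) a) x = 1 / 2 * indicator (cyl n a) x + (- ?r / 2) * psi_jk n k x" for x
      unfolding r2 r1 eq s cyl_eqI[OF 2] by (simp add: field_simps)
    then show ?thesis using that by blast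
  qed
qed

text \<open>Iterated halving. The factor is the ratio of the two measures, the only one compatible
  with Haar polynomials having integral zero.\<close>

lemma indicator_cyl_diff_haar_poly:
  assumes "n \<le> m"
  shows "(\<lambda>x. indicator (cyl m a) x - of_real (2 powi (n - m)) * indicator (cyl n a) x) \<in> haar_poly"
  using assms
proof (induction m rule: int_ge_induct)
  case base
  show ?case using function_spaceD(1)[OF function_space_haar_poly] by simp
next
  case (step m)
  obtain c k where c: "(\<lambda>x. indicator (cyl (m + 1) a) x) = (\<lambda>x. 1 / 2 * indicator (cyl m a) x + c * psi_jk m k x)"
    by (rule indicator_cyl_refine)
  have p: "2 powi (n - (m + 1)) = (1 / 2 * 2 powi (n - m) :: real)"
    by (simp add: power_int_diff power_int_add)
  have "(\<lambda>x. 1 / 2 * (indicator (cyl m a) x - of_real (2 powi (n - m)) * indicator (cyl n a) x) + c * psi_jk m k x)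
      \<in> haar_poly"
    by (intro function_spaceD(2,3)[OF function_space_haar_poly] step psi_haar_poly)
  also have "(\<lambda>x. 1 / 2 * (indicator (cyl m a) x - of_real (2 powi (n - m)) * indicator (cyl n a) x) + c * psi_jk m k x)
      = (\<lambda>x. indicator (cyl (m + 1) a) x - of_real (2 powi (n - (m + 1))) * indicator (cyl n a) x)"
    unfolding p using fun_cong[OF c] by (simp add: algebra_simps)
  finally show ?case .
qed

text \<open>The two cylinders need not be nested, so both are compared with a common larger cylinder
  around zero, whose contributions cancel.\<close>

lemma indicator_cyl_mean_haar_poly:
  "(\<lambda>x. indicator (cyl m a) x - of_real (2 powi (- m)) * indicator (cyl 0 0) x) \<in> haar_poly"
proof -
  obtain n where n: "n \<le> min 0 m" "a \<in> cyl n 0" using exists_mem_cyl_zero by blast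
  have eq: "cyl n a = cyl n 0" using cyl_eqI[OF n(2)] .
  have p: "of_real (2 powi (n - m)) = (of_real (2 powi (- m)) * of_real (2 powi (n - 0)) :: complex)"
    by (simp add: power_int_diff power_int_minus divide_simps flip: of_real_mult)
  have "(\<lambda>x. (indicator (cyl m a) x - of_real (2 powi (n - m)) * indicator (cyl n a) x)
       - of_real (2 powi (- m)) * (indicator (cyl 0 0) x - of_real (2 powi (n - 0)) * indicator (cyl n 0) x)) \<in> haar_poly"
    using n(1) by (intro function_space_diff[OF function_space_haar_poly]
        function_spaceD(3)[OF function_space_haar_poly] indicator_cyl_diff_haar_poly) auto
  then show ?thesis unfolding eq p by (simp add: algebra_simps)
qed

lemma test_fun_mean_haar_poly:
  assumes "\<phi> \<in> test_fun"
  shows "(\<lambda>x. \<phi> x - (LINT y|haar. \<phi> y) * indicator (cyl 0 0) x) \<in> haar_poly"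
proof -
  obtain m T where "m \<ge> 0" and T: "finite T" "\<phi> = (\<lambda>x. \<Sum>k\<in>T. \<phi> (cpt m k) * indicator (cyl m (cpt m k)) x)"
    by (rule test_fun_step[OF assms])
  have i: "integrable haar (\<lambda>x. indicator (cyl m a) x :: complex)" for a
    by (rule integrable_test_fun[OF indicator_cyl_test_fun])
  have I: "(LINT y|haar. \<phi> y) = (\<Sum>k\<in>T. \<phi> (cpt m k) * of_real (2 powi (- m)))"
    by (subst T(2)) (simp add: i integral_indicator_cyl)
  have "(\<lambda>x. \<Sum>k\<in>T. \<phi> (cpt m k) * (indicator (cyl m (cpt m k)) x - of_real (2 powi (- m)) * indicator (cyl 0 0) x))
      \<in> haar_poly"
    by (rule function_space_sum[OF function_space_haar_poly T(1) indicator_cyl_mean_haar_poly])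
  also have "(\<lambda>x. \<Sum>k\<in>T. \<phi> (cpt m k) * (indicator (cyl m (cpt m k)) x - of_real (2 powi (- m)) * indicator (cyl 0 0) x))
      = (\<lambda>x. \<phi> x - (LINT y|haar. \<phi> y) * indicator (cyl 0 0) x)"
    unfolding I by (subst (2) T(2)) (simp add: algebra_simps sum_subtractf sum_distrib_left)
  finally show ?thesis .
qed

lemma integral_psi: "(LINT x|haar. psi_jk j k x) = 0"
  using integral_mult_psi_const[of j k "\<lambda>_. 1" 1] by simp

lemma integral_haar_poly:
  assumes "\<phi> \<in> haar_poly" shows "(LINT x|haar. \<phi> x) = 0"
proof -
  have "linear_functional haar_poly (\<lambda>\<phi>. LINT x|haar. 1 * \<phi> x)"
    by (rule linear_functional_subset[OF linear_functional_regular haar_poly_subset_test_fun])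
       (simp add: locally_integrable_continuous)
  moreover have "linear_functional haar_poly (\<lambda>\<phi>. 0)" by (simp add: linear_functional_def)
  ultimately have "(LINT x|haar. 1 * \<phi> x) = 0"
    by (rule linear_functional_haar_poly_eqI) (simp_all add: integral_psi assms)
  then show ?thesis by simp
qed

text \<open>This composes \<open>f\<close> with the projection onto Haar polynomials along the
  indicator of the unit ball, so the extension is 0 on that indicator. It serves both to prove
  automatic continuity on \<open>haar_poly\<close> and to produce solutions of the coefficient
  system.\<close>

lemma linear_functional_extend:
  assumes f: "linear_functional haar_poly f"
  shows "linear_functional test_fun (\<lambda>\<phi>. f (\<lambda>x. \<phi> x - (LINT y|haar. \<phi> y) * indicator (cyl 0 0) x))"
proof -
  define R where "R \<phi> = (\<lambda>x. \<phi> x - (LINT y|haar. \<phi> y) * indicator (cyl 0 0) x)" for \<phi> :: "cantor \<Rightarrow> complex"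
  have R: "R \<phi> \<in> haar_poly" if "\<phi> \<in> test_fun" for \<phi>
    unfolding R_def using that by (rule test_fun_mean_haar_poly)
  have "linear_functional test_fun (\<lambda>\<phi>. f (R \<phi>))"
    unfolding linear_functional_def
  proof (intro conjI ballI allI)
    fix \<phi> \<theta> assume t: "\<phi> \<in> test_fun" "\<theta> \<in> test_fun"
    then have "R (\<lambda>x. \<phi> x + \<theta> x) = (\<lambda>x. R \<phi> x + R \<theta> x)"
      by (simp add: R_def Bochner_Integration.integral_add[OF integrable_test_fun integrable_test_fun] algebra_simps)
    then show "f (R (\<lambda>x. \<phi> x + \<theta> x)) = f (R \<phi>) + f (R \<theta>)"
      using linear_functionalD(1)[OF f R R] t by simp
  next
    fix c \<phi> assume t: "\<phi> \<in> test_fun"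
    have "R (\<lambda>x. c * \<phi> x) = (\<lambda>x. c * R \<phi> x)" by (simp add: R_def algebra_simps)
    then show "f (R (\<lambda>x. c * \<phi> x)) = c * f (R \<phi>)" using linear_functionalD(2)[OF f R] t by simp
  qed
  then show ?thesis by (simp add: R_def)
qed

text \<open>Continuity is inherited from the extension to \<open>test_fun\<close>, which agrees with
  \<open>F\<close> on Haar polynomials because their integrals vanish.\<close>

lemma dual_haar_poly_iff:
  "F \<in> dual haar_poly \<longleftrightarrow> F \<in> extensional haar_poly \<and> linear_functional haar_poly F"
proof -
  have "(\<lambda>i. F (u i)) \<longlonglongrightarrow> 0"
    if F: "linear_functional haar_poly F" and u: "\<forall>i. u i \<in> haar_poly" "null_seq u" for u
  proof -
    have "(\<lambda>i. F (\<lambda>x. u i x - (LINT y|haar. u i y) * indicator (cyl 0 0) x)) \<longlonglongrightarrow> 0"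
      by (rule linear_functional_null_seq[OF linear_functional_extend[OF F]])
         (use u haar_poly_subset_test_fun in auto)
    then show ?thesis using u(1) by (simp add: integral_haar_poly)
  qed
  then show ?thesis unfolding dual_def linear_functional_def by blast
qed

lemma dual_haar_poly_eqI:
  assumes "F \<in> dual haar_poly" "G \<in> dual haar_poly" "\<And>j k. F (psi_jk j k) = G (psi_jk j k)"
  shows "F = G"
  using assms linear_functional_haar_poly_eqI[of F G] unfolding dual_haar_poly_iff
  by (auto intro: extensionalityI)

text \<open>The quasi-Haar system spans the test functions: every test function is a step function
  of some level \<ge> 0, and halving reaches that level from level 0 using only \<psi> with j \<ge>
  0.\<close>

lemma linear_functional_test_fun_eqI:
  assumes F: "linear_functional test_fun F" and G: "linear_functional test_fun G"
    and phi: "\<And>k. F (phi_jk 0 k) = G (phi_jk 0 k)"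
    and psi: "\<And>j k. F (psi_jk (int j) k) = G (psi_jk (int j) k)" and "\<phi> \<in> test_fun"
  shows "F \<phi> = G \<phi>"
proof -
  have ind: "F (\<lambda>x. indicator (cyl m a) x) = G (\<lambda>x. indicator (cyl m a) x)" if "0 \<le> m" for m a
    using that
  proof (induction m rule: int_ge_induct)
    case base
    obtain k where k: "cyl 0 a = cyl 0 (cpt 0 k)" using cyl_eq_cyl_cpt[of 0 a] by (elim exE)
    have "(\<lambda>x. indicator (cyl 0 a) x) = phi_jk 0 k" unfolding k by (rule ext) (simp add: phi_0k_eq)
    then show ?case using phi by simp
  next
    case (step m)
    obtain c k where c: "(\<lambda>x. indicator (cyl (m + 1) a) x) = (\<lambda>x. 1 / 2 * indicator (cyl m a) x + c * psi_jk m k x)"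
      by (rule indicator_cyl_refine)
    have H: "H (\<lambda>x. indicator (cyl (m + 1) a) x) = 1 / 2 * H (\<lambda>x. indicator (cyl m a) x) + c * H (psi_jk m k)"
      if "linear_functional test_fun H" for H
      unfolding c by (subst linear_functionalD(1)[OF that], (rule function_spaceD(3)[OF function_space_test_fun] indicator_cyl_test_fun psi_test_fun)+)
        (subst (1 2) linear_functionalD(2)[OF that], (rule indicator_cyl_test_fun psi_test_fun refl)+)
    have "F (psi_jk m k) = G (psi_jk m k)" using psi[of "nat m" k] step(1) by simp
    then show ?case unfolding H[OF F] H[OF G] step(2) by (rule arg_cong)
  qed
  obtain m T where T: "m \<ge> 0" "finite T" "\<phi> = (\<lambda>x. \<Sum>k\<in>T. \<phi> (cpt m k) * indicator (cyl m (cpt m k)) x)"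
    by (rule test_fun_step[OF assms(5)])
  have H: "H \<phi> = (\<Sum>k\<in>T. \<phi> (cpt m k) * H (\<lambda>x. indicator (cyl m (cpt m k)) x))" if "linear_functional test_fun H" for H
  proof -
    have "H \<phi> = H (\<lambda>x. \<Sum>k\<in>T. \<phi> (cpt m k) * indicator (cyl m (cpt m k)) x)" using T(3) by (rule arg_cong)
    also have "\<dots> = (\<Sum>k\<in>T. \<phi> (cpt m k) * H (\<lambda>x. indicator (cyl m (cpt m k)) x))"
      by (rule linear_functional_sum[OF function_space_test_fun that T(2) indicator_cyl_test_fun])
    finally show ?thesis .
  qed
  show ?thesis unfolding H[OF F] H[OF G] ind[OF T(1)] by (rule refl)
qed

section \<open>The Walsh transform and the Gibbs derivative\<close>

lemma bit_mult_eq_1_iff: "a * b = 1 \<longleftrightarrow> a = 1 \<and> b = 1" for a b :: bit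
  by (cases a; cases b) auto

lemma walsh_eq: "walsh t x = (-1) ^ card {k. coord t k = 1 \<and> coord x (- k - 1) = 1}"
  unfolding walsh_def bit_mult_eq_1_iff by (rule refl)

lemma finite_walsh_support: "finite {k. coord t k = 1 \<and> coord x (- k - 1) = 1}"
proof -
  obtain m n where mn: "\<forall>k<m. coord t k = 0" "\<forall>k<n. coord x k = 0"
    using coord_bounded_below[of t] coord_bounded_below[of x] by (elim exE)
  have "{k. coord t k = 1 \<and> coord x (- k - 1) = 1} \<subseteq> {m..- n - 1}"
  proof
    fix k assume "k \<in> {k. coord t k = 1 \<and> coord x (- k - 1) = 1}"
    then have "\<not> k < m" "\<not> - k - 1 < n" using mn by auto
    then show "k \<in> {m..- n - 1}" by simp
  qed
  then show ?thesis using finite_subset by blast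
qed

text \<open>Any finite superset of the relevant places may serve as index set, so that values at
  different points can be compared factor by factor over one set.\<close>

lemma walsh_eq_prod:
  assumes "finite S" "{k. coord t k = 1 \<and> coord x (- k - 1) = 1} \<subseteq> S"
  shows "walsh t x = (\<Prod>k\<in>S. if coord t k = 1 \<and> coord x (- k - 1) = 1 then -1 else 1)"
proof -
  have "{k \<in> S. coord t k = 1 \<and> coord x (- k - 1) = 1} = {k. coord t k = 1 \<and> coord x (- k - 1) = 1}"
    using assms(2) by blast
  then show ?thesis unfolding walsh_eq using prod.inter_filter[OF assms(1), of "\<lambda>_. - 1 :: complex"
    "\<lambda>k. coord t k = 1 \<and> coord x (- k - 1) = 1"] by simp
qed

lemma walsh_add: "walsh t (x + y) = walsh t x * walsh t y"
proof -
  let ?A = "\<lambda>x. {k. coord t k = 1 \<and> coord x (- k - 1) = 1}"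
  let ?S = "?A x \<union> ?A y"
  have S: "finite ?S" using finite_walsh_support by simp
  have b: "a + b = 1 \<longleftrightarrow> a \<noteq> b" for a b :: bit by (cases a; cases b) auto
  have sub: "?A (x + y) \<subseteq> ?S"
  proof
    fix k assume "k \<in> ?A (x + y)"
    then show "k \<in> ?S" unfolding mem_Collect_eq Un_iff coord_plus b by (metis bit_not_one_iff)
  qed
  show ?thesis
    unfolding walsh_eq_prod[OF S sub] walsh_eq_prod[OF S Un_upper1] walsh_eq_prod[OF S Un_upper2]
      prod.distrib[symmetric] coord_plus b
  proof (rule prod.cong[OF refl])
    fix k
    show "(if coord t k = 1 \<and> coord x (- k - 1) \<noteq> coord y (- k - 1) then - 1 else 1) =
        (if coord t k = 1 \<and> coord x (- k - 1) = 1 then - 1 else 1) *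
        (if coord t k = 1 \<and> coord y (- k - 1) = 1 then - 1 else 1 :: complex)"
      by (cases "coord x (- k - 1)"; cases "coord y (- k - 1)") simp_all
  qed
qed

lemma walsh_commute: "walsh t x = walsh x t"
proof -
  have "bij_betw (\<lambda>k. - k - 1) {k. coord t k = 1 \<and> coord x (- k - 1) = 1}
      {k. coord x k = 1 \<and> coord t (- k - 1) = 1}"
    by (rule bij_betwI[where g = "\<lambda>k. - k - 1"]) auto
  from bij_betw_same_card[OF this] show ?thesis unfolding walsh_eq by (rule arg_cong)
qed

text \<open>One half of the duality by which \<open>cyl (- n) 0\<close> is the annihilator of the
  subgroup \<open>cyl n 0\<close>: place k of t meets place - k - 1 of x, and one of the two
  coordinates is always 0.\<close>

lemma walsh_eq_1:
  assumes "t \<in> cyl (- n) 0" "x \<in> cyl n 0" shows "walsh t x = 1"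
proof -
  have "\<not> (coord t k = 1 \<and> coord x (- k - 1) = 1)" for k
  proof (cases "k < - n")
    case True
    then show ?thesis using assms(1) by (simp add: mem_cyl)
  next
    case False
    then show ?thesis using assms(2) by (simp add: mem_cyl)
  qed
  then have "{k. coord t k = 1 \<and> coord x (- k - 1) = 1} = {}" by blast
  then show ?thesis unfolding walsh_eq by (simp only: card.empty power_0)
qed

lemma walsh_single: "walsh t (single n) = (if coord t (- n - 1) = 1 then -1 else 1)"
proof -
  have "{k. coord t k = 1 \<and> coord (single n) (- k - 1) = 1} = (if coord t (- n - 1) = 1 then {- n - 1} else {})"
    by auto
  then show ?thesis unfolding walsh_eq by simp
qed

lemma walsh_const:
  assumes "t \<in> cyl (- n) 0" "y \<in> cyl n x" shows "walsh t y = walsh t x"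
proof -
  have "x + y \<in> cyl n 0" using assms(2) by (simp only: add_mem_cyl_iff add_0_right)
  then have "walsh t (x + y) = 1" by (rule walsh_eq_1[OF assms(1)])
  then have "walsh t (x + (x + y)) = walsh t x" unfolding walsh_add[of t x "x + y"] by simp
  then show ?thesis by (simp only: cantor_add_cancel)
qed

lemma continuous_walsh: "continuous_on UNIV (walsh t)"
proof -
  obtain n where n: "t \<in> cyl n 0" using exists_mem_cyl_zero by auto
  show ?thesis
    by (rule continuous_on_locally_const, rule eventually_nhds_cyl[of "- n"])
       (rule walsh_const, simp_all add: n)
qed

lemma locally_integrable_walsh: "locally_integrable (walsh t)"
  by (rule locally_integrable_continuous[OF continuous_walsh])

text \<open>Either the character is constant on the cylinder, or some translation preserves the
  cylinder and reverses the sign of the character, which forces the integral to vanish.\<close>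

lemma cyl_integral_walsh:
  "cyl_integral n b (walsh t) = of_real (2 powi (- n)) * (walsh t b * indicator (cyl (- n) 0) t)"
proof (cases "t \<in> cyl (- n) 0")
  case True
  have "cyl_integral n b (walsh t) = cyl_integral n b (\<lambda>_. walsh t b)"
    by (rule cyl_integral_cong) (rule walsh_const[OF True])
  then show ?thesis using True by (simp add: cyl_integral_const)
next
  case False
  then obtain k where k: "k < - n" "coord t k = 1" unfolding mem_cyl by auto
  \<comment> \<open>As k < - n, the place - k - 1 is at least n: translation by \<open>?y\<close>
    preserves the cylinder, while the character takes the value -1 at \<open>?y\<close>.\<close>
  let ?y = "single (- k - 1)"
  let ?f = "\<lambda>x. indicator (cyl n b) x * walsh t x"
  have y: "walsh t ?y = - 1" using k by (simp add: walsh_single)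
  have c: "?y + b \<in> cyl n b" using k(1) unfolding mem_cyl coord_plus by auto
  have "?f (?y + x) = - ?f x" for x
  proof -
    have "?y + x \<in> cyl n b \<longleftrightarrow> x \<in> cyl n b" unfolding add_mem_cyl_iff using cyl_eqI[OF c] by simp
    then show ?thesis by (simp add: indicator_def walsh_add y)
  qed
  then have "(LINT x|haar. ?f (?y + x)) = - (LINT x|haar. ?f x)" by simp
  moreover have "(LINT x|haar. ?f (?y + x)) = (LINT x|haar. ?f x)"
    by (rule integral_haar_add)
       (intro borel_measurable_continuous_onI continuous_on_mult continuous_indicator_cyl continuous_walsh)
  ultimately have "(LINT x|haar. ?f x) = 0" by simp
  then show ?thesis using False by (simp add: cyl_integral_def)
qed

lemma linear_functional_walsh_transform: "linear_functional test_fun (\<lambda>\<phi>. walsh_transform \<phi> \<xi>)"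
  using linear_functional_regular[OF locally_integrable_walsh, of \<xi>]
  by (simp add: walsh_transform_def mult.commute)

lemma walsh_transform_indicator_cyl:
  "walsh_transform (\<lambda>x. indicator (cyl n b) x) \<xi> = of_real (2 powi (- n)) * (walsh \<xi> b * indicator (cyl (- n) 0) \<xi>)"
  using cyl_integral_walsh[of n b \<xi>] by (simp add: walsh_transform_def cyl_integral_def)

text \<open>This makes the transform injective on test functions, which the definite description in
  \<open>gibbs\<close> requires. For step functions it reduces to transforming one cylinder
  twice.\<close>

lemma walsh_inversion:
  assumes "\<phi> \<in> test_fun"
  shows "(LINT \<xi>|haar. walsh_transform \<phi> \<xi> * walsh a \<xi>) = \<phi> a"
proof -
  obtain m T where "m \<ge> 0" and T: "finite T" "\<phi> = (\<lambda>x. \<Sum>k\<in>T. \<phi> (cpt m k) * indicator (cyl m (cpt m k)) x)"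
    by (rule test_fun_step[OF assms])
  have "walsh_transform \<phi> \<xi> * walsh a \<xi> = (\<Sum>k\<in>T. \<phi> (cpt m k) * of_real (2 powi (- m)) *
      (indicator (cyl (- m) 0) \<xi> * walsh (cpt m k + a) \<xi>))" for \<xi>
  proof -
    have "walsh_transform \<phi> \<xi> = walsh_transform (\<lambda>x. \<Sum>k\<in>T. \<phi> (cpt m k) * indicator (cyl m (cpt m k)) x) \<xi>"
      using T(2) by (rule arg_cong)
    also have "\<dots> = (\<Sum>k\<in>T. \<phi> (cpt m k) * walsh_transform (\<lambda>x. indicator (cyl m (cpt m k)) x) \<xi>)"
      by (rule linear_functional_sum[OF function_space_test_fun linear_functional_walsh_transform T(1) indicator_cyl_test_fun])
    finally show ?thesis
      unfolding walsh_transform_indicator_cyl walsh_commute[of _ \<xi>] walsh_add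
      by (simp add: sum_distrib_right sum_distrib_left mult_ac)
  qed
  then have "(LINT \<xi>|haar. walsh_transform \<phi> \<xi> * walsh a \<xi>) =
      (\<Sum>k\<in>T. \<phi> (cpt m k) * of_real (2 powi (- m)) * cyl_integral (- m) 0 (walsh (cpt m k + a)))"
    unfolding cyl_integral_def using locally_integrableD(2)[OF locally_integrable_walsh] by simp
  also have "\<dots> = (\<Sum>k\<in>T. \<phi> (cpt m k) * indicator (cyl m (cpt m k)) a)"
  proof (rule sum.cong[OF refl])
    fix k
    have w: "walsh (cpt m k + a) 0 = 1" by (simp add: walsh_eq)
    have i: "indicator (cyl m 0) (cpt m k + a) = (indicator (cyl m (cpt m k)) a :: complex)"
      unfolding indicator_def add_mem_cyl_iff by simp
    have "of_real (2 powi (- m)) * of_real (2 powi m) = (1 :: complex)"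
      by (simp add: power_int_minus flip: of_real_mult)
    then show "\<phi> (cpt m k) * of_real (2 powi (- m)) * cyl_integral (- m) 0 (walsh (cpt m k + a)) =
        \<phi> (cpt m k) * indicator (cyl m (cpt m k)) a"
      unfolding cyl_integral_walsh minus_minus w i by (simp add: mult.assoc[symmetric])
  qed
  also have "\<dots> = \<phi> a" using fun_cong[OF T(2), of a] by (rule sym)
  finally show ?thesis .
qed

lemma gibbs_symbol_psi:
  "of_real (gibbs_symbol \<alpha> \<xi>) * walsh_transform (psi_jk j k) \<xi> =
   of_real (2 powr (j * \<alpha>)) * walsh_transform (psi_jk j k) \<xi>"
proof (cases "walsh_transform (psi_jk j k) \<xi> = 0")
  case False
  have "walsh_transform (psi_jk j k) \<xi> = (LINT x|haar. walsh \<xi> x * psi_jk j k x)"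
    by (simp add: walsh_transform_def mult.commute)
  also have "\<dots> = of_real (2 powr (j / 2)) * (of_real (2 powi (- (j + 1))) *
      (walsh \<xi> (cpt j k) * indicator (cyl (- (j + 1)) 0) \<xi> * (1 - walsh \<xi> (single j))))"
    unfolding integral_mult_psi(1)[OF locally_integrable_walsh] cyl_integral_walsh walsh_add
    by (simp add: algebra_simps)
  \<comment> \<open>The indicator kills \<xi> unless its coordinates below - j - 1 vanish, and the
    factor 1 - \<open>walsh \<xi> (single j)\<close> kills it unless the coordinate at - j - 1 is 1.
    So the first 1 stands exactly at - j - 1, which gives norm 2^j.\<close>
  finally have nz: "\<xi> \<in> cyl (- (j + 1)) 0" "walsh \<xi> (single j) \<noteq> 1"
    using False by (auto simp: indicator_def split: if_splits)
  then have one: "coord \<xi> (- j - 1) = 1" by (auto simp: walsh_single split: if_splits)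
  then have "\<xi> \<noteq> 0" by auto
  note fo = first_one[OF this]
  have "\<not> first_one \<xi> < - j - 1" using nz(1) fo(1) by (auto simp: mem_cyl)
  moreover have "\<not> - j - 1 < first_one \<xi>" using fo(2) one by auto
  ultimately have "cnorm \<xi> = 2 powi j" using \<open>\<xi> \<noteq> 0\<close> by (simp add: cnorm_def)
  also have "\<dots> = 2 powr j" by (simp add: powr_real_of_int')
  finally have "gibbs_symbol \<alpha> \<xi> = 2 powr (j * \<alpha>)" using \<open>\<xi> \<noteq> 0\<close> by (simp add: gibbs_symbol_def powr_powr)
  then show ?thesis by simp
qed simp

section \<open>The Gibbs derivative on Haar polynomials\<close>

lemma gibbs_eqI:
  assumes "\<theta> \<in> haar_poly"
    and "\<And>\<xi>. walsh_transform \<theta> \<xi> = of_real (gibbs_symbol \<alpha> \<xi>) * walsh_transform \<phi> \<xi>"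
  shows "gibbs \<alpha> \<phi> = \<theta>"
  unfolding gibbs_def
proof (rule the_equality)
  fix \<eta> assume \<eta>: "\<eta> \<in> haar_poly \<and> (\<forall>\<xi>. walsh_transform \<eta> \<xi> = of_real (gibbs_symbol \<alpha> \<xi>) * walsh_transform \<phi> \<xi>)"
  have "\<eta> a = \<theta> a" for a
    using walsh_inversion[of \<eta> a] walsh_inversion[of \<theta> a] \<eta> assms
      subsetD[OF haar_poly_subset_test_fun, of \<eta>] subsetD[OF haar_poly_subset_test_fun, of \<theta>] by simp
  then show "\<eta> = \<theta>" by (rule ext)
qed (use assms in auto)

lemma gibbs_haar_poly:
  assumes "\<phi> \<in> haar_poly"
  shows "gibbs \<alpha> \<phi> \<in> haar_poly"
    "walsh_transform (gibbs \<alpha> \<phi>) \<xi> = of_real (gibbs_symbol \<alpha> \<xi>) * walsh_transform \<phi> \<xi>"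
proof -
  obtain A c where A: "finite A" "\<phi> = (\<lambda>x. \<Sum>i\<in>A. c i * psi_jk (fst i) (snd i) x)"
    by (rule haar_polyE[OF assms])
  \<comment> \<open>Each Haar coefficient is multiplied by its eigenvalue; by uniqueness this
    candidate is the Gibbs derivative.\<close>
  let ?\<theta> = "\<lambda>x. \<Sum>i\<in>A. (c i * of_real (2 powr (real_of_int (fst i) * \<alpha>))) * psi_jk (fst i) (snd i) x"
  have \<theta>: "?\<theta> \<in> haar_poly"
    by (rule function_space_sum[OF function_space_haar_poly A(1) psi_haar_poly])
  have wt: "walsh_transform (\<lambda>x. \<Sum>i\<in>A. d i * psi_jk (fst i) (snd i) x) \<xi> =
      (\<Sum>i\<in>A. d i * walsh_transform (psi_jk (fst i) (snd i)) \<xi>)" for d \<xi>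
    by (rule linear_functional_sum[OF function_space_test_fun linear_functional_walsh_transform A(1) psi_test_fun])
  have "walsh_transform ?\<theta> \<xi> = of_real (gibbs_symbol \<alpha> \<xi>) * walsh_transform \<phi> \<xi>" for \<xi>
    unfolding A(2) wt sum_distrib_left
  proof (rule sum.cong[OF refl])
    fix i
    show "c i * of_real (2 powr (real_of_int (fst i) * \<alpha>)) * walsh_transform (psi_jk (fst i) (snd i)) \<xi> =
        of_real (gibbs_symbol \<alpha> \<xi>) * (c i * walsh_transform (psi_jk (fst i) (snd i)) \<xi>)"
      unfolding mult.left_commute[of "of_real (gibbs_symbol \<alpha> \<xi>)"] gibbs_symbol_psi by (rule mult.assoc)
  qed
  then show "gibbs \<alpha> \<phi> \<in> haar_poly"
    "walsh_transform (gibbs \<alpha> \<phi>) \<xi> = of_real (gibbs_symbol \<alpha> \<xi>) * walsh_transform \<phi> \<xi>"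
    using gibbs_eqI[OF \<theta>] \<theta> by auto
qed

lemma gibbs_add:
  assumes "\<phi> \<in> haar_poly" "\<theta> \<in> haar_poly"
  shows "gibbs \<alpha> (\<lambda>x. \<phi> x + \<theta> x) = (\<lambda>x. gibbs \<alpha> \<phi> x + gibbs \<alpha> \<theta> x)"
  by (rule gibbs_eqI)
     (use assms haar_poly_subset_test_fun gibbs_haar_poly in
       \<open>auto intro!: function_spaceD[OF function_space_haar_poly]
          simp: linear_functionalD(1)[OF linear_functional_walsh_transform] subsetD algebra_simps\<close>)

lemma gibbs_mult:
  assumes "\<phi> \<in> haar_poly"
  shows "gibbs \<alpha> (\<lambda>x. c * \<phi> x) = (\<lambda>x. c * gibbs \<alpha> \<phi> x)"
  by (rule gibbs_eqI)
     (use assms haar_poly_subset_test_fun gibbs_haar_poly in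
       \<open>auto intro!: function_spaceD[OF function_space_haar_poly]
          simp: linear_functionalD(2)[OF linear_functional_walsh_transform] subsetD algebra_simps\<close>)

lemma gibbs_psi: "gibbs \<alpha> (psi_jk j k) = (\<lambda>x. of_real (2 powr (j * \<alpha>)) * psi_jk j k x)"
proof (rule gibbs_eqI)
  show "(\<lambda>x. of_real (2 powr (j * \<alpha>)) * psi_jk j k x) \<in> haar_poly"
    by (rule function_spaceD(3)[OF function_space_haar_poly psi_haar_poly])
  show "walsh_transform (\<lambda>x. of_real (2 powr (j * \<alpha>)) * psi_jk j k x) \<xi> =
      of_real (gibbs_symbol \<alpha> \<xi>) * walsh_transform (psi_jk j k) \<xi>" for \<xi>
    unfolding gibbs_symbol_psi by (rule linear_functionalD(2)[OF linear_functional_walsh_transform psi_test_fun])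
qed

lemma linear_functional_gibbs:
  assumes "linear_functional haar_poly f"
  shows "linear_functional haar_poly (\<lambda>\<phi>. f (gibbs \<alpha> \<phi>))"
  unfolding linear_functional_def
  by (simp add: gibbs_add gibbs_mult linear_functionalD[OF assms] gibbs_haar_poly)

text \<open>Both sides of the equation are linear on \<open>haar_poly\<close>, so testing on the
  Haar functions suffices, and there the Gibbs derivative is multiplication by the
  eigenvalue.\<close>

lemma solves_iff:
  assumes "g \<in> dual haar_poly"
  shows "solves \<alpha> \<beta> g f \<longleftrightarrow> f \<in> dual haar_poly \<and>
    (\<forall>j k. of_real (2 powr (real_of_int j * \<alpha>) + \<beta>) * f (psi_jk j k) = g (psi_jk j k))"
proof (cases "f \<in> dual haar_poly")
  case True
  then have f: "linear_functional haar_poly f" by (simp add: dual_haar_poly_iff)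
  have g: "linear_functional haar_poly g" using assms by (simp add: dual_haar_poly_iff)
  have L: "linear_functional haar_poly (\<lambda>\<phi>. f (gibbs \<alpha> \<phi>) + of_real \<beta> * f \<phi>)"
    by (intro linear_functional_add linear_functional_mult linear_functional_gibbs f)
  have psi: "f (gibbs \<alpha> (psi_jk j k)) + of_real \<beta> * f (psi_jk j k) =
      of_real (2 powr (real_of_int j * \<alpha>) + \<beta>) * f (psi_jk j k)" for j k
    unfolding gibbs_psi linear_functionalD(2)[OF f psi_haar_poly] by (simp add: algebra_simps)
  have "solves \<alpha> \<beta> g f \<longleftrightarrow> (\<forall>\<phi>\<in>haar_poly. f (gibbs \<alpha> \<phi>) + of_real \<beta> * f \<phi> = g \<phi>)"
    using True by (simp add: solves_def gibbs_dual_def)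
  also have "\<dots> \<longleftrightarrow> (\<forall>j k. f (gibbs \<alpha> (psi_jk j k)) + of_real \<beta> * f (psi_jk j k) = g (psi_jk j k))"
    using linear_functional_haar_poly_eqI[OF L g] psi_haar_poly by blast
  finally show ?thesis using True by (simp only: psi simp_thms)
qed (simp add: solves_def)

section \<open>Formal Haar series as functionals\<close>

lemma infsum_finite_support:
  fixes f :: "'a \<Rightarrow> complex"
  assumes "finite S" "\<And>i. i \<notin> S \<Longrightarrow> f i = 0"
  shows "(\<Sum>\<^sub>\<infinity>i. f i) = (\<Sum>i\<in>S. f i)"
  by (rule infsumI, rule has_sum_finite_neutralI[OF assms(1)]) (use assms(2) in auto)

text \<open>No convergence is involved: for any two functions all nonzero terms lie in one finite
  index set, on which linearity is termwise.\<close>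

lemma linear_functional_infsum:
  fixes F :: "'i \<Rightarrow> (cantor \<Rightarrow> complex) \<Rightarrow> complex"
  assumes F: "\<And>i. linear_functional V (F i)" and fin: "\<And>\<phi>. \<phi> \<in> V \<Longrightarrow> finite {i. F i \<phi> \<noteq> 0}"
  shows "linear_functional V (\<lambda>\<phi>. \<Sum>\<^sub>\<infinity>i. v i * F i \<phi>)"
  unfolding linear_functional_def
proof (intro conjI ballI allI)
  fix \<phi> \<theta> assume V: "\<phi> \<in> V" "\<theta> \<in> V"
  let ?S = "{i. F i \<phi> \<noteq> 0} \<union> {i. F i \<theta> \<noteq> 0}"
  have S: "finite ?S" using fin V by simp
  have F': "F i (\<lambda>x. \<phi> x + \<theta> x) = F i \<phi> + F i \<theta>" for i by (rule linear_functionalD(1)[OF F V])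
  have "(\<Sum>\<^sub>\<infinity>i. v i * F i (\<lambda>x. \<phi> x + \<theta> x)) = (\<Sum>i\<in>?S. v i * F i (\<lambda>x. \<phi> x + \<theta> x))"
    by (rule infsum_finite_support[OF S]) (simp add: F')
  moreover have "(\<Sum>\<^sub>\<infinity>i. v i * F i \<phi>) = (\<Sum>i\<in>?S. v i * F i \<phi>)" "(\<Sum>\<^sub>\<infinity>i. v i * F i \<theta>) = (\<Sum>i\<in>?S. v i * F i \<theta>)"
    by (rule infsum_finite_support[OF S], simp)+
  ultimately show "(\<Sum>\<^sub>\<infinity>i. v i * F i (\<lambda>x. \<phi> x + \<theta> x)) = (\<Sum>\<^sub>\<infinity>i. v i * F i \<phi>) + (\<Sum>\<^sub>\<infinity>i. v i * F i \<theta>)"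
    by (simp add: F' distrib_left sum.distrib)
next
  fix c \<phi> assume V: "\<phi> \<in> V"
  have "v i * F i (\<lambda>x. c * \<phi> x) = c * (v i * F i \<phi>)" for i
    unfolding linear_functionalD(2)[OF F V] by (rule mult.left_commute)
  then show "(\<Sum>\<^sub>\<infinity>i. v i * F i (\<lambda>x. c * \<phi> x)) = c * (\<Sum>\<^sub>\<infinity>i. v i * F i \<phi>)"
    by (simp only: infsum_cmult_right')
qed

lemma linear_functional_regular_psi: "linear_functional test_fun (\<lambda>\<phi>. LINT x|haar. psi_jk j k x * \<phi> x)"
  by (rule linear_functional_regular[OF locally_integrable_continuous[OF continuous_psi]])

lemma finite_psi_coeffs:
  assumes "\<phi> \<in> haar_poly"
  shows "finite {i. (LINT x|haar. psi_jk (fst i) (snd i) x * \<phi> x) \<noteq> 0}"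
proof -
  obtain A c where A: "finite A" "\<phi> = (\<lambda>x. \<Sum>i\<in>A. c i * psi_jk (fst i) (snd i) x)"
    by (rule haar_polyE[OF assms])
  have "(LINT x|haar. psi_jk (fst i) (snd i) x * \<phi> x) = (\<Sum>l\<in>A. c l * of_bool (fst i = fst l \<and> snd i = snd l))" for i
    unfolding A(2)
    by (subst linear_functional_sum[OF function_space_test_fun linear_functional_regular_psi A(1) psi_test_fun])
       (simp only: psi_orthonormal)
  then have "{i. (LINT x|haar. psi_jk (fst i) (snd i) x * \<phi> x) \<noteq> 0} \<subseteq> A"
    by (force simp: prod_eq_iff intro: sum.neutral)
  then show ?thesis using A(1) finite_subset by blast
qed

text \<open>Orthonormality makes the series finite on each Haar polynomial and returns the
  prescribed coefficients; continuity is automatic, so \<open>v\<close> may grow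
  arbitrarily.\<close>

lemma exists_dual_haar_poly: "\<exists>f\<in>dual haar_poly. \<forall>j k. f (psi_jk j k) = v j k"
proof -
  let ?F = "\<lambda>i \<phi>. LINT x|haar. psi_jk (fst i) (snd i) x * \<phi> x"
  let ?f = "\<lambda>\<phi>. \<Sum>\<^sub>\<infinity>i. v (fst i) (snd i) * ?F i \<phi>"
  have lin: "linear_functional haar_poly ?f"
    by (rule linear_functional_infsum[OF linear_functional_subset[OF linear_functional_regular_psi haar_poly_subset_test_fun] finite_psi_coeffs])
  then have "linear_functional haar_poly (restrict ?f haar_poly)"
    by (subst linear_functional_cong[OF function_space_haar_poly, where G = ?f]) simp_all
  then have "restrict ?f haar_poly \<in> dual haar_poly" by (simp add: dual_haar_poly_iff)
  moreover have "?f (psi_jk j k) = v j k" for j k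
    by (subst infsum_finite_support[of "{(j, k)}"]) (auto simp: psi_orthonormal prod_eq_iff)
  ultimately show ?thesis by (intro bexI[of _ "restrict ?f haar_poly"]) (simp_all add: psi_haar_poly)
qed

lemma solves_unique:
  assumes g: "g \<in> dual haar_poly" and \<beta>: "\<forall>j::int. \<beta> \<noteq> - (2 powr (real_of_int j * \<alpha>))"
  shows "solves \<alpha> \<beta> g f \<longleftrightarrow> f \<in> dual haar_poly \<and> (\<forall>j k. f (psi_jk j k) = sol_coeff \<alpha> \<beta> g j k)"
    and "\<exists>!f. solves \<alpha> \<beta> g f"
proof -
  have nz: "complex_of_real (2 powr (real_of_int j * \<alpha>) + \<beta>) \<noteq> 0" for j
    unfolding of_real_eq_0_iff using \<beta>[rule_format, of j] by linarith
  have *: "solves \<alpha> \<beta> g f \<longleftrightarrow> f \<in> dual haar_poly \<and> (\<forall>j k. f (psi_jk j k) = sol_coeff \<alpha> \<beta> g j k)" for f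
    unfolding solves_iff[OF g] sol_coeff_def using nz by (auto simp: field_simps)
  show "solves \<alpha> \<beta> g f \<longleftrightarrow> f \<in> dual haar_poly \<and> (\<forall>j k. f (psi_jk j k) = sol_coeff \<alpha> \<beta> g j k)" by (rule *)
  obtain f where f: "f \<in> dual haar_poly" "\<forall>j k. f (psi_jk j k) = sol_coeff \<alpha> \<beta> g j k"
    using exists_dual_haar_poly by blast
  show "\<exists>!f. solves \<alpha> \<beta> g f"
  proof (rule ex1I[of _ f])
    show "solves \<alpha> \<beta> g f" using * f by blast
    show "h = f" if "solves \<alpha> \<beta> g h" for h
      using that f by (intro dual_haar_poly_eqI) (simp_all add: *)
  qed
qed

section \<open>Orthonormal sequences in L2\<close>

definition square_integrable :: "'a measure \<Rightarrow> ('a \<Rightarrow> complex) \<Rightarrow> bool" where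
  "square_integrable M f \<longleftrightarrow> f \<in> borel_measurable M \<and> integrable M (\<lambda>x. (cmod (f x))\<^sup>2)"

lemma square_integrable_measurable: "square_integrable M f \<Longrightarrow> f \<in> borel_measurable M"
  by (simp add: square_integrable_def)

lemma mult_le_sum_squares: "a * b \<le> a\<^sup>2 + b\<^sup>2" if "0 \<le> a" "0 \<le> b" for a b :: real
  using zero_le_power2[of "a - b"] mult_nonneg_nonneg[OF that] unfolding power2_diff by linarith

lemma norm_mult_le_sum_squares: "norm (a * b) \<le> (norm a)\<^sup>2 + (norm b)\<^sup>2" for a b :: complex
  unfolding norm_mult by (rule mult_le_sum_squares) simp_all

lemma square_integrable_mult:
  assumes "square_integrable M f" "square_integrable M g"
  shows "integrable M (\<lambda>x. f x * g x)"
proof (rule Bochner_Integration.integrable_bound)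
  show "integrable M (\<lambda>x. (cmod (f x))\<^sup>2 + (cmod (g x))\<^sup>2)"
    using assms by (intro Bochner_Integration.integrable_add) (simp_all add: square_integrable_def)
  show "(\<lambda>x. f x * g x) \<in> borel_measurable M"
    using assms[THEN square_integrable_measurable] by measurable
  show "AE x in M. norm (f x * g x) \<le> norm ((cmod (f x))\<^sup>2 + (cmod (g x))\<^sup>2)"
    using norm_mult_le_sum_squares by auto
qed

lemma measurable_cnj [measurable]: "cnj \<in> borel_measurable borel"
  by (intro borel_measurable_continuous_onI continuous_intros)

lemma square_integrable_cnj: "square_integrable M f \<Longrightarrow> square_integrable M (\<lambda>x. cnj (f x))"
  unfolding square_integrable_def by (auto intro: measurable_compose[OF _ measurable_cnj])

lemma square_integrable_cmult: "square_integrable M f \<Longrightarrow> square_integrable M (\<lambda>x. c * f x)"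
  unfolding square_integrable_def by (auto simp: norm_mult power_mult_distrib)

lemma square_integrable_bound:
  assumes "f \<in> borel_measurable M" "integrable M S" "AE x in M. (cmod (f x))\<^sup>2 \<le> S x"
  shows "square_integrable M f"
  unfolding square_integrable_def
proof (intro conjI assms(1))
  show "integrable M (\<lambda>x. (cmod (f x))\<^sup>2)"
  proof (rule Bochner_Integration.integrable_bound[OF assms(2)])
    show "(\<lambda>x. (cmod (f x))\<^sup>2) \<in> borel_measurable M" using assms(1) by measurable
    show "AE x in M. norm ((cmod (f x))\<^sup>2) \<le> norm (S x)"
      using assms(3) by eventually_elim simp
  qed
qed

lemma square_integrable_add:
  assumes "square_integrable M f" "square_integrable M g"
  shows "square_integrable M (\<lambda>x. f x + g x)"
proof (rule square_integrable_bound)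
  show "(\<lambda>x. f x + g x) \<in> borel_measurable M"
    using assms[THEN square_integrable_measurable] by measurable
  show "integrable M (\<lambda>x. 2 * (cmod (f x))\<^sup>2 + 2 * (cmod (g x))\<^sup>2)"
    using assms by (intro Bochner_Integration.integrable_add) (simp_all add: square_integrable_def)
  have "(cmod (a + b))\<^sup>2 \<le> 2 * (cmod a)\<^sup>2 + 2 * (cmod b)\<^sup>2" for a b
  proof -
    have "(cmod (a + b))\<^sup>2 \<le> (cmod a + cmod b)\<^sup>2" by (intro power_mono norm_triangle_ineq) simp
    moreover have "0 \<le> (cmod a - cmod b)\<^sup>2" by simp
    ultimately show ?thesis unfolding power2_sum power2_diff by linarith
  qed
  then show "AE x in M. (cmod (f x + g x))\<^sup>2 \<le> 2 * (cmod (f x))\<^sup>2 + 2 * (cmod (g x))\<^sup>2" by simp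
qed

lemma square_integrable_sum:
  assumes "finite A" "\<And>i. i \<in> A \<Longrightarrow> square_integrable M (f i)"
  shows "square_integrable M (\<lambda>x. \<Sum>i\<in>A. f i x)"
  using assms
proof (induction A rule: finite_induct)
  case empty
  show ?case by (simp add: square_integrable_def)
next
  case (insert i A)
  then show ?case by (simp add: square_integrable_add)
qed

lemma of_real_integral_cmod_squared:
  "complex_of_real (LINT x|M. (cmod (f x))\<^sup>2) = (LINT x|M. f x * cnj (f x))"
  by (simp only: integral_complex_of_real[symmetric] complex_norm_square)

locale orthonormal_sequence =
  fixes M :: "'a measure" and e :: "nat \<Rightarrow> 'a \<Rightarrow> complex"
  assumes L2: "\<And>i. square_integrable M (e i)"
    and orthonormal: "\<And>i j. (LINT x|M. e i x * cnj (e j x)) = of_bool (i = j)"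
begin

lemma square_integrable_comb: "finite A \<Longrightarrow> square_integrable M (\<lambda>x. \<Sum>i\<in>A. c i * e i x)"
  by (intro square_integrable_sum square_integrable_cmult L2)

lemma integral_mult_cnj_comb:
  assumes "finite A" "square_integrable M f"
  shows "(LINT x|M. f x * cnj (\<Sum>i\<in>A. c i * e i x)) = (\<Sum>i\<in>A. cnj (c i) * (LINT x|M. f x * cnj (e i x)))"
proof -
  have "f x * cnj (\<Sum>i\<in>A. c i * e i x) = (\<Sum>i\<in>A. cnj (c i) * (f x * cnj (e i x)))" for x
    by (simp add: sum_distrib_left mult_ac)
  then show ?thesis
    using square_integrable_mult[OF assms(2) square_integrable_cnj[OF L2]] by simp
qed

lemma integral_comb_mult_cnj:
  assumes "finite A"
  shows "(LINT x|M. (\<Sum>i\<in>A. c i * e i x) * cnj (e j x)) = (if j \<in> A then c j else 0)"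
proof -
  have "(\<Sum>i\<in>A. c i * e i x) * cnj (e j x) = (\<Sum>i\<in>A. c i * (e i x * cnj (e j x)))" for x
    by (simp only: sum_distrib_right mult.assoc)
  then have "(LINT x|M. (\<Sum>i\<in>A. c i * e i x) * cnj (e j x)) = (\<Sum>i\<in>A. c i * of_bool (i = j))"
    using square_integrable_mult[OF L2 square_integrable_cnj[OF L2]] by (simp add: orthonormal)
  also have "\<dots> = (if j \<in> A then c j else 0)"
    using assms by (simp add: of_bool_def if_distrib cong: if_cong)
  finally show ?thesis .
qed

lemma integral_norm_comb:
  assumes "finite A"
  shows "(LINT x|M. (cmod (\<Sum>i\<in>A. c i * e i x))\<^sup>2) = (\<Sum>i\<in>A. (cmod (c i))\<^sup>2)"
proof -
  have "complex_of_real (LINT x|M. (cmod (\<Sum>i\<in>A. c i * e i x))\<^sup>2) = (\<Sum>i\<in>A. cnj (c i) * c i)"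
    unfolding of_real_integral_cmod_squared
      integral_mult_cnj_comb[OF assms square_integrable_comb[OF assms]] integral_comb_mult_cnj[OF assms]
    by simp
  also have "\<dots> = complex_of_real (\<Sum>i\<in>A. (cmod (c i))\<^sup>2)"
    unfolding of_real_sum complex_norm_square by (simp only: mult.commute)
  finally show ?thesis by (simp only: of_real_eq_iff)
qed

text \<open>Expand the squared norm of f - \<open>F\<close>, where \<open>F\<close> is the
  projection of f onto the first n functions: the mixed products and the norm of \<open>F\<close>
  all equal \<open>s\<close>.\<close>

lemma bessel:
  assumes f: "square_integrable M f"
  shows "summable (\<lambda>i. (cmod (LINT x|M. f x * cnj (e i x)))\<^sup>2)"
proof (rule summableI_nonneg_bounded)
  fix n
  define a where "a i = (LINT x|M. f x * cnj (e i x))" for i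
  define F where "F x = (\<Sum>i<n. a i * e i x)" for x
  have F: "square_integrable M F" unfolding F_def by (rule square_integrable_comb) simp
  define s where "s = (\<Sum>i<n. (cmod (a i))\<^sup>2)"
  have s: "complex_of_real s = (\<Sum>i<n. cnj (a i) * a i)"
    unfolding s_def of_real_sum complex_norm_square by (simp only: mult.commute)
  have fF: "(LINT x|M. f x * cnj (F x)) = of_real s"
    unfolding F_def integral_mult_cnj_comb[OF finite_lessThan f] a_def[symmetric] s ..
  have "(LINT x|M. F x * cnj (f x)) = (LINT x|M. cnj (f x * cnj (F x)))" by (simp add: mult.commute)
  also have "\<dots> = cnj (LINT x|M. f x * cnj (F x))" by (rule Bochner_Integration.integral_cnj)
  finally have Ff: "(LINT x|M. F x * cnj (f x)) = of_real s" unfolding fF by simp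
  have FF: "(LINT x|M. F x * cnj (F x)) = of_real s"
    unfolding of_real_integral_cmod_squared[symmetric] F_def integral_norm_comb[OF finite_lessThan] s_def ..
  note int = square_integrable_mult[OF _ square_integrable_cnj]
  have "complex_of_real (LINT x|M. (cmod (f x + - 1 * F x))\<^sup>2) =
      (LINT x|M. (f x * cnj (f x) - f x * cnj (F x)) - (F x * cnj (f x) - F x * cnj (F x)))"
    unfolding of_real_integral_cmod_squared by (simp add: algebra_simps)
  also have "\<dots> = (LINT x|M. f x * cnj (f x)) - of_real s"
    by (simp add: int f F fF Ff FF)
  also have "\<dots> = complex_of_real ((LINT x|M. (cmod (f x))\<^sup>2) - s)"
    by (simp add: of_real_integral_cmod_squared)
  finally have "(LINT x|M. (cmod (f x))\<^sup>2) - s = (LINT x|M. (cmod (f x + - 1 * F x))\<^sup>2)"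
    by (simp only: of_real_eq_iff)
  also have "\<dots> \<ge> 0" by simp
  finally show "(\<Sum>i<n. (cmod (LINT x|M. f x * cnj (e i x)))\<^sup>2) \<le> (LINT x|M. (cmod (f x))\<^sup>2)"
    by (simp add: s_def a_def)
qed simp

text \<open>The partial sums are taken along blocks whose squared norms decay like \<open>4\<close> to the power
  \<open>- k\<close>. The Cauchy--Schwarz inequality with weights \<open>2\<close> to the power \<open>k\<close> then bounds all
  partial sums by one integrable function.\<close>

lemma riesz_fischer:
  assumes c: "summable (\<lambda>i. (cmod (c i))\<^sup>2)"
  shows "\<exists>f. square_integrable M f \<and> (\<forall>j. (LINT x|M. f x * cnj (e j x)) = c j)"
proof -
  have "\<exists>N. \<forall>m\<ge>N. \<forall>n. (\<Sum>i\<in>{m..<n}. (cmod (c i))\<^sup>2) < (1 / 4) ^ k" for k :: nat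
    using c[unfolded summable_Cauchy, rule_format, of "(1 / 4) ^ k"] by (auto simp: sum_nonneg)
  then obtain N0 where N0: "\<And>k m n. m \<ge> N0 k \<Longrightarrow> (\<Sum>i\<in>{m..<n}. (cmod (c i))\<^sup>2) < (1 / 4) ^ k"
    by metis
  \<comment> \<open>The sum makes \<open>N\<close> monotone and at least \<open>N0 k\<close> for k
    \<ge> 1, and the summand k makes it unbounded. \<open>N 0 = 0\<close> lets the blocks exhaust
    all indices; the first block has no decay estimate, so the bounds below start at k = 1.\<close>
  define N where "N k = (if k = 0 then 0 else k + (\<Sum>l\<le>k. N0 l))" for k
  have N_mono: "N k \<le> N (Suc k)" for k by (simp add: N_def)
  have N_ge: "k \<le> N k" for k by (simp add: N_def)
  have N_N0: "N0 k \<le> N k" if "k \<ge> 1" for k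
    using that member_le_sum[of k "{..k}" N0] by (simp add: N_def trans_le_add2)
  define D where "D k x = (\<Sum>i\<in>{N k..<N (Suc k)}. c i * e i x)" for k x
  have D: "square_integrable M (D k)" for k
    unfolding D_def by (rule square_integrable_comb) simp
  have F: "(\<Sum>k<n. D k x) = (\<Sum>i<N n. c i * e i x)" for n x
  proof (induction n)
    case (Suc n)
    have "(\<Sum>i<N (Suc n). c i * e i x) = (\<Sum>i<N n. c i * e i x) + D n x"
      unfolding D_def using N_mono[of n] by (simp add: lessThan_atLeast0 sum.atLeastLessThan_concat)
    then show ?case using Suc.IH by simp
  qed (simp add: N_def)
  \<comment> \<open>The weight 2^k is affordable: against the decay 4^(-k) the integrals still sum,
    so \<open>W k x\<close> is summable in k for almost every x.\<close>
  define W where "W k x = 2 ^ k * (cmod (D k x))\<^sup>2" for k x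
  have W_int: "integrable M (W k)" for k using D[of k] by (simp add: W_def[abs_def] square_integrable_def)
  have W0: "0 \<le> W k x" for k x by (simp add: W_def)
  have "(LINT x|M. W k x) \<le> (1 / 2) ^ k" if "k \<ge> 1" for k
  proof -
    have "(LINT x|M. W k x) = 2 ^ k * (\<Sum>i\<in>{N k..<N (Suc k)}. (cmod (c i))\<^sup>2)"
      by (simp add: W_def D_def integral_norm_comb)
    also have "\<dots> \<le> 2 ^ k * (1 / 4) ^ k"
      using N0[OF N_N0[OF that]] by (intro mult_left_mono) (auto intro: less_imp_le)
    also have "\<dots> = (1 / 2) ^ k" by (simp flip: power_mult_distrib)
    finally show ?thesis .
  qed
  then have W_sum: "summable (\<lambda>k. LINT x|M. W k x)"
    by (intro summable_comparison_test'[OF summable_geometric[of "1 / 2 :: real"], of 1])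
       (simp_all add: W0)
  have nn: "(\<integral>\<^sup>+ x. ennreal (W k x) \<partial>M) = ennreal (LINT x|M. W k x)" for k
    by (rule nn_integral_eq_integral[OF W_int]) (simp add: W0)
  have Wm[measurable]: "W k \<in> borel_measurable M" for k using W_int by (rule borel_measurable_integrable)
  have "(\<integral>\<^sup>+ x. (\<Sum>k. ennreal (W k x)) \<partial>M) = (\<Sum>k. ennreal (LINT x|M. W k x))"
    by (subst nn_integral_suminf) (simp_all add: nn)
  also have "\<dots> = ennreal (\<Sum>k. LINT x|M. W k x)"
    by (rule suminf_ennreal2[OF _ W_sum]) (simp add: W0)
  finally have "AE x in M. (\<Sum>k. ennreal (W k x)) \<noteq> \<infinity>"
    by (intro nn_integral_PInf_AE) simp_all
  then have W_AE: "AE x in M. summable (\<lambda>k. W k x)"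
    by eventually_elim (rule summable_suminf_not_top, simp_all add: W0)
  define S where "S x = (\<Sum>k. W k x)" for x
  have S_int: "integrable M (\<lambda>x. 2 * S x)"
    unfolding S_def
    by (intro integrable_mult_right integrable_suminf W_int) (use W_AE W_sum in \<open>simp_all add: W0\<close>)
  have part: "(cmod (\<Sum>k<n. D k x))\<^sup>2 \<le> 2 * S x" if x: "summable (\<lambda>k. W k x)" for n x
  proof -
    have e: "(sqrt ((1 / 2) ^ k))\<^sup>2 = (1 / 2) ^ k" for k by simp
    have e2: "(sqrt (W k x))\<^sup>2 = W k x" for k by (simp add: W0)
    have "cmod (D k x) = sqrt ((1 / 2) ^ k) * sqrt (W k x)" for k
      unfolding real_sqrt_mult[symmetric] W_def by (simp add: power_divide)
    then have "(cmod (\<Sum>k<n. D k x))\<^sup>2 \<le> (\<Sum>k<n. sqrt ((1 / 2) ^ k) * sqrt (W k x))\<^sup>2"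
      using norm_sum[of "\<lambda>k. D k x" "{..<n}"] by (intro power_mono) simp_all
    also have "\<dots> \<le> (\<Sum>k<n. (1 / 2) ^ k) * (\<Sum>k<n. W k x)"
      using Cauchy_Schwarz_ineq_sum[of "\<lambda>k. sqrt ((1 / 2) ^ k)" "\<lambda>k. sqrt (W k x)" "{..<n}"]
      unfolding e e2 .
    also have "\<dots> \<le> 2 * S x"
    proof (rule mult_mono)
      show "(\<Sum>k<n. (1 / 2) ^ k) \<le> (2 :: real)"
        using sum_le_suminf[OF summable_geometric[of "1/2 :: real"], of "{..<n}"] suminf_geometric[of "1/2 :: real"] by simp
      show "(\<Sum>k<n. W k x) \<le> S x" unfolding S_def by (rule sum_le_suminf[OF x]) (simp_all add: W0)
    qed (simp_all add: sum_nonneg W0)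
    finally show ?thesis .
  qed
  have conv: "summable (\<lambda>k. D k x)" if x: "summable (\<lambda>k. W k x)" for x
  proof (rule summable_norm_cancel, rule summable_comparison_test')
    show "summable (\<lambda>k. (1 / 2) ^ k + W k x)" by (intro summable_add summable_geometric x) simp
    fix k
    have "sqrt ((1 / 2) ^ k) * sqrt (W k x) \<le> (1 / 2) ^ k + W k x"
      using mult_le_sum_squares[of "sqrt ((1 / 2) ^ k)" "sqrt (W k x)"] by (simp add: W0)
    moreover have "cmod (D k x) = sqrt ((1 / 2) ^ k) * sqrt (W k x)"
      unfolding real_sqrt_mult[symmetric] W_def by (simp add: power_divide)
    ultimately have "cmod (D k x) \<le> (1 / 2) ^ k + W k x" by simp
    then show "norm (cmod (D k x)) \<le> (1 / 2) ^ k + W k x"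
      by (simp only: real_norm_def abs_norm_cancel)
  qed
  \<comment> \<open>Where the blocks do not sum, this is an arbitrary default value; that happens
    only on a null set.\<close>
  define f where "f x = (\<Sum>k. D k x)" for x
  have lim: "AE x in M. (\<lambda>n. \<Sum>k<n. D k x) \<longlonglongrightarrow> f x"
    using W_AE by eventually_elim (unfold f_def, rule summable_LIMSEQ[OF conv])
  have Dm[measurable]: "D k \<in> borel_measurable M" for k using D by (rule square_integrable_measurable)
  have fm[measurable]: "f \<in> borel_measurable M" unfolding f_def[abs_def] by measurable
  have f: "square_integrable M f"
  proof (rule square_integrable_bound[OF fm S_int])
    show "AE x in M. (cmod (f x))\<^sup>2 \<le> 2 * S x"
      using W_AE lim
    proof eventually_elim
      case (elim x)
      have "(\<lambda>n. (cmod (\<Sum>k<n. D k x))\<^sup>2) \<longlonglongrightarrow> (cmod (f x))\<^sup>2"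
        by (intro tendsto_intros elim(2))
      then show ?case by (rule LIMSEQ_le_const2) (use part[OF elim(1)] in auto)
    qed
  qed
  have "(LINT x|M. f x * cnj (e j x)) = c j" for j
  proof -
    have [measurable]: "e j \<in> borel_measurable M" using L2 by (rule square_integrable_measurable)
    have "(\<lambda>n. LINT x|M. (\<Sum>k<n. D k x) * cnj (e j x)) \<longlonglongrightarrow> (LINT x|M. f x * cnj (e j x))"
    proof (rule integral_dominated_convergence[where w = "\<lambda>x. 2 * S x + (cmod (e j x))\<^sup>2"])
      show "integrable M (\<lambda>x. 2 * S x + (cmod (e j x))\<^sup>2)"
        using L2[of j] by (intro Bochner_Integration.integrable_add S_int) (simp add: square_integrable_def)
      show "AE x in M. (\<lambda>n. (\<Sum>k<n. D k x) * cnj (e j x)) \<longlonglongrightarrow> f x * cnj (e j x)"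
        using lim by eventually_elim (intro tendsto_intros)
      show "AE x in M. norm ((\<Sum>k<n. D k x) * cnj (e j x)) \<le> 2 * S x + (cmod (e j x))\<^sup>2" for n
        using W_AE
      proof eventually_elim
        case (elim x)
        show ?case
          using norm_mult_le_sum_squares[of "\<Sum>k<n. D k x" "cnj (e j x)"] part[OF elim, of n] by simp
      qed
    qed measurable
    \<comment> \<open>Once n > j the partial sum contains \<open>e j\<close>, since
      \<open>N n\<close> is at least n; from then on its coefficient is exactly
      \<open>c j\<close>.\<close>
    moreover have "\<forall>\<^sub>F n in sequentially. (LINT x|M. (\<Sum>k<n. D k x) * cnj (e j x)) = c j"
      using eventually_ge_at_top[of "Suc j"]
    proof eventually_elim
      case (elim n)
      then have "j \<in> {..<N n}" using N_ge[of n] by simp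
      then show ?case unfolding F by (subst integral_comb_mult_cnj) simp_all
    qed
    ultimately show ?thesis using LIMSEQ_unique[OF _ tendsto_eventually] by blast
  qed
  then show ?thesis using f by blast
qed

end

section \<open>Square integrable solutions\<close>

lemma in_L2_iff: "in_L2 f \<longleftrightarrow> square_integrable haar f"
  by (simp add: in_L2_def square_integrable_def)

lemma cnj_psi: "cnj (psi_jk j k x) = psi_jk j k x"
  unfolding psi_jk_eq by (simp add: indicator_def)

lemma square_integrable_psi: "square_integrable haar (psi_jk j k)"
  unfolding square_integrable_def
proof
  show "psi_jk j k \<in> borel_measurable haar"
    using locally_integrableD(1)[OF locally_integrable_continuous[OF continuous_psi]] by simp
  have "integrable haar (\<lambda>x. norm (psi_jk j k x * psi_jk j k x))"
    by (intro integrable_norm integral_mult_psi(2) locally_integrable_continuous continuous_psi)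
  then show "integrable haar (\<lambda>x. (cmod (psi_jk j k x))\<^sup>2)" by (simp add: norm_mult power2_eq_square)
qed

text \<open>Enumerates the pairs (j, k) without repetition, so that the results for orthonormal
  sequences apply to the Haar system.\<close>

definition haar_index :: "nat \<Rightarrow> int \<times> nat" where
  "haar_index n = (int_decode (fst (prod_decode n)), snd (prod_decode n))"

lemma haar_index_eq_iff: "haar_index m = haar_index n \<longleftrightarrow> m = n"
  unfolding haar_index_def by (simp add: int_decode_eq prod_eq_iff[symmetric] prod_decode_eq)

lemma haar_index_surj: "haar_index (prod_encode (int_encode j, k)) = (j, k)"
  by (simp add: haar_index_def)

interpretation haar_sequence: orthonormal_sequence haar
  "\<lambda>n. psi_jk (fst (haar_index n)) (snd (haar_index n))"
  by unfold_locales
     (simp_all only: square_integrable_psi cnj_psi psi_orthonormal prod_eq_iff[symmetric] haar_index_eq_iff)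

text \<open>For q < 1 the limit is 1 / \<beta>, which is where \<beta> \<noteq> 0 enters; for q > 1
  it is 0, and for q = 1 the sequence is constant.\<close>

lemma Bseq_inverse_power_add:
  fixes q \<beta> :: real
  assumes "0 < q" "\<beta> \<noteq> 0"
  shows "Bseq (\<lambda>n. 1 / (q ^ n + \<beta>))"
proof -
  consider "q < 1" | "q = 1" | "q > 1" by linarith
  then show ?thesis
  proof cases
    case 1
    then have "(\<lambda>n. 1 / (q ^ n + \<beta>)) \<longlonglongrightarrow> 1 / (0 + \<beta>)"
      using assms by (intro tendsto_intros LIMSEQ_power_zero) auto
    then show ?thesis by (intro convergent_imp_Bseq convergentI)
  next
    case 2
    then show ?thesis by simp
  next
    case 3
    have "filterlim (\<lambda>n. \<beta> + q ^ n) at_infinity sequentially"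
      by (rule tendsto_add_filterlim_at_infinity[OF tendsto_const filterlim_realpow_sequentially_gt1]) (use 3 in simp)
    then have "(\<lambda>n. 1 / (\<beta> + q ^ n)) \<longlonglongrightarrow> 0"
      by (intro tendsto_divide_0[OF tendsto_const])
    then have "(\<lambda>n. 1 / (q ^ n + \<beta>)) \<longlonglongrightarrow> 0" by (simp only: add.commute)
    then show ?thesis by (intro convergent_imp_Bseq convergentI)
  qed
qed

text \<open>Levels j \<ge> 0 are powers of 2^\<alpha> and negative levels are powers of
  2^(-\<alpha>); each half is bounded separately.\<close>

lemma bounded_multiplier:
  assumes "\<beta> \<noteq> 0"
  obtains B where "\<And>j::int. \<bar>1 / (2 powr (real_of_int j * \<alpha>) + \<beta>)\<bar> \<le> B" "0 \<le> B"
proof -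
  let ?q = "2 powr \<alpha>" and ?r = "2 powr (- \<alpha>)"
  obtain B where B: "0 < B" "\<And>n. norm (1 / (?q ^ n + \<beta>)) \<le> B"
    using Bseq_inverse_power_add[of ?q \<beta>] assms unfolding Bseq_def by auto
  obtain C where C: "0 < C" "\<And>n. norm (1 / (?r ^ n + \<beta>)) \<le> C"
    using Bseq_inverse_power_add[of ?r \<beta>] assms unfolding Bseq_def by auto
  have pow: "?q ^ n = 2 powr (n * \<alpha>)" "?r ^ n = 2 powr (- real n * \<alpha>)" for n :: nat
    by (simp_all add: powr_realpow[symmetric] powr_powr mult.commute)
  have "\<bar>1 / (2 powr (real_of_int j * \<alpha>) + \<beta>)\<bar> \<le> max B C" for j
  proof (cases "0 \<le> j")
    case True
    then have h: "real_of_int j = real (nat j)" by simp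
    show ?thesis unfolding h by (rule max.coboundedI1[OF B(2)[of "nat j", unfolded pow real_norm_def]])
  next
    case False
    then have h: "real_of_int j = - real (nat (- j))" by simp
    show ?thesis unfolding h by (rule max.coboundedI2[OF C(2)[of "nat (- j)", unfolded pow real_norm_def]])
  qed
  then show ?thesis using that[of "max B C"] B(1) by simp
qed

lemma regular_dual_haar_poly:
  assumes "locally_integrable f" shows "regular haar_poly f \<in> dual haar_poly"
proof -
  have "linear_functional haar_poly (regular haar_poly f)"
    using linear_functional_subset[OF linear_functional_regular[OF assms] haar_poly_subset_test_fun]
    by (subst linear_functional_cong[OF function_space_haar_poly, where G = "\<lambda>\<phi>. LINT x|haar. f x * \<phi> x"])
       (simp_all add: regular_def)
  then show ?thesis by (simp add: dual_haar_poly_iff regular_def)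
qed

lemma L2_solution:
  assumes g: "g \<in> dual haar_poly" and \<beta>: "\<forall>j::int. \<beta> \<noteq> - (2 powr (real_of_int j * \<alpha>))"
    and g0: "in_L2 g0" "g = regular haar_poly g0" and "\<beta> \<noteq> 0" and f: "solves \<alpha> \<beta> g f"
  shows "\<exists>f0. in_L2 f0 \<and> f = regular haar_poly f0"
proof -
  define a where "a n = (LINT x|haar. g0 x * cnj (psi_jk (fst (haar_index n)) (snd (haar_index n)) x))" for n
  have a: "a n = g (psi_jk (fst (haar_index n)) (snd (haar_index n)))" for n
    unfolding a_def g0(2) cnj_psi by (simp add: regular_def psi_haar_poly)
  have sa: "summable (\<lambda>n. (cmod (a n))\<^sup>2)"
    unfolding a_def by (rule haar_sequence.bessel) (use g0(1) in \<open>simp add: in_L2_iff\<close>)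
  define c where "c n = sol_coeff \<alpha> \<beta> g (fst (haar_index n)) (snd (haar_index n))" for n
  obtain B where B: "\<And>j::int. \<bar>1 / (2 powr (real_of_int j * \<alpha>) + \<beta>)\<bar> \<le> B" "0 \<le> B"
    using bounded_multiplier[OF \<open>\<beta> \<noteq> 0\<close>] by blast
  have "norm ((cmod (c n))\<^sup>2) \<le> B\<^sup>2 * (cmod (a n))\<^sup>2" for n
  proof -
    have "cmod (c n) = \<bar>1 / (2 powr (real_of_int (fst (haar_index n)) * \<alpha>) + \<beta>)\<bar> * cmod (a n)"
      unfolding c_def sol_coeff_def a norm_divide norm_of_real by simp
    also have "\<dots> \<le> B * cmod (a n)" by (intro mult_right_mono B) simp
    finally have "(cmod (c n))\<^sup>2 \<le> (B * cmod (a n))\<^sup>2" by (intro power_mono) simp_all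
    then show ?thesis by (simp add: power_mult_distrib)
  qed
  then have "summable (\<lambda>n. (cmod (c n))\<^sup>2)"
    by (rule summable_comparison_test'[OF summable_mult[OF sa]])
  then obtain f0 where f0: "square_integrable haar f0"
    "\<And>n. (LINT x|haar. f0 x * cnj (psi_jk (fst (haar_index n)) (snd (haar_index n)) x)) = c n"
    using haar_sequence.riesz_fischer by blast
  have "f = regular haar_poly f0"
  proof (rule dual_haar_poly_eqI)
    show "f \<in> dual haar_poly" using f by (simp add: solves_def)
    show "regular haar_poly f0 \<in> dual haar_poly"
      using f0(1) by (intro regular_dual_haar_poly locally_integrable_L2) (simp add: in_L2_iff)
    fix j k
    have "regular haar_poly f0 (psi_jk j k) = sol_coeff \<alpha> \<beta> g j k"
      using f0(2)[of "prod_encode (int_encode j, k)"]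
      unfolding haar_index_surj c_def cnj_psi by (simp add: regular_def psi_haar_poly)
    then show "f (psi_jk j k) = regular haar_poly f0 (psi_jk j k)"
      using f solves_unique(1)[OF g \<beta>] by simp
  qed
  then show ?thesis using f0(1) by (auto simp: in_L2_iff)
qed

section \<open>The coefficient system\<close>

lemma linear_functional_vanishing_on_haar_poly:
  assumes F: "linear_functional test_fun F" and psi: "\<And>j k. F (psi_jk j k) = 0" and \<phi>: "\<phi> \<in> test_fun"
  shows "F \<phi> = F (\<lambda>x. indicator (cyl 0 0) x) * (LINT x|haar. \<phi> x)"
proof -
  let ?c = "LINT x|haar. \<phi> x"
  let ?\<theta> = "\<lambda>x. \<phi> x - ?c * indicator (cyl 0 0) x"
  have zero: "linear_functional haar_poly (\<lambda>_. 0)" by (simp add: linear_functional_def)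
  have \<theta>: "?\<theta> \<in> haar_poly" by (rule test_fun_mean_haar_poly[OF \<phi>])
  have "F ?\<theta> = 0"
    by (rule linear_functional_haar_poly_eqI[OF linear_functional_subset[OF F haar_poly_subset_test_fun] zero psi \<theta>])
  moreover have "F \<phi> = F (\<lambda>x. ?\<theta> x + ?c * indicator (cyl 0 0) x)" by simp
  moreover have "\<dots> = F ?\<theta> + F (\<lambda>x. ?c * indicator (cyl 0 0) x)"
    by (rule linear_functionalD(1)[OF F subsetD[OF haar_poly_subset_test_fun \<theta>]])
       (rule function_spaceD(3)[OF function_space_test_fun indicator_cyl_test_fun])
  moreover have "F (\<lambda>x. ?c * indicator (cyl 0 0) x) = ?c * F (\<lambda>x. indicator (cyl 0 0) x)"
    by (rule linear_functionalD(2)[OF F indicator_cyl_test_fun])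
  ultimately show ?thesis by simp
qed

text \<open>With \<open>cpt_double_Suc\<close>: the halves of cylinder k at level n are cylinders 2k
  and 2k + 1 at level n + 1.\<close>

lemma cpt_double: "cpt (n + 1) (2 * k) = cpt n k"
proof -
  have "coord (cpt (n + 1) (2 * k)) l = coord (cpt n k) l" for l
  proof (cases "l < n")
    case True
    then have "nat (n - l) = Suc (nat (n - l - 1))" by simp
    then show ?thesis using True by (simp add: bit_Suc)
  qed (auto simp: bit_0)
  then show ?thesis by (simp add: cantor_eq_iff)
qed

lemma cpt_double_Suc: "cpt (n + 1) (2 * k + 1) = cpt n k + single n"
proof -
  have "coord (cpt (n + 1) (2 * k + 1)) l = coord (cpt n k + single n) l" for l
  proof (cases "l < n")
    case True
    then have "nat (n - l) = Suc (nat (n - l - 1))" by simp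
    then show ?thesis using True unfolding coord_add_single by (simp add: bit_Suc)
  next
    case False
    then show ?thesis unfolding coord_add_single by (auto simp: bit_0)
  qed
  then show ?thesis unfolding cantor_eq_iff by blast
qed

text \<open>A cylinder of level - l consists of the 2^l unit cylinders whose index gives q after
  deletion of the last l binary digits.\<close>

lemma indicator_cyl_neg_eq_sum:
  "indicator (cyl (- int l) (cpt (- int l) q)) x = (\<Sum>m = 0..<2 ^ l. phi_jk 0 (2 ^ l * q + m) x)"
proof -
  obtain i where i: "x \<in> cyl 0 (cpt 0 i)" using exists_cyl_cpt by auto
  have phi: "phi_jk 0 n x = (if n = i then 1 else 0)" for n
    unfolding phi_0k_eq by (cases "n = i") (use i cyl_cpt_unique[OF i, of n] in \<open>auto simp: indicator_def\<close>)
  have "x \<in> cyl (- int l) (cpt (- int l) q) \<longleftrightarrow> cpt 0 i \<in> cyl (- int l) (cpt (- int l) q)"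
    using mem_cyl_mono[OF i, of "- int l"] unfolding mem_cyl by simp
  also have "\<dots> \<longleftrightarrow> q = i div 2 ^ l" using cpt_mem_cyl_cpt_iff[of 0 i l q] by simp
  finally have x: "x \<in> cyl (- int l) (cpt (- int l) q) \<longleftrightarrow> q = i div 2 ^ l" .
  have eq: "2 ^ l * q + m = i \<longleftrightarrow> m = i mod 2 ^ l" if "q = i div 2 ^ l" for m
    using mult_div_mod_eq[of "2 ^ l" i] that by (metis add_left_cancel)
  have neq: "2 ^ l * q + m \<noteq> i" if "q \<noteq> i div 2 ^ l" "m < 2 ^ l" for m
    using that by auto
  show ?thesis
  proof (cases "q = i div 2 ^ l")
    case True
    have "(\<Sum>m = 0..<2 ^ l. phi_jk 0 (2 ^ l * q + m) x) = (\<Sum>m = 0..<2 ^ l. if m = i mod 2 ^ l then 1 else 0)"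
      unfolding phi eq[OF True] by (rule refl)
    also have "\<dots> = 1" by simp
    finally show ?thesis using True x by (simp add: indicator_def)
  next
    case False
    have "(\<Sum>m = 0..<2 ^ l. phi_jk 0 (2 ^ l * q + m) x) = 0"
      unfolding phi using neq[OF False] by (intro sum.neutral) simp
    then show ?thesis using False x by (simp add: indicator_def)
  qed
qed

text \<open>The origin of the coefficient system: the two halves, with indices 2k and 2k + 1 at
  level 1 - j, are cut into unit cylinders. The normalising factor moves to the other side as
  2^(j/2).\<close>

lemma psi_neg_eq_sum:
  assumes "j \<ge> 1"
  shows "psi_jk (- int j) k x = of_real (2 powr (- real j / 2)) *
    ((\<Sum>m = 0..<2 ^ (j - 1). phi_jk 0 (2 ^ j * k + m) x) - (\<Sum>m = 2 ^ (j - 1)..<2 ^ j. phi_jk 0 (2 ^ j * k + m) x))"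
proof -
  obtain l where l: "j = Suc l" using assms by (metis Suc_le_D One_nat_def)
  have n: "- int j + 1 = - int l" by (simp add: l)
  have j1: "j - 1 = l" by (simp add: l)
  have j2: "(2::nat) ^ j = 2 ^ l + 2 ^ l" unfolding l power_Suc by (rule mult_2)
  have c0: "cpt (- int j) k = cpt (- int l) (2 * k)" and
    c1: "cpt (- int j) k + single (- int j) = cpt (- int l) (2 * k + 1)"
    using cpt_double[of "- int j" k] cpt_double_Suc[of "- int j" k] by (simp_all only: n)
  have s1: "indicator (cyl (- int l) (cpt (- int l) (2 * k))) x = (\<Sum>m = 0..<2 ^ (j - 1). phi_jk 0 (2 ^ j * k + m) x)"
    unfolding indicator_cyl_neg_eq_sum by (simp add: l mult_ac)
  have "(\<Sum>m = 2 ^ (j - 1)..<2 ^ j. phi_jk 0 (2 ^ j * k + m) x) = (\<Sum>m = 0 + 2 ^ l..<2 ^ l + 2 ^ l. phi_jk 0 (2 ^ j * k + m) x)"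
    by (simp only: j1 j2 add_0)
  also have "\<dots> = (\<Sum>m = 0..<2 ^ l. phi_jk 0 (2 ^ l * (2 * k + 1) + m) x)"
    unfolding sum.shift_bounds_nat_ivl by (rule sum.cong) (simp_all add: l algebra_simps)
  finally have s2: "indicator (cyl (- int l) (cpt (- int l) (2 * k + 1))) x = (\<Sum>m = 2 ^ (j - 1)..<2 ^ j. phi_jk 0 (2 ^ j * k + m) x)"
    unfolding indicator_cyl_neg_eq_sum by simp
  show ?thesis unfolding psi_jk_eq n c1 unfolding c0 s1 s2 by simp
qed

lemma linear_functional_psi_neg:
  assumes F: "linear_functional test_fun F" and "j \<ge> 1"
  shows "F (psi_jk (- int j) k) = of_real (2 powr (- real j / 2)) *
    ((\<Sum>m = 0..<2 ^ (j - 1). F (phi_jk 0 (2 ^ j * k + m))) - (\<Sum>m = 2 ^ (j - 1)..<2 ^ j. F (phi_jk 0 (2 ^ j * k + m))))"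
proof -
  let ?h = "complex_of_real (2 powr (- real j / 2))"
  \<comment> \<open>Merging both sums into a single signed linear combination lets linearity be
    applied once.\<close>
  let ?s = "\<lambda>m. if m < 2 ^ (j - 1) then ?h else - ?h"
  have le: "(2::nat) ^ (j - 1) \<le> 2 ^ j" by (rule power_increasing) simp_all
  have split: "?h * ((\<Sum>m = 0..<2 ^ (j - 1). u m) - (\<Sum>m = 2 ^ (j - 1)..<2 ^ j. u m)) = (\<Sum>m\<in>{0..<2 ^ j}. ?s m * u m)" for u :: "nat \<Rightarrow> complex"
  proof -
    have "(\<Sum>m\<in>{0..<2 ^ j}. ?s m * u m) = (\<Sum>m = 0..<2 ^ (j - 1). ?s m * u m) + (\<Sum>m = 2 ^ (j - 1)..<2 ^ j. ?s m * u m)"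
      by (rule sum.atLeastLessThan_concat[symmetric]) (use le in auto)
    also have "\<dots> = (\<Sum>m = 0..<2 ^ (j - 1). ?h * u m) + (\<Sum>m = 2 ^ (j - 1)..<2 ^ j. - (?h * u m))"
      by (intro arg_cong2[where f = "(+)"] sum.cong) auto
    finally show ?thesis by (simp add: sum_distrib_left sum_negf right_diff_distrib)
  qed
  have "psi_jk (- int j) k = (\<lambda>x. \<Sum>m\<in>{0..<2 ^ j}. ?s m * phi_jk 0 (2 ^ j * k + m) x)"
    by (rule ext) (simp only: psi_neg_eq_sum[OF assms(2)] split)
  then have "F (psi_jk (- int j) k) = F (\<lambda>x. \<Sum>m\<in>{0..<2 ^ j}. ?s m * phi_jk 0 (2 ^ j * k + m) x)"
    by (rule arg_cong)
  also have "\<dots> = (\<Sum>m\<in>{0..<2 ^ j}. ?s m * F (phi_jk 0 (2 ^ j * k + m)))"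
    by (rule linear_functional_sum[OF function_space_test_fun F _ phi_test_fun]) simp
  finally show ?thesis unfolding split .
qed

text \<open>The system says exactly that \<open>F\<close> has the right pairings at negative levels.
  The constant c drops out because it occurs equally often with either sign.\<close>

lemma coeff_system_iff:
  assumes F: "linear_functional test_fun F" and a: "\<And>i. F (phi_jk 0 i) = a i + c"
  shows "coeff_system \<alpha> \<beta> g a \<longleftrightarrow> (\<forall>j\<ge>1. \<forall>k. F (psi_jk (- int j) k) = sol_coeff \<alpha> \<beta> g (- int j) k)"
proof -
  have "((\<Sum>m = 0..<2 ^ (j - 1). a (2 ^ j * k + m)) - (\<Sum>m = 2 ^ (j - 1)..<2 ^ j. a (2 ^ j * k + m))
      = of_real (2 powr (real j / 2)) * s) \<longleftrightarrow> F (psi_jk (- int j) k) = s" if j: "j \<ge> 1" for j k s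
  proof -
    obtain l where l: "j = Suc l" using j by (metis Suc_le_D One_nat_def)
    have r: "complex_of_real (2 powr (- real j / 2)) * of_real (2 powr (real j / 2)) = 1"
      by (simp flip: of_real_mult powr_add)
    have "(\<Sum>m = 2 ^ (j - 1)..<(2 :: nat) ^ j. c) = (\<Sum>m = 0..<(2 :: nat) ^ (j - 1). c)" by (simp add: l)
    then have "F (psi_jk (- int j) k) = of_real (2 powr (- real j / 2)) *
        ((\<Sum>m = 0..<2 ^ (j - 1). a (2 ^ j * k + m)) - (\<Sum>m = 2 ^ (j - 1)..<2 ^ j. a (2 ^ j * k + m)))"
      unfolding linear_functional_psi_neg[OF F j] a sum.distrib by (simp add: l)
    moreover have "X = p * Y \<longleftrightarrow> r * X = Y" if "r * p = (1::complex)" for X Y p r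
      using that by (metis mult.assoc mult.commute mult.left_neutral)
    ultimately show ?thesis using r by simp
  qed
  then show ?thesis unfolding coeff_system_def by simp
qed

text \<open>Take the functional with the required Haar coefficients, extend it to test functions,
  and read off its values on the \<phi>.\<close>

lemma exists_coeff_system:
  assumes "g \<in> dual haar_poly" and "\<forall>j::int. \<beta> \<noteq> - (2 powr (real_of_int j * \<alpha>))"
  shows "\<exists>a. coeff_system \<alpha> \<beta> g a"
proof -
  obtain f where "f \<in> dual haar_poly" and psi: "\<forall>j k. f (psi_jk j k) = sol_coeff \<alpha> \<beta> g j k"
    using exists_dual_haar_poly by blast
  then have f: "linear_functional haar_poly f" by (simp add: dual_haar_poly_iff)
  let ?F = "\<lambda>\<phi>. f (\<lambda>x. \<phi> x - (LINT y|haar. \<phi> y) * indicator (cyl 0 0) x)"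
  have "coeff_system \<alpha> \<beta> g (\<lambda>i. ?F (phi_jk 0 i))"
    by (subst coeff_system_iff[OF linear_functional_extend[OF f], where c = 0])
       (simp_all add: integral_psi psi)
  then show ?thesis by blast
qed

lemma finite_phi_coeffs:
  assumes "\<phi> \<in> test_fun"
  shows "finite {k. (LINT x|haar. phi_jk 0 k x * \<phi> x) \<noteq> 0}"
proof -
  obtain m K where K: "m \<ge> (0::int)" "\<And>x y. y \<in> cyl m x \<Longrightarrow> \<phi> y = \<phi> x" "compact K" "\<And>x. x \<notin> K \<Longrightarrow> \<phi> x = 0"
    using test_fun_uniform[OF assms, where n = 0] by auto
  have "{k. (LINT x|haar. phi_jk 0 k x * \<phi> x) \<noteq> 0} \<subseteq> {k. cyl 0 (cpt 0 k) \<inter> K \<noteq> {}}"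
  proof (intro Collect_mono impI notI)
    fix k assume nz: "(LINT x|haar. phi_jk 0 k x * \<phi> x) \<noteq> 0" and e: "cyl 0 (cpt 0 k) \<inter> K = {}"
    have "phi_jk 0 k x * \<phi> x = 0" for x
      unfolding phi_0k_eq using e K(4)[of x] by (auto simp: indicator_def)
    then have "(LINT x|haar. phi_jk 0 k x * \<phi> x) = 0" by (simp only: Bochner_Integration.integral_zero)
    then show False using nz by (rule notE[rotated])
  qed
  then show ?thesis using finite_cpt_meeting_compact[OF K(3)] finite_subset by blast
qed

text \<open>From the level of constancy on, the coefficients vanish by cancellation; each of the
  finitely many levels below has only finitely many cylinders meeting the support.\<close>

lemma finite_psi_coeffs_nonneg:
  assumes "\<phi> \<in> test_fun"
  shows "finite {i. (LINT x|haar. psi_jk (int (fst i)) (snd i) x * \<phi> x) \<noteq> 0}"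
proof -
  obtain m K where K: "m \<ge> (0::int)" "\<And>x y. y \<in> cyl m x \<Longrightarrow> \<phi> y = \<phi> x" "compact K" "\<And>x. x \<notin> K \<Longrightarrow> \<phi> x = 0"
    using test_fun_uniform[OF assms, where n = 0] by auto
  have "{i. (LINT x|haar. psi_jk (int (fst i)) (snd i) x * \<phi> x) \<noteq> 0} \<subseteq>
      Sigma {..<nat m} (\<lambda>j. {k. cyl (int j) (cpt (int j) k) \<inter> K \<noteq> {}})"
  proof
    fix i assume "i \<in> {i. (LINT x|haar. psi_jk (int (fst i)) (snd i) x * \<phi> x) \<noteq> 0}"
    moreover obtain j k where i: "i = (j, k)" by (cases i)
    ultimately have nz: "(LINT x|haar. \<phi> x * psi_jk (int j) k x) \<noteq> 0" by (simp add: mult.commute)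
    have "j < nat m"
    proof (rule ccontr)
      assume "\<not> j < nat m"
      then have "m \<le> int j" by simp
      then have "\<phi> x = \<phi> (cpt (int j) k)" if "x \<in> cyl (int j) (cpt (int j) k)" for x
        using K(2) mem_cyl_mono[OF that] by simp
      then show False using integral_mult_psi_const nz by blast
    qed
    moreover have "cyl (int j) (cpt (int j) k) \<inter> K \<noteq> {}"
    proof
      assume e: "cyl (int j) (cpt (int j) k) \<inter> K = {}"
      have "\<phi> x = 0" if "x \<in> cyl (int j) (cpt (int j) k)" for x
        using K(4) e that by blast
      then show False using integral_mult_psi_const nz by blast
    qed
    ultimately show "i \<in> Sigma {..<nat m} (\<lambda>j. {k. cyl (int j) (cpt (int j) k) \<inter> K \<noteq> {}})" by (simp add: i)
  qed
  moreover have "finite (Sigma {..<nat m} (\<lambda>j. {k. cyl (int j) (cpt (int j) k) \<inter> K \<noteq> {}}))"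
    by (intro finite_SigmaI finite_cpt_meeting_compact K(3)) simp
  ultimately show ?thesis by (rule finite_subset)
qed

lemma linear_functional_regular_restrict:
  assumes "locally_integrable f" shows "linear_functional test_fun (regular test_fun f)"
  unfolding regular_def
  by (subst linear_functional_cong[OF function_space_test_fun, where G = "\<lambda>\<phi>. LINT x|haar. f x * \<phi> x"])
     (simp_all add: linear_functional_regular[OF assms])

section \<open>The family of candidate solutions\<close>

context
  fixes \<alpha> \<beta> :: real and g :: "(cantor \<Rightarrow> complex) \<Rightarrow> complex" and a :: "nat \<Rightarrow> complex"
begin

lemma sol_family_eq:
  assumes "\<phi> \<in> test_fun"
  shows "sol_family \<alpha> \<beta> g a c \<phi> = (\<Sum>\<^sub>\<infinity>k. a k * (LINT x|haar. phi_jk 0 k x * \<phi> x)) +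
    (\<Sum>\<^sub>\<infinity>i. sol_coeff \<alpha> \<beta> g (int (fst i)) (snd i) * (LINT x|haar. psi_jk (int (fst i)) (snd i) x * \<phi> x)) +
    (LINT x|haar. c * \<phi> x)"
  using assms by (simp add: sol_family_def quasi_haar_series_def regular_def case_prod_unfold)

lemma linear_functional_sol_family: "linear_functional test_fun (sol_family \<alpha> \<beta> g a c)"
  by (subst linear_functional_cong[OF function_space_test_fun sol_family_eq], assumption)
     (intro linear_functional_add linear_functional_infsum linear_functional_regular
        locally_integrable_continuous continuous_on_const continuous_psi
        test_fun_continuous phi_test_fun finite_phi_coeffs finite_psi_coeffs_nonneg)

lemma sol_family_phi: "sol_family \<alpha> \<beta> g a c (phi_jk 0 i) = a i + c"
proof -
  have "(LINT x|haar. psi_jk (int j) k x * phi_jk 0 i x) = 0" for j k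
    using integral_phi_psi[of "int j" i k] by (simp add: mult.commute)
  moreover have "(\<Sum>\<^sub>\<infinity>k. a k * (LINT x|haar. phi_jk 0 k x * phi_jk 0 i x)) = a i"
    by (subst infsum_finite_support[of "{i}"]) (auto simp: integral_phi_phi)
  moreover have "(LINT x|haar. c * phi_jk 0 i x) = c"
    by (simp only: integral_mult_phi cyl_integral_const) simp
  ultimately show ?thesis by (simp add: sol_family_eq[OF phi_test_fun])
qed

lemma sol_family_psi_nonneg: "sol_family \<alpha> \<beta> g a c (psi_jk (int j) k) = sol_coeff \<alpha> \<beta> g (int j) k"
proof -
  have "(LINT x|haar. phi_jk 0 i x * psi_jk (int j) k x) = 0" for i
    using integral_phi_psi[of "int j" i k] by simp
  moreover have "(\<Sum>\<^sub>\<infinity>i. sol_coeff \<alpha> \<beta> g (int (fst i)) (snd i) *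
      (LINT x|haar. psi_jk (int (fst i)) (snd i) x * psi_jk (int j) k x)) = sol_coeff \<alpha> \<beta> g (int j) k"
    by (subst infsum_finite_support[of "{(j, k)}"]) (auto simp: psi_orthonormal prod_eq_iff)
  moreover have "(LINT x|haar. c * psi_jk (int j) k x) = 0"
    by (rule integral_mult_psi_const[OF refl])
  ultimately show ?thesis by (simp add: sol_family_eq[OF psi_test_fun])
qed

text \<open>Orthonormality gives the levels j \<ge> 0. Negative levels are absent from the series,
  and their pairings are fixed through the values on the \<phi> by the coefficient system.\<close>

lemma sol_family_psi:
  assumes "coeff_system \<alpha> \<beta> g a"
  shows "sol_family \<alpha> \<beta> g a c (psi_jk j k) = sol_coeff \<alpha> \<beta> g j k"
proof (cases "0 \<le> j")
  case True
  then show ?thesis using sol_family_psi_nonneg[of c "nat j" k] by simp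
next
  case False
  have "\<forall>i\<ge>1. \<forall>k. sol_family \<alpha> \<beta> g a c (psi_jk (- int i) k) = sol_coeff \<alpha> \<beta> g (- int i) k"
    by (rule iffD1[OF coeff_system_iff[OF linear_functional_sol_family sol_family_phi] assms])
  from this[rule_format, of "nat (- j)" k] False show ?thesis by simp
qed

lemma sol_family_extensional: "sol_family \<alpha> \<beta> g a c \<in> extensional test_fun"
  by (simp add: sol_family_def)

lemma sol_family_dual: "sol_family \<alpha> \<beta> g a c \<in> dual test_fun"
  by (simp add: dual_test_fun_iff sol_family_extensional linear_functional_sol_family)

lemma restrict_sol_family_solves:
  assumes "g \<in> dual haar_poly" "\<forall>j::int. \<beta> \<noteq> - (2 powr (real_of_int j * \<alpha>))" "coeff_system \<alpha> \<beta> g a"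
  shows "solves \<alpha> \<beta> g (restrict (sol_family \<alpha> \<beta> g a c) haar_poly)"
proof -
  have "linear_functional haar_poly (restrict (sol_family \<alpha> \<beta> g a c) haar_poly)"
    using linear_functional_subset[OF linear_functional_sol_family haar_poly_subset_test_fun]
    by (subst linear_functional_cong[OF function_space_haar_poly, where G = "sol_family \<alpha> \<beta> g a c"]) simp_all
  then show ?thesis
    by (simp add: solves_unique(1)[OF assms(1,2)] dual_haar_poly_iff psi_haar_poly sol_family_psi[OF assms(3)])
qed

lemma solves_regular_iff:
  assumes g: "g \<in> dual haar_poly" "\<forall>j::int. \<beta> \<noteq> - (2 powr (real_of_int j * \<alpha>))"
    and a: "coeff_system \<alpha> \<beta> g a" and f: "continuous_on UNIV f"
  shows "solves \<alpha> \<beta> g (regular haar_poly f) \<longleftrightarrow> (\<exists>c. regular test_fun f = sol_family \<alpha> \<beta> g a c)"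
proof
  note li = locally_integrable_continuous[OF f]
  have reg: "regular haar_poly f (psi_jk j k) = regular test_fun f (psi_jk j k)" for j k
    by (simp add: regular_def psi_haar_poly psi_test_fun)
  {
    assume "\<exists>c. regular test_fun f = sol_family \<alpha> \<beta> g a c"
    then obtain c where c: "regular test_fun f = sol_family \<alpha> \<beta> g a c" by blast
    show "solves \<alpha> \<beta> g (regular haar_poly f)"
      unfolding solves_unique(1)[OF g] reg c using regular_dual_haar_poly[OF li] sol_family_psi[OF a] by blast
  next
    assume "solves \<alpha> \<beta> g (regular haar_poly f)"
    then have psi: "regular test_fun f (psi_jk j k) = sol_coeff \<alpha> \<beta> g j k" for j k
      unfolding solves_unique(1)[OF g] reg by blast
    let ?F = "\<lambda>\<phi>. regular test_fun f \<phi> + - 1 * sol_family \<alpha> \<beta> g a 0 \<phi>"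
    \<comment> \<open>The difference from the member with constant 0 kills all Haar functions, so it
      is a multiple of the integral. The factor is read off on the unit ball, whose measure is
      1.\<close>
    define c where "c = ?F (\<lambda>x. indicator (cyl 0 0) x)"
    have F: "linear_functional test_fun ?F"
      by (intro linear_functional_add linear_functional_mult linear_functional_sol_family
          linear_functional_regular_restrict li)
    have "regular test_fun f \<phi> = sol_family \<alpha> \<beta> g a c \<phi>" if "\<phi> \<in> test_fun" for \<phi>
    proof -
      have "?F \<phi> = c * (LINT x|haar. \<phi> x)"
        unfolding c_def
        by (rule linear_functional_vanishing_on_haar_poly[OF F _ that]) (simp add: psi sol_family_psi[OF a])
      moreover have "sol_family \<alpha> \<beta> g a c \<phi> = sol_family \<alpha> \<beta> g a 0 \<phi> + c * (LINT x|haar. \<phi> x)"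
        by (simp add: sol_family_eq[OF that])
      ultimately show ?thesis by (simp add: diff_eq_eq add.commute)
    qed
    then have "regular test_fun f = sol_family \<alpha> \<beta> g a c"
      by (intro extensionalityI[OF _ sol_family_extensional]) (simp_all add: regular_def)
    then show "\<exists>c. regular test_fun f = sol_family \<alpha> \<beta> g a c" by blast
  }
qed

end

section \<open>Continuous solutions\<close>

lemma Bseq_power_div:
  fixes q \<beta> :: real
  assumes "1 < q"
  shows "Bseq (\<lambda>n. q ^ n / (q ^ n + \<beta>))"
proof -
  have "(\<lambda>n. 1 / (1 + \<beta> * (1 / q) ^ n)) \<longlonglongrightarrow> 1 / (1 + \<beta> * 0)"
    using assms by (intro tendsto_intros LIMSEQ_power_zero) auto
  moreover have "1 / (1 + \<beta> * (1 / q) ^ n) = q ^ n / (q ^ n + \<beta>)" for n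
  proof -
    have "q ^ n + \<beta> = q ^ n * (1 + \<beta> * (1 / q) ^ n)" using assms by (simp add: power_divide field_simps)
    then show ?thesis using assms by simp
  qed
  ultimately show ?thesis by (intro convergent_imp_Bseq convergentI) simp
qed

text \<open>The difference equals (1 - q) q^n / ((q^n + \<beta>)(q^(n+1) + \<beta>)). For q < 1 the
  denominators are bounded away from 0 and q^n decays; for q > 1 the quotient q^n / (q^n + \<beta>)
  is bounded and the remaining factor decays like q^(-n-1).\<close>

lemma summable_multiplier_diff:
  fixes q \<beta> :: real
  assumes q: "0 < q" "\<beta> \<noteq> 0 \<or> 1 \<le> q" and nz: "\<And>n. q ^ n + \<beta> \<noteq> 0"
  shows "summable (\<lambda>n. \<bar>1 / (q ^ Suc n + \<beta>) - 1 / (q ^ n + \<beta>)\<bar>)"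
proof -
  have eq: "\<bar>1 / (q ^ Suc n + \<beta>) - 1 / (q ^ n + \<beta>)\<bar> =
      \<bar>1 - q\<bar> * (q ^ n * \<bar>1 / (q ^ n + \<beta>)\<bar> * \<bar>1 / (q ^ Suc n + \<beta>)\<bar>)" for n
  proof -
    have "1 / (q ^ Suc n + \<beta>) - 1 / (q ^ n + \<beta>) = (1 - q) * (q ^ n * (1 / (q ^ n + \<beta>)) * (1 / (q ^ Suc n + \<beta>)))"
      using nz[of n] nz[of "Suc n"] by (simp add: divide_simps) (simp add: algebra_simps)
    then show ?thesis using q(1) by (simp add: abs_mult)
  qed
  consider "q < 1" "\<beta> \<noteq> 0" | "q = 1" | "1 < q" using q by linarith
  then show ?thesis
  proof cases
    case 1
    obtain B where B: "0 < B" "\<And>n. norm (1 / (q ^ n + \<beta>)) \<le> B"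
      using Bseq_inverse_power_add[OF q(1) 1(2)] unfolding Bseq_def by auto
    have "summable (\<lambda>n. \<bar>1 - q\<bar> * (q ^ n * B * B))"
      using 1(1) q(1) by (intro summable_mult summable_mult2 summable_geometric) simp
    then show ?thesis
    proof (rule summable_comparison_test')
      fix n
      have "q ^ n * \<bar>1 / (q ^ n + \<beta>)\<bar> * \<bar>1 / (q ^ Suc n + \<beta>)\<bar> \<le> q ^ n * B * B"
        using B(2)[of n] B(2)[of "Suc n"] q(1) B(1) unfolding real_norm_def by (intro mult_mono) simp_all
      then show "norm \<bar>1 / (q ^ Suc n + \<beta>) - 1 / (q ^ n + \<beta>)\<bar> \<le> \<bar>1 - q\<bar> * (q ^ n * B * B)"
        unfolding real_norm_def abs_idempotent unfolding eq by (intro mult_left_mono) simp_all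
    qed
  next
    case 2
    then show ?thesis by simp
  next
    case 3
    obtain B where B: "0 < B" "\<And>n. norm (q ^ n / (q ^ n + \<beta>)) \<le> B"
      using Bseq_power_div[OF 3] unfolding Bseq_def by auto
    have "summable (\<lambda>n. \<bar>1 - q\<bar> * (B * (B * (1 / q) ^ Suc n)))"
      using 3 by (intro summable_mult summable_mult2 summable_geometric iffD2[OF summable_Suc_iff]) simp
    then show ?thesis
    proof (rule summable_comparison_test')
      fix n
      have a: "q ^ n * \<bar>1 / (q ^ n + \<beta>)\<bar> \<le> B" for n
        using B(2)[of n] q(1) unfolding real_norm_def by (simp add: abs_divide)
      have "\<bar>1 / (q ^ Suc n + \<beta>)\<bar> = (q ^ Suc n * \<bar>1 / (q ^ Suc n + \<beta>)\<bar>) * (1 / q) ^ Suc n"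
        using q(1) by (simp add: power_divide)
      also have "\<dots> \<le> B * (1 / q) ^ Suc n"
        using q(1) by (intro mult_right_mono a) simp
      finally have "q ^ n * \<bar>1 / (q ^ n + \<beta>)\<bar> * \<bar>1 / (q ^ Suc n + \<beta>)\<bar> \<le> B * (B * (1 / q) ^ Suc n)"
        using B(1) q(1) by (intro mult_mono a) simp_all
      then show "norm \<bar>1 / (q ^ Suc n + \<beta>) - 1 / (q ^ n + \<beta>)\<bar> \<le> \<bar>1 - q\<bar> * (B * (B * (1 / q) ^ Suc n))"
        unfolding real_norm_def abs_idempotent unfolding eq by (intro mult_left_mono) simp_all
    qed
  qed
qed

text \<open>The conditional expectation of f given the cylinders of level n. In Haar terms it
  truncates the expansion, keeping the coefficients with j < n.\<close>

definition cyl_average :: "int \<Rightarrow> (cantor \<Rightarrow> complex) \<Rightarrow> cantor \<Rightarrow> complex" where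
  "cyl_average n f x = of_real (2 powi n) * cyl_integral n x f"

lemma cyl_integral_cyl_eq: "y \<in> cyl n x \<Longrightarrow> cyl_integral n y f = cyl_integral n x f"
  unfolding cyl_integral_def using cyl_eqI by simp

lemma cyl_average_const: "y \<in> cyl n x \<Longrightarrow> cyl_average n f y = cyl_average n f x"
  unfolding cyl_average_def using cyl_integral_cyl_eq by simp

lemma continuous_cyl_average: "continuous_on UNIV (cyl_average n f)"
  by (rule continuous_on_locally_const, rule eventually_nhds_cyl[of n]) (rule cyl_average_const)

text \<open>Downward induction from level i, where the average is constant on the cylinder; each
  coarser cylinder is the sum of its halves.\<close>

lemma cyl_integral_cyl_average:
  assumes f: "locally_integrable f" and "n \<le> i"
  shows "cyl_integral n b (cyl_average i f) = cyl_integral n b f"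
  using \<open>n \<le> i\<close>
proof (induction n arbitrary: b rule: int_le_induct)
  case base
  have "cyl_integral i b (cyl_average i f) = cyl_integral i b (\<lambda>_. cyl_average i f b)"
    by (rule cyl_integral_cong) (rule cyl_average_const)
  also have "\<dots> = of_real (2 powi (- i) * 2 powi i) * cyl_integral i b f"
    unfolding cyl_integral_const cyl_average_def by simp
  also have "2 powi (- i) * 2 powi i = (1 :: real)" by (simp add: power_int_minus)
  finally show ?case by simp
next
  case (step n)
  show ?case
    using cyl_integral_split[OF locally_integrable_continuous[OF continuous_cyl_average], of "n - 1" b i f]
      cyl_integral_split[OF f, of "n - 1" b] step.IH by simp
qed

lemma integral_cyl_average_psi:
  assumes f: "locally_integrable f"
  shows "(LINT x|haar. cyl_average i f x * psi_jk j k x) = (if j < i then LINT x|haar. f x * psi_jk j k x else 0)"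
proof (cases "j < i")
  case True
  then show ?thesis
    by (simp add: integral_mult_psi(1)[OF f] integral_mult_psi(1)[OF locally_integrable_continuous[OF continuous_cyl_average]]
        cyl_integral_cyl_average[OF f])
next
  case False
  have "(LINT x|haar. cyl_average i f x * psi_jk j k x) = 0"
  proof (rule integral_mult_psi_const)
    fix x assume "x \<in> cyl j (cpt j k)"
    then have "x \<in> cyl i (cpt j k)" using False by (simp add: mem_cyl_mono)
    then show "cyl_average i f x = cyl_average i f (cpt j k)" by (rule cyl_average_const)
  qed
  then show ?thesis using False by simp
qed

lemma norm_cyl_average_le:
  assumes f: "locally_integrable f" and B: "\<And>y. y \<in> cyl n b \<Longrightarrow> cmod (f y) \<le> B" and "n \<le> i" "x \<in> cyl n b"
  shows "cmod (cyl_average i f x) \<le> B"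
proof -
  have "cmod (cyl_integral i x f) \<le> (LINT y|haar. indicator (cyl i x) y * B)"
    unfolding cyl_integral_def
  proof (rule order_trans[OF Bochner_Integration.integral_norm_bound integral_mono])
    show "integrable haar (\<lambda>y. cmod (indicator (cyl i x) y * f y))"
      by (rule integrable_norm[OF locally_integrableD(2)[OF f]])
    show "integrable haar (\<lambda>y. indicator (cyl i x) y * B)"
      by (intro integrable_mult_left integrable_real_indicator) simp_all
    fix y
    have "cmod (f y) \<le> B" if "y \<in> cyl i x"
      using B cyl_subset[OF assms(4,3)] that by blast
    then show "cmod (indicator (cyl i x) y * f y) \<le> indicator (cyl i x) y * B" by (simp add: indicator_def)
  qed
  also have "\<dots> = 2 powi (- i) * B" by simp
  finally have "2 powi i * cmod (cyl_integral i x f) \<le> 2 powi i * (2 powi (- i) * B)"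
    by (intro mult_left_mono) simp_all
  also have "\<dots> = B" by (simp add: power_int_minus)
  finally show ?thesis unfolding cyl_average_def norm_mult norm_of_real by simp
qed

text \<open>Abel summation of \<open>\<Sum>\<^sub>j m j * (E (j+1) - E j)\<close>, where \<open>E j\<close> is the average of \<open>f\<close> over
  cylinders of level \<open>j\<close>, in terms of the errors \<open>E j - f\<close>. In this form the series converges
  locally uniformly as soon as the multiplier \<open>m\<close> has bounded variation.\<close>

lemma exists_continuous_multiplier:
  fixes m :: "nat \<Rightarrow> real"
  assumes f: "continuous_on UNIV f" and m: "summable (\<lambda>i. \<bar>m (Suc i) - m i\<bar>)"
  shows "\<exists>F. continuous_on UNIV F \<and> (\<forall>k. (LINT x|haar. F x * phi_jk 0 k x) = 0) \<and>
    (\<forall>j k. (LINT x|haar. F x * psi_jk (int j) k x) = of_real (m j) * (LINT x|haar. f x * psi_jk (int j) k x))"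
proof -
  note li = locally_integrable_continuous[OF f]
  \<comment> \<open>Here \<open>E\<close> is the error of the average, not the average itself. Its
    pairing with a Haar function of level j vanishes for j < i and is minus that of f
    otherwise.\<close>
  define E where "E i x = cyl_average (int i) f x - f x" for i x
  have E_cont: "continuous_on UNIV (E i)" for i
    unfolding E_def[abs_def] by (intro continuous_intros continuous_cyl_average f)
  define d where "d i = m (Suc i) - m i" for i
  define T where "T i x = complex_of_real (d i) * E (Suc i) x" for i x
  have T_cont: "continuous_on UNIV (T i)" for i
    unfolding T_def[abs_def] by (intro continuous_intros E_cont)
  \<comment> \<open>Bounds are taken over one unit cylinder at a time, because f may be unbounded on
    the whole group. This is enough: continuity is local, and each function tested below is
    supported in one unit cylinder.\<close>
  have T_bound: "\<exists>M. summable M \<and> (\<forall>i. \<forall>x\<in>cyl 0 b. cmod (T i x) \<le> M i)" for b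
  proof -
    obtain B where B: "\<And>x. x \<in> cyl 0 b \<Longrightarrow> cmod (f x) \<le> B"
      using bounded_on_cyl[OF f, where n = 0 and a = b] by auto
    have "cmod (T i x) \<le> \<bar>d i\<bar> * (B + B)" if x: "x \<in> cyl 0 b" for i x
    proof -
      have "cmod (E (Suc i) x) \<le> cmod (cyl_average (int (Suc i)) f x) + cmod (f x)"
        unfolding E_def by (rule norm_triangle_ineq4)
      also have "\<dots> \<le> B + B" by (intro add_mono B x norm_cyl_average_le[OF li B _ x]) simp_all
      finally show ?thesis unfolding T_def norm_mult norm_of_real by (rule mult_left_mono) simp
    qed
    then show ?thesis using summable_mult2[OF m] unfolding d_def by blast
  qed
  define Q where "Q x = (\<Sum>i. T i x)" for x
  have Q_cont: "continuous_on UNIV Q"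
  proof (rule continuous_at_imp_continuous_on, rule ballI)
    fix b :: cantor
    obtain M where M: "summable M" "\<And>i x. x \<in> cyl 0 b \<Longrightarrow> cmod (T i x) \<le> M i"
      using T_bound[of b] by auto
    have "uniform_limit (cyl 0 b) (\<lambda>n x. \<Sum>i<n. T i x) (\<lambda>x. suminf (\<lambda>i. T i x)) sequentially"
      by (rule Weierstrass_m_test[OF M(2) M(1)])
    then have "continuous_on (cyl 0 b) Q"
      unfolding Q_def[abs_def]
      by (rule uniform_limit_theorem[rotated])
         (auto intro!: continuous_intros continuous_on_subset[OF T_cont] always_eventually)
    then show "isCont Q b" by (simp add: continuous_on_eq_continuous_at)
  qed
  have T_sums: "(LINT x|haar. Q x * \<phi> x) = (\<Sum>i. LINT x|haar. T i x * \<phi> x)"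
    if \<phi>: "\<phi> \<in> test_fun" and supp: "\<And>x. x \<notin> cyl 0 b \<Longrightarrow> \<phi> x = 0" for \<phi> b
  proof -
    obtain M where M: "summable M" "\<And>i x. x \<in> cyl 0 b \<Longrightarrow> cmod (T i x) \<le> M i"
      using T_bound[of b] by auto
    have le: "cmod (T i x * \<phi> x) \<le> M i * cmod (\<phi> x)" for i x
    proof (cases "x \<in> cyl 0 b")
      case True
      then show ?thesis unfolding norm_mult by (intro mult_right_mono M) simp_all
    next
      case False
      then show ?thesis by (simp add: supp)
    qed
    have int: "integrable haar (\<lambda>x. T i x * \<phi> x)" for i
      by (intro integrable_mult_test_fun locally_integrable_continuous T_cont \<phi>)
    have sm: "summable (\<lambda>i. cmod (T i x * \<phi> x))" for x
      by (rule summable_comparison_test'[OF summable_mult2[OF M(1), of "cmod (\<phi> x)"]]) (use le in simp)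
    have "Q x * \<phi> x = (\<Sum>i. T i x * \<phi> x)" for x
    proof (cases "x \<in> cyl 0 b")
      case True
      have "summable (\<lambda>i. T i x)"
        by (rule summable_norm_cancel, rule summable_comparison_test'[OF M(1)]) (use M(2)[OF True] in simp)
      then show ?thesis unfolding Q_def by (rule suminf_mult2)
    next
      case False
      then show ?thesis by (simp add: supp)
    qed
    then have "(LINT x|haar. Q x * \<phi> x) = (LINT x|haar. (\<Sum>i. T i x * \<phi> x))" by (simp only:)
    also have "\<dots> = (\<Sum>i. LINT x|haar. T i x * \<phi> x)"
    proof (rule integral_suminf[OF int])
      show "AE x in haar. summable (\<lambda>i. norm (T i x * \<phi> x))" using sm by simp
      show "summable (\<lambda>i. LINT x|haar. norm (T i x * \<phi> x))"
      proof (rule summable_comparison_test'[OF summable_mult2[OF M(1), of "LINT x|haar. cmod (\<phi> x)"]])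
        fix i
        have "(LINT x|haar. norm (T i x * \<phi> x)) \<le> (LINT x|haar. M i * cmod (\<phi> x))"
          by (intro integral_mono integrable_norm int integrable_mult_right integrable_test_fun \<phi> le)
        then show "norm (LINT x|haar. norm (T i x * \<phi> x)) \<le> M i * (LINT x|haar. cmod (\<phi> x))" by simp
      qed
    qed
    finally show ?thesis .
  qed
  have E_phi: "(LINT x|haar. E i x * phi_jk 0 k x) = 0" for i k
  proof -
    have "E i x * phi_jk 0 k x = cyl_average (int i) f x * phi_jk 0 k x - f x * phi_jk 0 k x" for x
      by (simp add: E_def algebra_simps)
    then have "(LINT x|haar. E i x * phi_jk 0 k x) = (LINT x|haar. cyl_average (int i) f x * phi_jk 0 k x) - (LINT x|haar. f x * phi_jk 0 k x)"
      by (simp add: integrable_mult_test_fun[OF _ phi_test_fun] li locally_integrable_continuous[OF continuous_cyl_average])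
    then show ?thesis by (simp add: integral_mult_phi cyl_integral_cyl_average[OF li])
  qed
  have E_psi: "(LINT x|haar. E i x * psi_jk (int j) k x) = (if j < i then 0 else - (LINT x|haar. f x * psi_jk (int j) k x))" for i j k
  proof -
    have "E i x * psi_jk (int j) k x = cyl_average (int i) f x * psi_jk (int j) k x - f x * psi_jk (int j) k x" for x
      by (simp add: E_def algebra_simps)
    then have "(LINT x|haar. E i x * psi_jk (int j) k x) = (LINT x|haar. cyl_average (int i) f x * psi_jk (int j) k x) - (LINT x|haar. f x * psi_jk (int j) k x)"
      by (simp add: integrable_mult_test_fun[OF _ psi_test_fun] li locally_integrable_continuous[OF continuous_cyl_average])
    then show ?thesis by (simp add: integral_cyl_average_psi[OF li])
  qed
  have T_E: "(LINT x|haar. T i x * \<phi> x) = of_real (d i) * (LINT x|haar. E (Suc i) x * \<phi> x)" for i \<phi>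
    unfolding T_def mult.assoc by simp
  \<comment> \<open>Abel summation of m j (E (j+1) - E j) leaves -m 0 * E 0, minus the sum of the
    \<open>T i\<close>, plus a boundary term m n * E n that tends to 0. The formula omits that term,
    and the coefficients are verified directly.\<close>
  define F where "F x = - (of_real (m 0) * E 0 x) - Q x" for x
  have F_cont: "continuous_on UNIV F"
    unfolding F_def[abs_def] by (intro continuous_intros E_cont Q_cont)
  have F_int: "(LINT x|haar. F x * \<phi> x) = - (of_real (m 0) * (LINT x|haar. E 0 x * \<phi> x)) - (LINT x|haar. Q x * \<phi> x)"
    if \<phi>: "\<phi> \<in> test_fun" for \<phi>
  proof -
    have "F x * \<phi> x = - (of_real (m 0) * (E 0 x * \<phi> x)) - Q x * \<phi> x" for x
      by (simp add: F_def algebra_simps)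
    then show ?thesis
      by (simp add: integrable_mult_test_fun[OF _ \<phi>] locally_integrable_continuous E_cont Q_cont)
  qed
  have F_phi: "(LINT x|haar. F x * phi_jk 0 k x) = 0" for k
  proof -
    have "(LINT x|haar. Q x * phi_jk 0 k x) = (\<Sum>i. LINT x|haar. T i x * phi_jk 0 k x)"
      by (rule T_sums[OF phi_test_fun, of "cpt 0 k"]) (simp add: phi_0k_eq)
    then show ?thesis unfolding F_int[OF phi_test_fun] T_E E_phi by simp
  qed
  have F_psi: "(LINT x|haar. F x * psi_jk (int j) k x) = of_real (m j) * (LINT x|haar. f x * psi_jk (int j) k x)" for j k
  proof -
    let ?I = "LINT x|haar. f x * psi_jk (int j) k x"
    have "(LINT x|haar. Q x * psi_jk (int j) k x) = (\<Sum>i. LINT x|haar. T i x * psi_jk (int j) k x)"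
    proof (rule T_sums[OF psi_test_fun, of "cpt (int j) k"])
      fix x assume "x \<notin> cyl 0 (cpt (int j) k)"
      then show "psi_jk (int j) k x = 0" using mem_cyl_mono[of x "int j" "cpt (int j) k" 0] psi_jk_support by auto
    qed
    \<comment> \<open>\<open>T i\<close> contains the error at level i + 1, which level j sees only
      if i + 1 \<le> j. The finite sum telescopes to m j - m 0, and the term with \<open>E 0\<close>
      restores m 0.\<close>
    also have "\<dots> = (\<Sum>i. if i < j then - (of_real (d i) * ?I) else 0)"
      unfolding T_E E_psi by (rule suminf_cong) auto
    also have "\<dots> = (\<Sum>i<j. - (of_real (d i) * ?I))"
      by (subst suminf_finite[of "{..<j}"]) auto
    also have "\<dots> = - (of_real (\<Sum>i<j. d i) * ?I)"
      by (simp add: sum_negf sum_distrib_right)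
    also have "(\<Sum>i<j. d i) = m j - m 0"
      unfolding d_def by (rule sum_lessThan_telescope)
    finally show ?thesis unfolding F_int[OF psi_test_fun] E_psi by (simp add: algebra_simps)
  qed
  show ?thesis using F_cont F_phi F_psi by blast
qed

text \<open>The solution is assembled from two pieces: a function constant on unit cylinders with
  values a k + c, invisible to \<psi> with j \<ge> 0, and the multiplier transform of
  \<open>g0\<close>, invisible to the \<phi>.\<close>

lemma exists_continuous_solution:
  assumes g0: "continuous_on UNIV g0" "g = regular haar_poly g0"
    and \<beta>: "\<forall>j::int. \<beta> \<noteq> - (2 powr (real_of_int j * \<alpha>))" and "\<beta> \<noteq> 0 \<or> \<alpha> \<ge> 0"
  shows "\<exists>f. continuous_on UNIV f \<and> regular test_fun f = sol_family \<alpha> \<beta> g a c"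
proof -
  let ?q = "2 powr \<alpha>"
  define m where "m n = 1 / (?q ^ n + \<beta>)" for n
  have pow: "?q ^ n = 2 powr (real_of_int (int n) * \<alpha>)" for n
    by (simp add: powr_realpow[symmetric] powr_powr mult.commute)
  have "?q ^ n + \<beta> \<noteq> 0" for n
    unfolding pow using \<beta>[rule_format, of "int n"] by linarith
  then have "summable (\<lambda>i. \<bar>m (Suc i) - m i\<bar>)"
    unfolding m_def using assms(4) by (intro summable_multiplier_diff) (auto simp: ge_one_powr_ge_zero)
  then obtain F where F: "continuous_on UNIV F" "\<And>k. (LINT x|haar. F x * phi_jk 0 k x) = 0"
    "\<And>j k. (LINT x|haar. F x * psi_jk (int j) k x) = of_real (m j) * (LINT x|haar. g0 x * psi_jk (int j) k x)"
    using exists_continuous_multiplier[OF g0(1), of m] by blast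
  have co: "of_real (m j) * (LINT x|haar. g0 x * psi_jk (int j) k x) = sol_coeff \<alpha> \<beta> g (int j) k" for j k
    unfolding sol_coeff_def g0(2) m_def pow by (simp add: regular_def psi_haar_poly)
  define A where "A x = a (SOME k. x \<in> cyl 0 (cpt 0 k))" for x
  have A: "A x = a k" if "x \<in> cyl 0 (cpt 0 k)" for x k
    unfolding A_def using someI[of "\<lambda>k. x \<in> cyl 0 (cpt 0 k)", OF that] cyl_cpt_unique[OF that] by simp
  have A_const: "A y = A x" if "y \<in> cyl 0 x" for x y
  proof -
    obtain k where k: "x \<in> cyl 0 (cpt 0 k)" using exists_cyl_cpt by auto
    then have "y \<in> cyl 0 (cpt 0 k)" using that cyl_eqI[OF k] by simp
    then show ?thesis using A k by simp
  qed
  have A_cont: "continuous_on UNIV A"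
    by (rule continuous_on_locally_const, rule eventually_nhds_cyl[of 0]) (rule A_const)
  define f where "f x = (A x + c) + F x" for x
  have f: "continuous_on UNIV f" unfolding f_def[abs_def] by (intro continuous_intros A_cont F(1))
  have Ac: "continuous_on UNIV (\<lambda>x. A x + c)" by (intro continuous_intros A_cont)
  have f_int: "(LINT x|haar. f x * \<phi> x) = (LINT x|haar. (A x + c) * \<phi> x) + (LINT x|haar. F x * \<phi> x)"
    if "\<phi> \<in> test_fun" for \<phi>
    unfolding f_def distrib_right[of "A _ + c"]
    by (intro Bochner_Integration.integral_add integrable_mult_test_fun locally_integrable_continuous Ac F(1) that)
  have "regular test_fun f \<phi> = sol_family \<alpha> \<beta> g a c \<phi>" if "\<phi> \<in> test_fun" for \<phi>
  proof (rule linear_functional_test_fun_eqI[OF _ _ _ _ that])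
    show "linear_functional test_fun (regular test_fun f)"
      by (intro linear_functional_regular_restrict locally_integrable_continuous f)
    show "linear_functional test_fun (sol_family \<alpha> \<beta> g a c)" by (rule linear_functional_sol_family)
    fix k
    have "(LINT x|haar. (A x + c) * phi_jk 0 k x) = cyl_integral 0 (cpt 0 k) (\<lambda>_. a k + c)"
      unfolding integral_mult_phi by (rule cyl_integral_cong) (simp add: A)
    then show "regular test_fun f (phi_jk 0 k) = sol_family \<alpha> \<beta> g a c (phi_jk 0 k)"
      unfolding sol_family_phi by (simp add: regular_def phi_test_fun f_int F(2) cyl_integral_const)
    fix j
    have "(LINT x|haar. (A x + c) * psi_jk (int j) k x) = 0"
    proof (rule integral_mult_psi_const)
      fix x assume "x \<in> cyl (int j) (cpt (int j) k)"
      then have "x \<in> cyl 0 (cpt (int j) k)" by (rule mem_cyl_mono) simp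
      then show "A x + c = A (cpt (int j) k) + c" using A_const by simp
    qed
    then show "regular test_fun f (psi_jk (int j) k) = sol_family \<alpha> \<beta> g a c (psi_jk (int j) k)"
      unfolding sol_family_psi_nonneg by (simp add: regular_def psi_test_fun f_int F(3) co)
  qed
  then have "regular test_fun f = sol_family \<alpha> \<beta> g a c"
    by (intro extensionalityI[OF _ sol_family_extensional]) (simp_all add: regular_def)
  then show ?thesis using f by blast
qed

text \<open>The f_c are kept as functionals on test functions, and continuous functions are matched
  with them through \<open>regular\<close>. Two solutions of the system differ by a constant
  sequence, which is absorbed into c, so each a yields all continuous solutions. That every f_c is a
  continuous function is asserted for \<beta> \<noteq> 0 or \<alpha> \<ge> 0, where the multiplier
  has bounded variation over j \<ge> 0; for \<beta> = 0 and \<alpha> < 0 it is 2^(-j\<alpha>), which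
  is unbounded there.\<close>

theorem theorem4:
  fixes \<alpha> \<beta> :: real and g :: "(cantor \<Rightarrow> complex) \<Rightarrow> complex"
  assumes "g \<in> dual haar_poly"
    and "\<forall>j::int. \<beta> \<noteq> - (2 powr (real_of_int j * \<alpha>))"
  shows "(\<exists>!f. solves \<alpha> \<beta> g f) \<and>
    ((\<exists>g\<^sub>0. in_L2 g\<^sub>0 \<and> g = regular haar_poly g\<^sub>0) \<and> \<beta> \<noteq> 0 \<longrightarrow>
      (\<forall>f. solves \<alpha> \<beta> g f \<longrightarrow> (\<exists>f\<^sub>0. in_L2 f\<^sub>0 \<and> f = regular haar_poly f\<^sub>0))) \<and>
    ((\<exists>g\<^sub>0. continuous_on UNIV g\<^sub>0 \<and> g = regular haar_poly g\<^sub>0) \<and>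
        (\<beta> \<noteq> 0 \<or> \<beta> = 0 \<and> \<alpha> > - 1 / 2) \<longrightarrow>
      (\<exists>a. coeff_system \<alpha> \<beta> g a) \<and>
      (\<forall>a. coeff_system \<alpha> \<beta> g a \<longrightarrow>
        (\<forall>f. continuous_on UNIV f \<longrightarrow>
          (solves \<alpha> \<beta> g (regular haar_poly f) \<longleftrightarrow>
            (\<exists>c. regular test_fun f = sol_family \<alpha> \<beta> g a c))) \<and>
        (\<forall>c. sol_family \<alpha> \<beta> g a c \<in> dual test_fun \<and>
             solves \<alpha> \<beta> g (restrict (sol_family \<alpha> \<beta> g a c) haar_poly)) \<and>
        (\<beta> \<noteq> 0 \<or> \<alpha> \<ge> 0 \<longrightarrow>
          (\<forall>c. \<exists>f. continuous_on UNIV f \<and> regular test_fun f = sol_family \<alpha> \<beta> g a c)) \<and>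
        (\<forall>c c'. haar_repr (sol_family \<alpha> \<beta> g a c) = haar_repr (sol_family \<alpha> \<beta> g a c'))))"
proof (intro conjI impI allI)
  note g = assms
  show "\<exists>!f. solves \<alpha> \<beta> g f" by (rule solves_unique(2)[OF g])
  show "\<exists>a. coeff_system \<alpha> \<beta> g a" by (rule exists_coeff_system[OF g])
  show "\<exists>f\<^sub>0. in_L2 f\<^sub>0 \<and> f = regular haar_poly f\<^sub>0"
    if "(\<exists>g\<^sub>0. in_L2 g\<^sub>0 \<and> g = regular haar_poly g\<^sub>0) \<and> \<beta> \<noteq> 0" "solves \<alpha> \<beta> g f" for f
    using L2_solution[OF g] that by blast
  fix a assume a: "coeff_system \<alpha> \<beta> g a"
  show "solves \<alpha> \<beta> g (regular haar_poly f) \<longleftrightarrow> (\<exists>c. regular test_fun f = sol_family \<alpha> \<beta> g a c)"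
    if "continuous_on UNIV f" for f
    by (rule solves_regular_iff[OF g a that])
  show "sol_family \<alpha> \<beta> g a c \<in> dual test_fun" for c by (rule sol_family_dual)
  show "solves \<alpha> \<beta> g (restrict (sol_family \<alpha> \<beta> g a c) haar_poly)" for c
    by (rule restrict_sol_family_solves[OF g a])
  show "\<exists>f. continuous_on UNIV f \<and> regular test_fun f = sol_family \<alpha> \<beta> g a c"
    if "(\<exists>g\<^sub>0. continuous_on UNIV g\<^sub>0 \<and> g = regular haar_poly g\<^sub>0) \<and> (\<beta> \<noteq> 0 \<or> \<beta> = 0 \<and> \<alpha> > - 1 / 2)"
      "\<beta> \<noteq> 0 \<or> \<alpha> \<ge> 0" for c
    using exists_continuous_solution[OF _ _ g(2) that(2)] that(1) by blast
  show "haar_repr (sol_family \<alpha> \<beta> g a c) = haar_repr (sol_family \<alpha> \<beta> g a c')" for c c'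
    by (intro ext) (simp add: haar_repr_def sol_family_psi[OF a])
qed

end
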